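(* Let $1<q<p<\infty$ and assume (N1)–(N2). Then for every $\epsilon>0$ and $\bar u\in L^p(\Omega;\mathbb R^d)$ there exists $\delta>0$ such that for all $u,v\in B_{L^p}(\bar u,\delta)$ there exists $M\in\partial^\circ\mathfrak H[\bar u]$ satisfying $$\|\mathfrak H[u]-\mathfrak H[v]-M(u-v)\|_{L^q(\Omega;\mathbb R^n)}<\epsilon\|u-v\|_{L^p(\Omega;\mathbb R^d)}.$$
   Context: Let $(\Omega,\mathcal F,\mu)$ be a complete finite measure space and $H\colon\Omega\times\mathbb R^d\to\mathbb R^n$. For $x\in\Omega$ and $z\in\mathbb R^d$, $\partial^CH(x,z)$ denotes the Clarke generalized Jacobian of $H(x,\cdot)$ at $z$: the convex hull of all limits $\lim_k J_zH(x,z_k)$ with $z_k\to z$ and $z_k$ outside a Lebesgue-null set off which $H(x,\cdot)$ is differentiable ($J_z$ = Jacobian matrix in $z$); it is a subset of $\mathbb R^{n\times d}$. (N1): $H$ is $(\mathcal F\otimes\mathcal B(\mathbb R^d),\mathcal B(\mathbb R^n))$-measurable and $z\mapsto H(x,z)$ is locally Lipschitz for every $x\in\Omega$. (N2): there exist $C_H>0$ and $1<q\le p<\infty$ with $|H(x,z)|\le C_H(1+|z|^{p/q})$ for all $(x,z)$, and $|M|\le C_H(1+|z|^{p/q-1})$ for all $M\in\partial^CH(x,z)$ and all $(x,z)$. The Nemytskii operator $\mathfrak H\colon L^p(\Omega;\mathbb R^d)\to L^q(\Omega;\mathbb R^n)$ is $\mathfrak H[u](x)=H(x,u(x))$. For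 $u\in L^p(\Omega;\mathbb R^d)$, $\partial^\circ\mathfrak H[u]$ is the set of all $\mathcal F$-measurable $A\colon\Omega\to\mathbb R^{n\times d}$ with $A(x)\in\partial^CH(x,u(x))$ for $\mu$-a.e. $x$; such $A$ acts on $w\in L^p$ by $(Aw)(x)=A(x)w(x)$. $B_{L^p}(\bar u,\delta)$ is a closed ball.
   Formalization: The formal theorem requires u and v to be different elements of L^p (‖u−v‖ ≠ 0), because for u = v the strict inequality reads 0 < 0 and is false. *)

theory Defs
  imports "HOL-Analysis.Analysis"
begin

definition Lp_mem :: "'a measure \<Rightarrow> real \<Rightarrow> ('a \<Rightarrow> 'b::euclidean_space) \<Rightarrow> bool" where
  "Lp_mem M p f \<longleftrightarrow> f \<in> borel_measurable M \<and> integrable M (\<lambda>x. norm (f x) powr p)"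

definition Lp_norm :: "'a measure \<Rightarrow> real \<Rightarrow> ('a \<Rightarrow> 'b::euclidean_space) \<Rightarrow> real" where
  "Lp_norm M p f = (\<integral>x. norm (f x) powr p \<partial>M) powr (1 / p)"

definition clarke_jac :: "(real^'d \<Rightarrow> real^'n) \<Rightarrow> real^'d \<Rightarrow> (real^'d^'n) set" where
  "clarke_jac f z = convex hull
     {A. \<exists>zs. (\<forall>k. f differentiable (at (zs k))) \<and> zs \<longlonglongrightarrow> z \<and>
             (\<lambda>k. jacobian f (at (zs k))) \<longlonglongrightarrow> A}"

definition clarke_nemytskii ::
    "'a measure \<Rightarrow> ('a \<Rightarrow> real^'d \<Rightarrow> real^'n) \<Rightarrow> ('a \<Rightarrow> real^'d) \<Rightarrow> ('a \<Rightarrow> real^'d^'n) set" where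
  "clarke_nemytskii M H u =
     {A. A \<in> borel_measurable M \<and> (AE x in M. A x \<in> clarke_jac (H x) (u x))}"

end

(* Averaging a locally Lipschitz f over small balls gives an everywhere differentiable function whose
   Jacobian is the average of the Jacobian of f, which exists almost everywhere by Rademacher's
   theorem.  The averages at countably many shifts of z and radii 1/k have closed convex hulls K_r
   that shrink, as r tends to 0, to a subset of the Clarke Jacobian at z, and the mean value theorem
   holds in the form f u - f v = B (u - v) with B in K_r.  Since each K_r is described by countably
   many functions measurable in the parameter x, almost minimizers of |H(x,u) - H(x,v) - A (u - v)|
   over the intersection of the K_r can be chosen measurably.

   If the theorem failed there would be u_k, v_k with distance to the base point so small that both
   converge almost everywhere and are dominated in L^p.  The quotients of the residual by |u_k - v_k|
   then tend to 0 almost everywhere and are dominated in L^(pq/(p-q)), a contradiction. *)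

theory Submission
  imports Defs
begin

section \<open>Lipschitz functions of one variable\<close>

text \<open>The derivative of \<open>H x\<close> exists only off a null set that depends on
  \<open>x\<close>, so its values at countably many prescribed points may carry no information.
  Averages see it almost everywhere, depend continuously on the centre, and are measurable in
  \<open>x\<close> as limits of difference quotients of averages of \<open>H x\<close> itself; this
  is why the selection is built from them.

  The matrix in the mean value theorem belongs to a hull of positive radius and varies with u and v,
  whereas the required matrix must lie in the Clarke Jacobian at the base point. By compactness,
  hulls of small radius are close to their intersection, so an almost minimizer over the
  intersection has a small residual quotient. How small the radius must be depends on
  \<open>x\<close>; dominated convergence along a sequence takes the place of a uniform rate.

  The exponent s = pq/(p-q) is that of Hoelder's inequality, 1/q = 1/p + 1/s, and q < p keeps it
  finite. Since (p/q - 1) s = p, the growth allowed for the Jacobians is exactly what a dominating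
  function built from p-th powers controls.\<close>

lemma local_increase_imp_le:
  fixes G :: "real \<Rightarrow> real"
  assumes "a \<le> b" and cont: "continuous_on {a..b} G"
    and inc: "\<And>x. x \<in> {a..<b} \<Longrightarrow> \<exists>y\<in>{x<..b}. G x \<le> G y"
  shows "G a \<le> G b"
proof -
  define A where "A = {x \<in> {a..b}. G a \<le> G x}"
  have "A = G -` {G a..} \<inter> {a..b}" unfolding A_def by auto
  then have "closed A"
    using cont continuous_closed_preimage[of "{a..b}" G "{G a..}"] by (simp add: Int_commute)
  moreover have "a \<in> A" using assms(1) by (auto simp: A_def)
  moreover have bdd: "bdd_above A" unfolding A_def by (rule bdd_aboveI[of _ b]) auto
  ultimately have S: "Sup A \<in> A" by (intro closed_contains_Sup) auto
  \<comment> \<open>Continuous induction: \<open>inc\<close> would move the supremum of the closed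
    set \<open>A\<close> further to the right unless it is already \<open>b\<close>.\<close>
  have "Sup A = b"
  proof (rule ccontr)
    assume "Sup A \<noteq> b"
    with S have "Sup A \<in> {a..<b}" by (auto simp: A_def)
    from inc[OF this] obtain y where "y \<in> {Sup A<..b}" "G (Sup A) \<le> G y" by auto
    with S have "y \<in> A" "Sup A < y" by (auto simp: A_def)
    then show False using cSup_upper[OF _ bdd, of y] by auto
  qed
  with S show ?thesis by (simp add: A_def)
qed

text \<open>On \<open>C\<close> the function \<open>g\<close> gains at least slope \<open>b\<close>,
  elsewhere it loses at most slope \<open>L\<close>. The proof applies
  \<open>local_increase_imp_le\<close> to \<open>G\<close>: at points of \<open>C\<close> the step
  comes from \<open>freq\<close>, and off \<open>C\<close> closedness makes \<open>m\<close> locally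
  constant while \<open>g s + L * s\<close> is nondecreasing.\<close>

lemma closed_density_le_increment:
  fixes g :: "real \<Rightarrow> real"
  assumes lip: "L-lipschitz_on UNIV g" and C: "closed C" and ab: "\<alpha> \<le> \<beta>" and b: "0 \<le> b + L"
    and freq: "\<And>t \<eta>. t \<in> C \<Longrightarrow> \<eta> > 0 \<Longrightarrow> \<exists>h. 0 < h \<and> h < \<eta> \<and> b * h \<le> g (t + h) - g t"
  shows "(b + L) * measure lborel (C \<inter> {\<alpha>..\<beta>}) \<le> g \<beta> - g \<alpha> + L * (\<beta> - \<alpha>)"
proof -
  have [measurable]: "C \<in> sets borel" using C by auto
  define m where "m s = measure lborel (C \<inter> {\<alpha>..s})" for s
  define G where "G s = g s + L * s - (b + L) * m s" for s
  have fin: "emeasure lborel (C \<inter> {\<alpha>..s}) \<noteq> \<infinity>" for s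
  proof -
    have "emeasure lborel (C \<inter> {\<alpha>..s}) \<le> emeasure lborel {\<alpha>..s}"
      by (intro emeasure_mono) auto
    also have "\<dots> < \<infinity>" by (simp add: emeasure_lborel_Icc_eq)
    finally show ?thesis by simp
  qed
  have split: "m s' = m s + measure lborel (C \<inter> {s<..s'})" if "\<alpha> \<le> s" "s \<le> s'" for s s'
  proof -
    have "C \<inter> {\<alpha>..s'} = (C \<inter> {\<alpha>..s}) \<union> (C \<inter> {s<..s'})" using that by auto
    moreover have "emeasure lborel (C \<inter> {s<..s'}) \<noteq> \<infinity>"
    proof -
      have "emeasure lborel (C \<inter> {s<..s'}) \<le> emeasure lborel (C \<inter> {\<alpha>..s'})"
        using that by (intro emeasure_mono) auto
      then show ?thesis using fin[of s'] by (auto simp: top_unique)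
    qed
    ultimately show ?thesis unfolding m_def using fin[of s]
      by (simp add: measure_Union disjoint_iff)
  qed
  have small: "measure lborel (C \<inter> {s<..s'}) \<le> s' - s" if "s \<le> s'" for s s'
  proof -
    have "measure lborel (C \<inter> {s<..s'}) \<le> measure lborel {s<..s'}"
      using that by (intro measure_mono_fmeasurable) (auto intro: fmeasurableI)
    then show ?thesis using that by simp
  qed
  have gl: "\<bar>g x - g y\<bar> \<le> L * \<bar>x - y\<bar>" for x y
    using lipschitz_onD[OF lip, of x y] by (simp add: dist_real_def)
  have L0: "0 \<le> L" using lipschitz_on_nonneg[OF lip] .
  have "continuous_on {\<alpha>..\<beta>} m"
  proof (rule lipschitz_on_continuous_on[where L=1], rule lipschitz_onI)
    have *: "dist (m x) (m y) \<le> 1 * dist x y" if "\<alpha> \<le> x" "x \<le> y" for x y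
      using split[OF that] small[OF that(2)] that(2) measure_nonneg[of lborel "C \<inter> {x<..y}"]
      by (simp add: dist_real_def)
    show "dist (m x) (m y) \<le> 1 * dist x y" if "x \<in> {\<alpha>..\<beta>}" "y \<in> {\<alpha>..\<beta>}" for x y
      using *[of x y] *[of y x] that by (cases "x \<le> y") (auto simp: dist_commute)
  qed simp
  then have cont: "continuous_on {\<alpha>..\<beta>} G"
    unfolding G_def using lipschitz_on_continuous_on[OF lip]
    by (intro continuous_intros) (auto intro: continuous_on_subset)
  have "G \<alpha> \<le> G \<beta>"
  proof (rule local_increase_imp_le[OF ab cont])
    fix t assume t: "t \<in> {\<alpha>..<\<beta>}"
    show "\<exists>y\<in>{t<..\<beta>}. G t \<le> G y"
    proof (cases "t \<in> C")
      case True
      from freq[OF True, of "\<beta> - t"] t obtain h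
        where h: "0 < h" "h < \<beta> - t" "b * h \<le> g (t + h) - g t" by auto
      have "(b + L) * m (t + h) \<le> (b + L) * (m t + h)"
        using split[of t "t+h"] small[of t "t+h"] h t b by (intro mult_left_mono) auto
      then have "G t \<le> G (t + h)" using h by (simp add: G_def algebra_simps)
      then show ?thesis using h t by (intro bexI[of _ "t+h"]) auto
    next
      case False
      have "open (- C)" using C by auto
      then obtain e where e: "e > 0" "ball t e \<subseteq> - C" using False
        by (meson ComplI openE)
      define y where "y = min \<beta> (t + e/2)"
      have y: "t < y" "y \<le> \<beta>" "y \<le> t + e/2" using t e by (auto simp: y_def)
      have "C \<inter> {t<..y} = {}"
      proof -
        have "x \<in> ball t e" if "x \<in> {t<..y}" for x using that y e by (auto simp: dist_real_def)
        then show ?thesis using e by blast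
      qed
      then have "m y = m t" using split[of t y] y t by simp
      then have "G t \<le> G y" using gl[of y t] y by (simp add: G_def algebra_simps abs_if split: if_splits)
      then show ?thesis using y by auto
    qed
  qed
  moreover have "m \<alpha> = 0"
  proof -
    have "m \<alpha> \<le> measure lborel {\<alpha>..\<alpha>}" unfolding m_def
      by (intro measure_mono_fmeasurable) (auto intro: fmeasurableI)
    then show ?thesis by (simp add: m_def measure_le_0_iff)
  qed
  ultimately show ?thesis unfolding G_def m_def[symmetric] by (simp add: algebra_simps)
qed

lemma density_le_increment:
  fixes g :: "real \<Rightarrow> real"
  assumes lip: "L-lipschitz_on UNIV g" and E[measurable]: "E \<in> sets borel"
    and ab: "\<alpha> \<le> \<beta>" and b: "0 \<le> b + L"
    and freq: "\<And>t \<eta>. t \<in> E \<Longrightarrow> \<eta> > 0 \<Longrightarrow> \<exists>h. 0 < h \<and> h < \<eta> \<and> b * h \<le> g (t + h) - g t"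
  shows "(b + L) * measure lborel (E \<inter> {\<alpha>..\<beta>}) \<le> g \<beta> - g \<alpha> + L * (\<beta> - \<alpha>)"
proof (rule field_le_epsilon)
  fix e :: real assume "e > 0"
  \<comment> \<open>The summand 1 in the denominator covers the case
    \<open>b + L = 0\<close>.\<close>
  define e' where "e' = e / (b + L + 1)"
  have e': "e' > 0" "(b + L) * e' \<le> e" using \<open>e > 0\<close> b by (auto simp: e'_def field_simps)
  obtain C where C: "closed C" "C \<subseteq> E" "E - C \<in> lmeasurable" "emeasure lebesgue (E - C) < ennreal e'"
    using sets_lebesgue_inner_closed[of E e'] e' E by (auto simp: sets_completionI_sets)
  have [measurable]: "C \<in> sets borel" using C by auto
  have "measure lborel (E - C) \<le> e'"
    using C(4) e' by (simp add: measure_def enn2real_leI less_imp_le)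
  have fin: "emeasure lborel (E - C) \<noteq> \<infinity>"
    using C(4) e' by auto
  have "measure lborel (E \<inter> {\<alpha>..\<beta>}) \<le> measure lborel ((C \<inter> {\<alpha>..\<beta>}) \<union> (E - C))"
  proof (intro measure_mono_fmeasurable)
    have "C \<inter> {\<alpha>..\<beta>} \<in> fmeasurable lborel"
      by (rule fmeasurableI2[of "{\<alpha>..\<beta>}"]) (auto intro: fmeasurable_compact)
    moreover have "E - C \<in> fmeasurable lborel" using fin by (intro fmeasurableI) (auto simp: less_top)
    ultimately show "C \<inter> {\<alpha>..\<beta>} \<union> (E - C) \<in> fmeasurable lborel" by (rule fmeasurable.Un)
  qed auto
  also have "\<dots> \<le> measure lborel (C \<inter> {\<alpha>..\<beta>}) + measure lborel (E - C)"
    by (intro measure_Un_le) auto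
  also have "\<dots> \<le> measure lborel (C \<inter> {\<alpha>..\<beta>}) + e'" using \<open>measure lborel (E - C) \<le> e'\<close> by simp
  finally have "(b + L) * measure lborel (E \<inter> {\<alpha>..\<beta>}) \<le> (b + L) * measure lborel (C \<inter> {\<alpha>..\<beta>}) + (b + L) * e'"
    using mult_left_mono[OF _ b] by (metis distrib_left)
  moreover have "(b + L) * measure lborel (C \<inter> {\<alpha>..\<beta>}) \<le> g \<beta> - g \<alpha> + L * (\<beta> - \<alpha>)"
    using C(2) freq by (intro closed_density_le_increment[OF lip C(1) ab b]) auto
  ultimately show "(b + L) * measure lborel (E \<inter> {\<alpha>..\<beta>}) \<le> g \<beta> - g \<alpha> + L * (\<beta> - \<alpha>) + e"
    using e' by linarith
qed

text \<open>Takes the place of the Lebesgue density theorem. A bounded piece \<open>F\<close> of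
  positive measure is covered, up to a null set, by disjoint balls inside an open set barely larger
  than \<open>F\<close>; density at most \<open>k\<close> in each ball then makes \<open>F\<close>
  too small.\<close>

lemma null_set_if_interval_density_less_1:
  fixes E :: "real set"
  assumes E[measurable]: "E \<in> sets borel" and k: "0 \<le> k" "k < 1"
    and dens: "\<And>\<alpha> \<beta>. \<alpha> \<le> \<beta> \<Longrightarrow> measure lborel (E \<inter> {\<alpha>..\<beta>}) \<le> k * (\<beta> - \<alpha>)"
  shows "E \<in> null_sets lborel"
proof -
  have "E \<inter> {- real n..real n} \<in> null_sets lborel" for n
  proof (rule ccontr)
    define F where "F = E \<inter> {- real n..real n}"
    assume "E \<inter> {- real n..real n} \<notin> null_sets lborel"
    then have "F \<notin> null_sets lborel" by (simp add: F_def)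
    have [measurable]: "F \<in> sets borel" by (simp add: F_def)
    have fF: "F \<in> fmeasurable lborel" unfolding F_def
      by (rule fmeasurableI2[of "{- real n..real n}"]) (auto intro: fmeasurable_compact)
    define m where "m = measure lborel F"
    have em: "emeasure lborel F = ennreal m"
      using fF by (simp add: m_def emeasure_eq_measure2)
    have m: "m > 0"
    proof (rule ccontr)
      assume "\<not> m > 0"
      then have "emeasure lborel F = 0" by (simp add: em ennreal_neg)
      then show False using \<open>F \<notin> null_sets lborel\<close> by auto
    qed
    \<comment> \<open>The covering will give \<open>m \<le> k * (m + e) \<le> k * m + e\<close>, so
      any positive \<open>e\<close> below \<open>(1 - k) * m\<close> is contradictory.\<close>
    define e where "e = (1 - k) * m / 2"
    have e: "e > 0" using m k by (simp add: e_def)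
    obtain U where U: "open U" "F \<subseteq> U" "U - F \<in> lmeasurable" "emeasure lebesgue (U - F) < ennreal e"
      using sets_lebesgue_outer_open[of F e] e by (auto simp: sets_completionI_sets)
    have [measurable]: "U \<in> sets borel" using U by auto
    \<comment> \<open>Balls are coded as pairs of centre and radius. Staying inside \<open>U\<close>
      bounds the total length of a disjoint family by the measure of \<open>U\<close>.\<close>
    define K where "K = {(x, r). 0 < r \<and> cball x r \<subseteq> U}"
    obtain C where C: "countable C" "C \<subseteq> K"
      "pairwise (\<lambda>i j. disjnt (cball (fst i) (snd i)) (cball (fst j) (snd j))) C"
      "negligible (F - (\<Union>i\<in>C. cball (fst i) (snd i)))"
    proof (rule Vitali_covering_theorem_cballs[of K snd F fst])
      show "0 < snd i" if "i \<in> K" for i using that by (auto simp: K_def)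
      show "\<exists>i. i \<in> K \<and> x \<in> cball (fst i) (snd i) \<and> snd i < d" if x: "x \<in> F" and d: "0 < d" for x d
      proof -
        obtain r where r: "r > 0" "cball x r \<subseteq> U" using U x open_contains_cball by blast
        have "cball x (min r (d/2)) \<subseteq> U" using r by auto
        then show ?thesis using r d
          by (intro exI[of _ "(x, min r (d/2))"]) (auto simp: K_def)
      qed
    qed
    let ?B = "\<lambda>i. cball (fst i) (snd i) :: real set"
    have disj: "disjoint_family_on ?B C" "disjoint_family_on (\<lambda>i. F \<inter> ?B i) C"
      using C(3) unfolding disjoint_family_on_def pairwise_def disjnt_def by blast+
    have UB: "(\<Union>i\<in>C. ?B i) \<in> sets borel" using C(1) by (intro sets.countable_UN') auto
    have sub: "(\<Union>i\<in>C. ?B i) \<subseteq> U" using C(2) unfolding K_def by fastforce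
    have dB: "emeasure lborel (F \<inter> ?B i) \<le> k * emeasure lborel (?B i)" if "i \<in> C" for i
    proof -
      have r: "0 \<le> snd i" using that C(2) by (auto simp: K_def)
      have B: "?B i = {fst i - snd i..fst i + snd i}" by (simp add: cball_eq_atLeastAtMost)
      have fm: "E \<inter> ?B i \<in> fmeasurable lborel" unfolding B
        by (rule fmeasurableI2[of "{fst i - snd i..fst i + snd i}"]) (auto intro: fmeasurable_compact)
      have "emeasure lborel (F \<inter> ?B i) \<le> emeasure lborel (E \<inter> ?B i)"
        by (intro emeasure_mono) (auto simp: F_def)
      also have "\<dots> = ennreal (measure lborel (E \<inter> ?B i))"
        using fm by (simp add: emeasure_eq_measure2)
      also have "\<dots> \<le> ennreal (k * (2 * snd i))"
        using dens[of "fst i - snd i" "fst i + snd i"] r unfolding B by (intro ennreal_leI) auto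
      also have "\<dots> = k * emeasure lborel (?B i)"
        unfolding B using r k by (simp add: ennreal_mult)
      finally show ?thesis .
    qed
    have "F - (\<Union>i\<in>C. ?B i) \<in> null_sets lborel"
      using C(4) UB by (simp add: negligible_iff_null_sets null_sets_completion_iff)
    moreover have Feq: "F = (F \<inter> (\<Union>i\<in>C. ?B i)) \<union> (F - (\<Union>i\<in>C. ?B i))" by auto
    ultimately have "emeasure lborel F = emeasure lborel (F \<inter> (\<Union>i\<in>C. ?B i))"
      using UB by (subst Feq) (rule emeasure_Un_null_set, auto)
    also have "F \<inter> (\<Union>i\<in>C. ?B i) = (\<Union>i\<in>C. F \<inter> ?B i)" by auto
    also have "emeasure lborel \<dots> = (\<integral>\<^sup>+i. emeasure lborel (F \<inter> ?B i) \<partial>count_space C)"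
      using disj C(1) by (intro emeasure_UN_countable) auto
    also have "\<dots> \<le> (\<integral>\<^sup>+i. k * emeasure lborel (?B i) \<partial>count_space C)"
      using dB by (intro nn_integral_mono) auto
    also have "\<dots> = k * (\<integral>\<^sup>+i. emeasure lborel (?B i) \<partial>count_space C)"
      by (intro nn_integral_cmult) auto
    also have "(\<integral>\<^sup>+i. emeasure lborel (?B i) \<partial>count_space C) = emeasure lborel (\<Union>i\<in>C. ?B i)"
      using disj C(1) by (intro emeasure_UN_countable[symmetric]) auto
    also have "\<dots> \<le> emeasure lborel U" using sub by (intro emeasure_mono) auto
    also have "\<dots> = emeasure lborel (F \<union> (U - F))" using U(2) by (simp add: Un_absorb1)
    also have "\<dots> \<le> emeasure lborel F + emeasure lborel (U - F)"
      by (intro emeasure_subadditive) auto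
    also have "\<dots> \<le> ennreal m + ennreal e"
      using U(4) by (simp add: em)
    finally have "ennreal m \<le> ennreal k * (ennreal m + ennreal e)"
      using em by (simp add: mult_left_mono)
    also have "\<dots> = ennreal (k * (m + e))"
      using k m e by (simp add: ennreal_mult ennreal_plus)
    finally have "m \<le> k * (m + e)" using k m e by (simp add: ennreal_le_iff)
    also have "\<dots> \<le> k * m + e" using k e by (simp add: distrib_left mult_left_le_one_le)
    finally have "(1 - k) * m \<le> e" by (simp add: algebra_simps)
    moreover have "(1 - k) * m > 0" using m k by simp
    ultimately show False unfolding e_def by linarith
  qed
  then have "(\<Union>n. E \<inter> {- real n..real n}) \<in> null_sets lborel" by blast
  moreover have "(\<Union>n. E \<inter> {- real n..real n}) = E"
  proof -
    have "\<exists>n. - real n \<le> x \<and> x \<le> real n" for x :: real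
      using real_arch_simple[of "\<bar>x\<bar>"] by (auto simp: abs_le_iff intro: minus_le_iff[THEN iffD1])
    then show ?thesis by auto
  qed
  ultimately show ?thesis by simp
qed

text \<open>A cluster point \<open>l\<close> exists by compactness, and the sequence is infinitely
  often at least \<open>e\<close> away from it on one fixed side; \<open>a\<close> and
  \<open>b\<close> fit in between. Their rationality leaves only countably many exceptional sets
  later.\<close>

lemma bounded_not_convergent_oscillates:
  fixes q :: "nat \<Rightarrow> real"
  assumes bd: "\<And>k. \<bar>q k\<bar> \<le> B" and nc: "\<not> convergent q"
  obtains a b where "a \<in> \<rat>" "b \<in> \<rat>" "a < b" "\<exists>\<^sub>F k in sequentially. q k < a" "\<exists>\<^sub>F k in sequentially. b < q k"
proof -
  have "compact {-B..B}" by simp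
  moreover have "\<forall>k. q k \<in> {-B..B}" using bd by (auto simp: abs_le_iff minus_le_iff)
  ultimately obtain l r where lr: "strict_mono r" "(q \<circ> r) \<longlonglongrightarrow> l"
    unfolding compact_def by meson
  have freq: "\<exists>\<^sub>F k in sequentially. P (q k)" if "\<forall>\<^sub>F k in sequentially. P ((q \<circ> r) k)" for P
  proof -
    have "\<exists>\<^sub>F k in sequentially. P (q (r k))"
      using that by (auto intro: eventually_frequently)
    then show ?thesis
      using filterlim_subseq[OF lr(1)] unfolding frequently_def filterlim_iff by fastforce
  qed
  from nc have "\<not> q \<longlonglongrightarrow> l" by (auto simp: convergent_def)
  then obtain e where e: "e > 0" "\<exists>\<^sub>F k in sequentially. \<not> dist (q k) l < e"
    unfolding tendsto_iff frequently_def by auto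
  then have "(\<exists>\<^sub>F k in sequentially. l + e \<le> q k) \<or> (\<exists>\<^sub>F k in sequentially. q k \<le> l - e)"
    unfolding frequently_disj_iff[symmetric]
    by (elim frequently_mono[rotated]) (auto simp: dist_real_def abs_if split: if_splits)
  then show thesis
  proof
    assume f: "\<exists>\<^sub>F k in sequentially. l + e \<le> q k"
    obtain a where a: "a \<in> \<rat>" "l < a" "a < l + e" using Rats_dense_in_real[of l "l+e"] e by auto
    obtain b where b: "b \<in> \<rat>" "a < b" "b < l + e" using Rats_dense_in_real[of a "l+e"] a by auto
    have "\<exists>\<^sub>F k in sequentially. q k < a"
      using a order_tendstoD(2)[OF lr(2), of a] by (intro freq) auto
    moreover have "\<exists>\<^sub>F k in sequentially. b < q k"
      using f by (rule frequently_elim1) (use b in auto)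
    ultimately show thesis using that a b by blast
  next
    assume f: "\<exists>\<^sub>F k in sequentially. q k \<le> l - e"
    obtain a where a: "a \<in> \<rat>" "l - e < a" "a < l" using Rats_dense_in_real[of "l-e" l] e by auto
    obtain b where b: "b \<in> \<rat>" "a < b" "b < l" using Rats_dense_in_real[of a l] a by auto
    have "\<exists>\<^sub>F k in sequentially. b < q k"
      using b order_tendstoD(1)[OF lr(2), of b] by (intro freq) auto
    moreover have "\<exists>\<^sub>F k in sequentially. q k < a"
      using f by (rule frequently_elim1) (use a in auto)
    ultimately show thesis using that a b by blast
  qed
qed

text \<open>The increments run only through 1/(k+1): with countably many quotients the set of
  convergence is Borel.\<close>

definition diffquot :: "('a::real_vector \<Rightarrow> 'b::real_vector) \<Rightarrow> 'a \<Rightarrow> nat \<Rightarrow> 'a \<Rightarrow> 'b" where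
  "diffquot f w k x = real (Suc k) *\<^sub>R (f (x + (1 / real (Suc k)) *\<^sub>R w) - f x)"

lemma norm_diffquot_le:
  fixes f :: "'a::real_normed_vector \<Rightarrow> 'b::real_normed_vector"
  assumes "L-lipschitz_on UNIV f"
  shows "norm (diffquot f w k x) \<le> L * norm w"
proof -
  have "norm (f (x + (1 / real (Suc k)) *\<^sub>R w) - f x) \<le> L * norm ((1 / real (Suc k)) *\<^sub>R w)"
    using lipschitz_onD[OF assms, of "x + (1 / real (Suc k)) *\<^sub>R w" x] by (simp add: dist_norm)
  then have "real (Suc k) * norm (f (x + (1 / real (Suc k)) *\<^sub>R w) - f x)
      \<le> real (Suc k) * (L * norm ((1 / real (Suc k)) *\<^sub>R w))"
    by (intro mult_left_mono) auto
  also have "\<dots> = L * norm w" by simp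
  finally show ?thesis by (simp add: diffquot_def)
qed

lemma borel_measurable_diffquot [measurable]:
  fixes f :: "'a::euclidean_space \<Rightarrow> 'b::euclidean_space"
  assumes [measurable]: "f \<in> borel_measurable borel"
  shows "diffquot f w k \<in> borel_measurable borel"
  unfolding diffquot_def by measurable

lemma lipschitz_borel_measurable:
  "L-lipschitz_on UNIV f \<Longrightarrow> f \<in> borel_measurable borel"
  by (intro borel_measurable_continuous_onI lipschitz_on_continuous_on)

lemma frequently_diffquot_step:
  fixes g :: "real \<Rightarrow> real"
  assumes "\<exists>\<^sub>F k in sequentially. b < diffquot g 1 k t" "\<eta> > 0"
  shows "\<exists>h. 0 < h \<and> h < \<eta> \<and> b * h \<le> g (t + h) - g t"
proof -
  have "\<forall>\<^sub>F k in sequentially. inverse (real (Suc k)) < \<eta>"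
    using LIMSEQ_inverse_real_of_nat assms(2) by (rule order_tendstoD(2))
  then obtain k where k: "inverse (real (Suc k)) < \<eta>" "b < diffquot g 1 k t"
    using frequently_eventually_frequently[OF assms(1)] by (metis (mono_tags, lifting) frequently_ex)
  then have "b * (1 / real (Suc k)) \<le> g (t + 1 / real (Suc k)) - g t"
    by (simp add: diffquot_def field_simps)
  then show ?thesis using k by (intro exI[of _ "1 / real (Suc k)"]) (auto simp: inverse_eq_divide)
qed

text \<open>Divergence means oscillation across two rationals \<open>a < b\<close>. On
  \<open>E a b\<close>, arbitrarily small steps achieve slope \<open>b\<close> for \<open>g\<close>
  and slope \<open>- a\<close> for \<open>- g\<close>. Adding the two density estimates cancels the
  increments of \<open>g\<close> and leaves density at most 2L/(b - a + 2L) < 1 in every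
  interval.\<close>

lemma AE_convergent_diffquot_real:
  fixes g :: "real \<Rightarrow> real"
  assumes lip: "L-lipschitz_on UNIV g"
  shows "AE t in lborel. convergent (\<lambda>k. diffquot g 1 k t)"
proof -
  have [measurable]: "g \<in> borel_measurable borel" by (rule lipschitz_borel_measurable[OF lip])
  have bd: "\<bar>diffquot g 1 k t\<bar> \<le> L" for k t
    using norm_diffquot_le[OF lip, of 1 k t] by simp
  have L0: "0 \<le> L" by (rule lipschitz_on_nonneg[OF lip])
  define E where "E a b = {t. (\<forall>N. \<exists>k\<ge>N. diffquot g 1 k t < a) \<and> (\<forall>N. \<exists>k\<ge>N. b < diffquot g 1 k t)}" for a b
  have [measurable]: "E a b \<in> sets borel" for a b unfolding E_def by measurable
  have null: "E a b \<in> null_sets lborel" if "a < b" for a b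
  proof (cases "E a b = {}")
    case False
    \<comment> \<open>All quotients lie in [-L, L], so a point of \<open>E a b\<close> forces these
      bounds; they make \<open>b + L\<close> and \<open>- a + L\<close> nonnegative, as
      \<open>density_le_increment\<close> requires.\<close>
    then have ab: "a > - L" "b < L"
      using bd by (auto simp: E_def abs_le_iff) (metis le_refl le_less_trans minus_le_iff, metis le_refl less_le_trans)
    have lip': "L-lipschitz_on UNIV (\<lambda>t. - g t)" using lip by simp
    have neg: "diffquot (\<lambda>t. - g t) 1 k t = - diffquot g 1 k t" for k t
      by (simp add: diffquot_def algebra_simps)
    show ?thesis
    proof (rule null_set_if_interval_density_less_1[where k = "2 * L / (b - a + 2 * L)"])
      fix \<alpha> \<beta> :: real assume "\<alpha> \<le> \<beta>"
      have "(b + L) * measure lborel (E a b \<inter> {\<alpha>..\<beta>}) \<le> g \<beta> - g \<alpha> + L * (\<beta> - \<alpha>)"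
        by (rule density_le_increment[OF lip _ \<open>\<alpha> \<le> \<beta>\<close>], simp, use ab that in simp, rule frequently_diffquot_step)
          (auto simp: E_def frequently_sequentially)
      moreover have "(- a + L) * measure lborel (E a b \<inter> {\<alpha>..\<beta>}) \<le> (- g \<beta>) - (- g \<alpha>) + L * (\<beta> - \<alpha>)"
        by (rule density_le_increment[OF lip' _ \<open>\<alpha> \<le> \<beta>\<close>], simp, use ab that in simp, rule frequently_diffquot_step)
          (auto simp: E_def frequently_sequentially neg)
      ultimately have "(b - a + 2 * L) * measure lborel (E a b \<inter> {\<alpha>..\<beta>}) \<le> 2 * L * (\<beta> - \<alpha>)"
        by (simp add: algebra_simps)
      then show "measure lborel (E a b \<inter> {\<alpha>..\<beta>}) \<le> 2 * L / (b - a + 2 * L) * (\<beta> - \<alpha>)"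
        using that L0 by (simp add: field_simps)
    qed (use that L0 in \<open>auto simp: field_simps\<close>)
  qed auto
  have "(\<Union>(a, b)\<in>{(a, b). a \<in> \<rat> \<and> b \<in> \<rat> \<and> a < b}. E a b) \<in> null_sets lborel"
  proof (rule null_sets_UN')
    show "countable {(a::real, b::real). a \<in> \<rat> \<and> b \<in> \<rat> \<and> a < b}"
      by (rule countable_subset[of _ "\<rat> \<times> \<rat>"]) (auto intro: countable_rat)
  qed (use null in auto)
  moreover have "{t \<in> space lborel. \<not> convergent (\<lambda>k. diffquot g 1 k t)}
      \<subseteq> (\<Union>(a, b)\<in>{(a, b). a \<in> \<rat> \<and> b \<in> \<rat> \<and> a < b}. E a b)"
  proof
    fix t assume "t \<in> {t \<in> space lborel. \<not> convergent (\<lambda>k. diffquot g 1 k t)}"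
    then have "\<not> convergent (\<lambda>k. diffquot g 1 k t)" by simp
    from bounded_not_convergent_oscillates[OF bd this] obtain a b where
      "a \<in> \<rat>" "b \<in> \<rat>" "a < b" "\<exists>\<^sub>F k in sequentially. diffquot g 1 k t < a"
      "\<exists>\<^sub>F k in sequentially. b < diffquot g 1 k t" by metis
    then show "t \<in> (\<Union>(a, b)\<in>{(a, b). a \<in> \<rat> \<and> b \<in> \<rat> \<and> a < b}. E a b)"
      by (auto simp: E_def frequently_sequentially)
  qed
  ultimately show ?thesis by (rule AE_I')
qed

text \<open>Tonelli over the translates \<open>E + t w\<close>, \<open>t \<in> [0, 1]\<close>: the exceptional set \<open>E\<close> meets every
  line parallel to \<open>w\<close> in a null set.\<close>

lemma AE_convergent_diffquot:
  fixes f :: "'a::euclidean_space \<Rightarrow> real"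
  assumes lip: "L-lipschitz_on UNIV f"
  shows "AE x in lborel. convergent (\<lambda>k. diffquot f w k x)"
proof -
  have [measurable]: "f \<in> borel_measurable borel" by (rule lipschitz_borel_measurable[OF lip])
  \<comment> \<open>The Cauchy condition involves countably many quotients and rational tolerances
    suffice, so \<open>E\<close> is Borel; completeness of the reals makes it equivalent to
    divergence.\<close>
  define E where "E = {x. \<not> Cauchy (\<lambda>k. diffquot f w k x)}"
  have E[measurable]: "E \<in> sets borel" unfolding E_def by measurable
  have zero: "AE t in lborel. x + t *\<^sub>R w \<notin> E" for x
  proof -
    define g where "g t = f (x + t *\<^sub>R w)" for t
    have "(L * norm w)-lipschitz_on UNIV g"
    proof (rule lipschitz_onI)
      fix s t :: real
      have "dist (g s) (g t) \<le> L * dist (x + s *\<^sub>R w) (x + t *\<^sub>R w)"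
        unfolding g_def by (rule lipschitz_onD[OF lip]) auto
      also have "dist (x + s *\<^sub>R w) (x + t *\<^sub>R w) = norm w * dist s t"
        by (simp add: dist_norm flip: scaleR_diff_left)
      finally show "dist (g s) (g t) \<le> L * norm w * dist s t" by (simp add: mult_ac)
    qed (use lipschitz_on_nonneg[OF lip] in auto)
    from AE_convergent_diffquot_real[OF this] show ?thesis
    proof eventually_elim
      case (elim t)
      have "diffquot g 1 k t = diffquot f w k (x + t *\<^sub>R w)" for k
        by (simp add: diffquot_def g_def algebra_simps)
      with elim show ?case by (simp add: E_def Cauchy_convergent_iff)
    qed
  qed
  have "emeasure lborel E = (\<integral>\<^sup>+t. indicator {0..1::real} t * emeasure lborel E \<partial>lborel)"
    by (subst nn_integral_multc) (auto simp: nn_integral_indicator)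
  also have "\<dots> = (\<integral>\<^sup>+t. (\<integral>\<^sup>+x. indicator {0..1::real} t * indicator E (x + t *\<^sub>R w) \<partial>lborel) \<partial>lborel)"
  proof (intro nn_integral_cong)
    fix t :: real
    have "emeasure lborel E = (\<integral>\<^sup>+x. indicator E x \<partial>distr lborel borel ((+) (t *\<^sub>R w)))"
      by (simp add: lborel_distr_plus)
    also have "\<dots> = (\<integral>\<^sup>+x. indicator E (t *\<^sub>R w + x) \<partial>lborel)"
      by (subst nn_integral_distr) auto
    finally show "indicator {0..1} t * emeasure lborel E
        = (\<integral>\<^sup>+x. indicator {0..1::real} t * indicator E (x + t *\<^sub>R w) \<partial>lborel)"
      by (subst nn_integral_cmult) (auto simp: add.commute)
  qed
  also have "\<dots> = (\<integral>\<^sup>+x. (\<integral>\<^sup>+t. indicator {0..1::real} t * indicator E (x + t *\<^sub>R w) \<partial>lborel) \<partial>lborel)"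
    by (rule lborel_pair.Fubini') measurable
  also have "\<dots> = (\<integral>\<^sup>+(x::'a). 0 \<partial>lborel)"
  proof (intro nn_integral_cong)
    fix x :: 'a
    show "(\<integral>\<^sup>+t. indicator {0..1::real} t * indicator E (x + t *\<^sub>R w) \<partial>lborel) = 0"
      using zero[of x] by (subst nn_integral_0_iff_AE) (auto simp: indicator_def)
  qed
  finally have "E \<in> null_sets lborel" by auto
  then show ?thesis
    by (rule AE_I') (auto simp: E_def Cauchy_convergent_iff)
qed

section \<open>Rademacher's theorem\<close>

text \<open>At points of divergence \<open>lim\<close> has one unspecified value, the same for all
  such points, so the function stays Borel on the whole space.\<close>

definition dirderiv :: "('a::real_vector \<Rightarrow> 'b::real_normed_vector) \<Rightarrow> 'a \<Rightarrow> 'a \<Rightarrow> 'b" where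
  "dirderiv f w x = lim (\<lambda>k. diffquot f w k x)"

lemma borel_measurable_dirderiv [measurable]:
  fixes f :: "'a::euclidean_space \<Rightarrow> 'b::euclidean_space"
  assumes [measurable]: "f \<in> borel_measurable borel"
  shows "dirderiv f w \<in> borel_measurable borel"
  unfolding dirderiv_def by measurable

text \<open>Lipschitz continuity interpolates, since \<open>1/k\<close> and \<open>1/(k+1)\<close> differ by \<open>O(1/k\<^sup>2)\<close>.\<close>

lemma diffquot_tendsto_imp_at_right:
  fixes f :: "'a::real_normed_vector \<Rightarrow> real"
  assumes lip: "L-lipschitz_on UNIV f" and lim: "(\<lambda>k. diffquot f w k x) \<longlonglongrightarrow> l"
  shows "((\<lambda>t. (f (x + t *\<^sub>R w) - f x) / t) \<longlongrightarrow> l) (at_right 0)"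
proof (rule tendstoI)
  fix e :: real assume e: "e > 0"
  from lim e obtain N where N: "\<And>k. k \<ge> N \<Longrightarrow> dist (diffquot f w k x) l < e / 2"
    unfolding tendsto_iff eventually_sequentially by (meson half_gt_zero)
  define c where "c = L * norm w"
  have c: "0 \<le> c" using lipschitz_on_nonneg[OF lip] by (simp add: c_def)
  \<comment> \<open>The first entry forces \<open>k \<ge> N\<close> below; the second keeps the
    error \<open>2 * c * t\<close> of passing from \<open>t\<close> to a reciprocal integer under
    \<open>e / 2\<close>, with \<open>c + 1\<close> guarding against \<open>c = 0\<close>.\<close>
  define d where "d = min (1 / (real N + 1)) (e / (4 * (c + 1)))"
  have d: "d > 0" using e c by (auto simp: d_def)
  have "dist ((f (x + t *\<^sub>R w) - f x) / t) l < e" if t: "0 < t" "t < d" for t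
  proof -
    \<comment> \<open>With this \<open>k\<close>, the increment \<open>1 / real (Suc k)\<close> is
      the largest available one below \<open>t\<close>, and the gap \<open>t - s\<close> is at most
      \<open>t * s\<close>, hence of second order.\<close>
    define k where "k = nat \<lfloor>1 / t\<rfloor>"
    define s where "s = 1 / real (Suc k)"
    have rk: "real k \<le> 1 / t" "1 / t < real k + 1"
      using t by (auto simp: k_def of_nat_nat)
    have tk: "t * real k \<le> 1" "1 < t * real (Suc k)"
      using rk t by (auto simp: field_simps)
    have s: "0 < s" "s \<le> t" using tk t by (auto simp: s_def field_simps)
    have "t - s = s * (t * real (Suc k) - 1)" by (simp add: s_def field_simps)
    also have "\<dots> \<le> s * t" using tk s by (intro mult_left_mono) (auto simp: algebra_simps)
    finally have s: "0 < s" "s \<le> t" "t - s \<le> t * s" using s by (auto simp: mult.commute)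
    have "real N + 1 < 1 / t" using t by (simp add: d_def field_simps)
    then have kN: "k \<ge> N" using rk by linarith
    define r where "r = f (x + t *\<^sub>R w) - f (x + s *\<^sub>R w)"
    have "\<bar>r\<bar> \<le> L * norm ((t - s) *\<^sub>R w)"
      using lipschitz_onD[OF lip, of "x + t *\<^sub>R w" "x + s *\<^sub>R w"]
      by (simp add: r_def dist_norm scaleR_diff_left)
    also have "\<dots> = c * (t - s)" using s by (simp add: c_def)
    finally have r: "\<bar>r\<bar> \<le> c * (t - s)" .
    define q where "q = diffquot f w k x"
    have q: "\<bar>q\<bar> \<le> c" using norm_diffquot_le[OF lip, of w k x] by (simp add: q_def c_def)
    have "f (x + s *\<^sub>R w) - f x = s * q" by (simp add: q_def diffquot_def s_def)
    then have "(f (x + t *\<^sub>R w) - f x) / t - q = (r - (t - s) * q) / t"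
      using t by (simp add: r_def field_simps)
    also have "\<bar>\<dots>\<bar> \<le> (c * (t - s) + (t - s) * c) / t"
    proof -
      have "\<bar>(t - s) * q\<bar> \<le> (t - s) * c" using s q by (simp add: abs_mult mult_left_mono)
      then have "\<bar>r - (t - s) * q\<bar> \<le> c * (t - s) + (t - s) * c" using r by linarith
      then show ?thesis using t by (simp only: abs_divide) (simp add: divide_right_mono)
    qed
    also have "\<dots> = 2 * c * ((t - s) / t)" by simp
    also have "\<dots> \<le> 2 * c * t"
    proof -
      have "(t - s) / t \<le> s" using s t by (simp add: field_simps)
      then show ?thesis using s c by (intro mult_left_mono) auto
    qed
    also have "\<dots> \<le> 2 * (c + 1) * t" using t by simp
    also have "\<dots> < 2 * (c + 1) * d" using t c by simp
    also have "\<dots> \<le> e / 2"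
    proof -
      have "d \<le> e / (4 * (c + 1))" by (simp add: d_def)
      then have "2 * (c + 1) * d \<le> 2 * (c + 1) * (e / (4 * (c + 1)))" using c by (intro mult_left_mono) auto
      also have "\<dots> = e / 2" using c by (simp add: field_simps)
      finally show ?thesis .
    qed
    finally have "\<bar>(f (x + t *\<^sub>R w) - f x) / t - q\<bar> < e / 2" .
    moreover have "\<bar>q - l\<bar> < e / 2" using N[OF kN] by (simp add: q_def dist_real_def)
    ultimately show ?thesis unfolding dist_real_def by linarith
  qed
  then show "\<forall>\<^sub>F t in at_right 0. dist ((f (x + t *\<^sub>R w) - f x) / t) l < e"
    unfolding eventually_at_right_field using d by auto
qed

lemma at_right_imp_diffquot_tendsto:
  fixes f :: "'a::real_normed_vector \<Rightarrow> real"
  assumes "((\<lambda>t. (f (x + t *\<^sub>R w) - f x) / t) \<longlongrightarrow> l) (at_right 0)"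
  shows "(\<lambda>k. diffquot f w k x) \<longlonglongrightarrow> l"
proof -
  have "filterlim (\<lambda>k. 1 / real (Suc k)) (at_right 0) sequentially"
    unfolding filterlim_at_right_to_top filterlim_at
    using LIMSEQ_inverse_real_of_nat by (auto simp: inverse_eq_divide)
  from filterlim_compose[OF assms this] show ?thesis
    by (simp add: diffquot_def mult.commute)
qed

text \<open>For \<open>x\<close> outside the closed set \<open>S\<close> the points
  \<open>x + v k\<close> eventually stay outside, so dominated convergence gives the second limit.
  Applied to \<open>- v\<close> and translated by \<open>v k\<close>, it becomes the first.\<close>

lemma compact_translation_symdiff_tendsto_0:
  fixes S :: "'a::euclidean_space set"
  assumes S: "compact S" and v: "v \<longlonglongrightarrow> 0"
  shows "(\<lambda>k. \<integral>x. indicator S x * (1 - indicator S (x + v k)) \<partial>lborel) \<longlonglongrightarrow> (0::real)" (is ?A)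
    and "(\<lambda>k. \<integral>x. indicator S (x + v k) * (1 - indicator S x) \<partial>lborel) \<longlonglongrightarrow> (0::real)" (is ?B)
proof -
  have [measurable]: "S \<in> sets borel" using S by (simp add: borel_compact)
  obtain R where R: "\<And>x. x \<in> S \<Longrightarrow> norm x \<le> R" using compact_imp_bounded[OF S] unfolding bounded_iff by auto
  have B: "(\<lambda>k. \<integral>x. indicator S (x + u k) * (1 - indicator S x) \<partial>lborel) \<longlonglongrightarrow> (0::real)"
    if u: "u \<longlonglongrightarrow> 0" for u
  proof -
    obtain U where U: "\<And>k. norm (u k) \<le> U" using convergent_imp_Bseq[of u] u
      by (auto simp: convergent_def Bseq_def)
    have "(\<lambda>k. \<integral>x. indicator S (x + u k) * (1 - indicator S x) \<partial>lborel) \<longlonglongrightarrow> (\<integral>(x::'a). 0 \<partial>lborel :: real)"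
    proof (rule integral_dominated_convergence[where w = "indicator (cball 0 (R + U))"])
      show "integrable lborel (indicator (cball 0 (R + U)) :: 'a \<Rightarrow> real)"
        using emeasure_compact_finite[OF compact_cball, of 0 "R + U"] by (intro integrable_real_indicator) auto
      show "AE x in lborel. (\<lambda>k. indicator S (x + u k) * (1 - indicator S x)) \<longlonglongrightarrow> (0::real)"
      proof (intro AE_I2)
        fix x :: 'a
        show "(\<lambda>k. indicator S (x + u k) * (1 - indicator S x)) \<longlonglongrightarrow> (0::real)"
        proof (cases "x \<in> S")
          case False
          have "(\<lambda>k. x + u k) \<longlonglongrightarrow> x" using tendsto_add[OF tendsto_const[of x] u] by simp
          then have "\<forall>\<^sub>F k in sequentially. x + u k \<in> - S"
            using S False by (intro topological_tendstoD) (auto simp: compact_imp_closed)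
          then have "\<forall>\<^sub>F k in sequentially. indicator S (x + u k) * (1 - indicator S x) = (0::real)"
            by eventually_elim simp
          then show ?thesis by (simp add: tendsto_eventually)
        qed simp
      qed
      show "AE x in lborel. norm (indicator S (x + u k) * (1 - indicator S x) :: real) \<le> indicator (cball 0 (R + U)) x" for k
      proof (intro AE_I2)
        fix x :: 'a
        have "norm x \<le> R + U" if "x + u k \<in> S"
          using R[OF that] U[of k] norm_triangle_ineq4[of "x + u k" "u k"] by simp
        then show "norm (indicator S (x + u k) * (1 - indicator S x) :: real) \<le> indicator (cball 0 (R + U)) x"
          by (auto simp: indicator_def)
      qed
    qed measurable
    then show ?thesis by simp
  qed
  show ?B by (rule B[OF v])
  have "(\<integral>x. indicator S (x + - v k) * (1 - indicator S x) \<partial>lborel)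
      = (\<integral>x. indicator S x * (1 - indicator S (x + v k)) \<partial>lborel :: real)" for k
  proof -
    have "(\<integral>x. indicator S (x + - v k) * (1 - indicator S x) \<partial>lborel)
      = (\<integral>x. indicator S (x + - v k) * (1 - indicator S x) \<partial>distr lborel borel ((+) (v k)) :: real)"
      by (simp add: lborel_distr_plus)
    also have "\<dots> = (\<integral>x. indicator S x * (1 - indicator S (x + v k)) \<partial>lborel)"
      by (subst integral_distr) (auto simp: add.commute)
    finally show ?thesis .
  qed
  then show ?A using B[of "\<lambda>k. - v k"] tendsto_minus[OF v] by simp
qed

text \<open>If \<psi> were positive on a set of positive measure, inner regularity would supply a
  compact \<open>T\<close> of positive measure inside it, and the vanishing integral over
  \<open>T\<close> would force \<psi> to vanish almost everywhere on \<open>T\<close>. The same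
  argument applies to \<open>- \<psi>\<close>.\<close>

lemma AE_zero_if_compact_integrals_zero:
  fixes \<psi> :: "'a::euclidean_space \<Rightarrow> real"
  assumes [measurable]: "\<psi> \<in> borel_measurable borel" and bd: "AE x in lborel. \<bar>\<psi> x\<bar> \<le> B"
    and zero: "\<And>S. compact S \<Longrightarrow> (\<integral>x. indicator S x * \<psi> x \<partial>lborel) = 0"
  shows "AE x in lborel. \<psi> x = 0"
proof -
  have pos: "{x \<in> cball 0 (real n). 0 < \<phi> x} \<in> null_sets lborel"
    if [measurable]: "\<phi> \<in> borel_measurable borel" and bd: "AE x in lborel. \<bar>\<phi> x\<bar> \<le> B"
      and zero: "\<And>S. compact S \<Longrightarrow> (\<integral>x. indicator S x * \<phi> x \<partial>lborel) = 0" for \<phi> :: "'a \<Rightarrow> real" and n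
  proof (rule ccontr)
    define P where "P = {x \<in> cball 0 (real n). 0 < \<phi> x}"
    have [measurable]: "P \<in> sets borel" unfolding P_def by measurable
    assume "{x \<in> cball 0 (real n). 0 < \<phi> x} \<notin> null_sets lborel"
    then have "P \<notin> null_sets lborel" by (simp only: P_def not_False_eq_True)
    then have "emeasure lborel P \<noteq> 0" by auto
    moreover have "emeasure lborel P < \<infinity>"
      by (rule emeasure_bounded_finite) (auto simp: P_def intro: bounded_subset[of "cball 0 (real n)"])
    ultimately obtain m where m: "m > 0" "emeasure lborel P = ennreal m"
      by (cases "emeasure lborel P") (auto simp: less_le)
    obtain T where T: "closed T" "T \<subseteq> P" "P - T \<in> lmeasurable" "emeasure lebesgue (P - T) < ennreal m"
      using sets_lebesgue_inner_closed[of P m] m by (auto simp: sets_completionI_sets)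
    have "T \<subseteq> cball 0 (real n)" using T(2) by (auto simp: P_def)
    then have "compact T"
      using T(1) bounded_subset[OF bounded_cball] by (auto simp: compact_eq_bounded_closed)
    have [measurable]: "T \<in> sets borel" using T by auto
    have int: "integrable lborel (\<lambda>x. indicator T x * \<phi> x)"
    proof (rule Bochner_Integration.integrable_bound[of _ "\<lambda>x. B * indicator T x"])
      show "integrable lborel (\<lambda>x. B * indicator T x)"
        using emeasure_compact_finite[OF \<open>compact T\<close>]
        by (intro integrable_mult_right integrable_real_indicator) auto
      show "AE x in lborel. norm (indicator T x * \<phi> x) \<le> norm (B * indicator T x)"
        using bd by eventually_elim (auto simp: indicator_def)
    qed measurable
    have "AE x in lborel. indicator T x * \<phi> x = 0"
      using integral_nonneg_eq_0_iff_AE[OF int] zero[OF \<open>compact T\<close>] T(2)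
      by (force simp: P_def indicator_def)
    then have "AE x in lborel. x \<notin> T"
      by eventually_elim (use T(2) in \<open>auto simp: P_def indicator_def\<close>)
    then have "T \<in> null_sets lborel" by (simp add: AE_iff_null_sets)
    then have "emeasure lborel P = emeasure lborel (P - T)" by (simp add: emeasure_Diff_null_set)
    then show False using T(4) m(2) by simp
  qed
  have "{x \<in> cball 0 (real n). 0 < \<psi> x} \<union> {x \<in> cball 0 (real n). 0 < - \<psi> x} \<in> null_sets lborel" for n
  proof (intro null_sets.Un pos)
    show "(\<integral>x. indicator S x * - \<psi> x \<partial>lborel) = 0" if "compact S" for S
      using zero[OF that] by simp
  qed (use bd zero in auto)
  then have "(\<Union>n. {x \<in> cball 0 (real n). 0 < \<psi> x} \<union> {x \<in> cball 0 (real n). 0 < - \<psi> x}) \<in> null_sets lborel"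
    by blast
  then show ?thesis
  proof (rule AE_I', intro subsetI)
    fix x :: 'a assume "x \<in> {x \<in> space lborel. \<psi> x \<noteq> 0}"
    moreover obtain n where "norm x \<le> real n" using real_arch_simple by blast
    ultimately show "x \<in> (\<Union>n. {x \<in> cball 0 (real n). 0 < \<psi> x} \<union> {x \<in> cball 0 (real n). 0 < - \<psi> x})"
      by (auto simp: neq_iff)
  qed
qed

text \<open>Additivity in the direction is obtained weakly: after integration over a compact set the
  base point \<open>x + w1/k\<close> may be replaced by \<open>x\<close>.\<close>

lemma AE_dirderiv_add:
  fixes f :: "'a::euclidean_space \<Rightarrow> real"
  assumes lip: "L-lipschitz_on UNIV f"
  shows "AE x in lborel. dirderiv f (w1 + w2) x = dirderiv f w1 x + dirderiv f w2 x"
proof -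
  have [measurable]: "f \<in> borel_measurable borel" by (rule lipschitz_borel_measurable[OF lip])
  have L0: "0 \<le> L" by (rule lipschitz_on_nonneg[OF lip])
  have bd: "\<bar>diffquot f w k x\<bar> \<le> L * norm w" for w k x
    using norm_diffquot_le[OF lip, of w k x] by simp
  have lim: "AE x in lborel. (\<lambda>k. diffquot f w k x) \<longlonglongrightarrow> dirderiv f w x" for w
    using AE_convergent_diffquot[OF lip, of w]
    by eventually_elim (simp add: dirderiv_def convergent_LIMSEQ_iff)
  have bdd: "AE x in lborel. \<bar>dirderiv f w x\<bar> \<le> L * norm w" for w
    using lim[of w]
  proof eventually_elim
    case (elim x)
    show ?case by (rule tendsto_upperbound[OF tendsto_rabs[OF elim]]) (use bd in auto)
  qed
  have "AE x in lborel. dirderiv f (w1 + w2) x - dirderiv f w1 x - dirderiv f w2 x = 0"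
  proof (rule AE_zero_if_compact_integrals_zero)
    show "AE x in lborel. \<bar>dirderiv f (w1 + w2) x - dirderiv f w1 x - dirderiv f w2 x\<bar>
        \<le> L * norm (w1 + w2) + L * norm w1 + L * norm w2"
      using bdd[of "w1 + w2"] bdd[of w1] bdd[of w2] by eventually_elim linarith
    fix S :: "'a set" assume S: "compact S"
    have [measurable]: "S \<in> sets borel" using S by (simp add: borel_compact)
    have finS: "emeasure lborel S < \<infinity>" using S by (rule emeasure_compact_finite)
    have intS: "integrable lborel (\<lambda>x. c * indicator S x :: real)" for c
      using finS by (intro integrable_mult_right integrable_real_indicator) auto
    have intq: "integrable lborel (\<lambda>x. indicator S x * diffquot f w k x)" for w k
      by (rule Bochner_Integration.integrable_bound[OF intS[of "L * norm w"]])
        (use bd[of w k] L0 in \<open>auto simp: indicator_def\<close>)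
    have I: "(\<lambda>k. \<integral>x. indicator S x * diffquot f w k x \<partial>lborel) \<longlonglongrightarrow> (\<integral>x. indicator S x * dirderiv f w x \<partial>lborel)"
      "integrable lborel (\<lambda>x. indicator S x * dirderiv f w x)" for w
    proof -
      have *: "AE x in lborel. (\<lambda>k. indicator S x * diffquot f w k x) \<longlonglongrightarrow> indicator S x * dirderiv f w x"
        using lim[of w] by eventually_elim (intro tendsto_intros)
      have **: "AE x in lborel. norm (indicator S x * diffquot f w k x) \<le> L * norm w * indicator S x" for k
        by (intro AE_I2) (use bd[of w k] in \<open>auto simp: indicator_def\<close>)
      show "(\<lambda>k. \<integral>x. indicator S x * diffquot f w k x \<partial>lborel) \<longlonglongrightarrow> (\<integral>x. indicator S x * dirderiv f w x \<partial>lborel)"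
        by (rule integral_dominated_convergence[OF _ _ intS * **]) measurable
      show "integrable lborel (\<lambda>x. indicator S x * dirderiv f w x)"
        by (rule integrable_dominated_convergence[OF _ _ intS * **]) measurable
    qed
    define v where "v k = (1 / real (Suc k)) *\<^sub>R w1" for k
    have v: "v \<longlonglongrightarrow> 0"
      using tendsto_scaleR[OF LIMSEQ_inverse_real_of_nat tendsto_const[of w1]]
      by (simp add: v_def[abs_def] inverse_eq_divide)
    have vm: "(\<lambda>k. - v k) \<longlonglongrightarrow> 0" using tendsto_minus[OF v] by simp
    define c where "c = L * norm w2"
    have c0: "0 \<le> c" using L0 by (simp add: c_def)
    have ints: "integrable lborel (\<lambda>x. indicator S x * (1 - indicator S (x + u)) :: real)"
      "integrable lborel (\<lambda>x. indicator S (x + u) * (1 - indicator S x) :: real)"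
      "integrable lborel (\<lambda>x. indicator S (x + u) :: real)" for u
    proof -
      show "integrable lborel (\<lambda>x. indicator S x * (1 - indicator S (x + u)) :: real)"
        by (rule Bochner_Integration.integrable_bound[OF intS[of 1]]) (auto simp: indicator_def)
      have "integrable (distr lborel borel ((+) u)) (\<lambda>x. 1 * indicator S x :: real)"
        using intS[of 1] by (simp add: lborel_distr_plus)
      then show *: "integrable lborel (\<lambda>x. indicator S (x + u) :: real)"
        by (subst (asm) integrable_distr_eq) (auto simp: add.commute)
      show "integrable lborel (\<lambda>x. indicator S (x + u) * (1 - indicator S x) :: real)"
        by (rule Bochner_Integration.integrable_bound[OF *]) (auto simp: indicator_def)
    qed
    have D: "\<bar>(\<integral>x. indicator S x * diffquot f (w1 + w2) k x \<partial>lborel)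
        - (\<integral>x. indicator S x * diffquot f w1 k x \<partial>lborel)
        - (\<integral>x. indicator S x * diffquot f w2 k x \<partial>lborel)\<bar>
        \<le> c * (\<integral>x. indicator S x * (1 - indicator S (x + - v k)) \<partial>lborel)
         + c * (\<integral>x. indicator S (x + - v k) * (1 - indicator S x) \<partial>lborel)" for k
    proof -
      \<comment> \<open>The step in direction \<open>w1 + w2\<close> is broken at
        \<open>x + v k\<close>. A change of variables then moves the translation from the quotient
        to the indicator of \<open>S\<close>, where only the two differences of \<open>S\<close> and
        its translate remain.\<close>
      have eq: "diffquot f (w1 + w2) k x = diffquot f w1 k x + diffquot f w2 k (x + v k)" for x
        by (simp add: diffquot_def v_def algebra_simps)
      have int2: "integrable lborel (\<lambda>x. indicator S (x + - v k) * diffquot f w2 k x)"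
        by (rule Bochner_Integration.integrable_bound[OF integrable_mult_right[OF ints(3)[of "- v k"], of c]])
          (use bd[of w2 k] c0 in \<open>auto simp: indicator_def c_def\<close>)
      have "(\<integral>x. indicator S (x + - v k) * diffquot f w2 k x \<partial>lborel)
          = (\<integral>x. indicator S (x + - v k) * diffquot f w2 k x \<partial>distr lborel borel ((+) (v k)))"
        by (simp add: lborel_distr_plus)
      also have "\<dots> = (\<integral>x. indicator S x * diffquot f w2 k (x + v k) \<partial>lborel)"
        by (subst integral_distr) (auto simp: add.commute)
      finally have shift: "(\<integral>x. indicator S x * diffquot f w2 k (x + v k) \<partial>lborel)
        = (\<integral>x. indicator S (x + - v k) * diffquot f w2 k x \<partial>lborel)" by simp
      have "(\<integral>x. indicator S x * diffquot f (w1 + w2) k x \<partial>lborel) - (\<integral>x. indicator S x * diffquot f w1 k x \<partial>lborel)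
        = (\<integral>x. indicator S x * diffquot f w2 k (x + v k) \<partial>lborel)"
        by (subst Bochner_Integration.integral_diff[OF intq intq, symmetric])
          (auto simp: eq algebra_simps intro!: Bochner_Integration.integral_cong)
      then have "(\<integral>x. indicator S x * diffquot f (w1 + w2) k x \<partial>lborel)
        - (\<integral>x. indicator S x * diffquot f w1 k x \<partial>lborel)
        - (\<integral>x. indicator S x * diffquot f w2 k x \<partial>lborel)
        = (\<integral>x. indicator S (x + - v k) * diffquot f w2 k x - indicator S x * diffquot f w2 k x \<partial>lborel)"
        unfolding shift by (subst Bochner_Integration.integral_diff) (use intq int2 in auto)
      also have "\<bar>\<dots>\<bar> \<le> (\<integral>x. c * (indicator S x * (1 - indicator S (x + - v k))) + c * (indicator S (x + - v k) * (1 - indicator S x)) \<partial>lborel)"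
      proof (rule integral_abs_bound_integral)
        fix x
        show "\<bar>indicator S (x + - v k) * diffquot f w2 k x - indicator S x * diffquot f w2 k x\<bar>
          \<le> c * (indicator S x * (1 - indicator S (x + - v k))) + c * (indicator S (x + - v k) * (1 - indicator S x))"
          using bd[of w2 k x] c0 by (auto simp: indicator_def c_def)
      qed (use intq int2 ints(1)[of "- v k"] ints(2)[of "- v k"] in auto)
      also have "\<dots> = c * (\<integral>x. indicator S x * (1 - indicator S (x + - v k)) \<partial>lborel)
         + c * (\<integral>x. indicator S (x + - v k) * (1 - indicator S x) \<partial>lborel)"
        by (subst Bochner_Integration.integral_add) (use ints(1)[of "- v k"] ints(2)[of "- v k"] in auto)
      finally show ?thesis .
    qed
    have "(\<lambda>k. (\<integral>x. indicator S x * diffquot f (w1 + w2) k x \<partial>lborel)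
        - (\<integral>x. indicator S x * diffquot f w1 k x \<partial>lborel)
        - (\<integral>x. indicator S x * diffquot f w2 k x \<partial>lborel)) \<longlonglongrightarrow> 0"
    proof (rule tendsto_0_le[where K = 1])
      show "(\<lambda>k. c * (\<integral>x. indicator S x * (1 - indicator S (x + - v k)) \<partial>lborel)
         + c * (\<integral>x. indicator S (x + - v k) * (1 - indicator S x) \<partial>lborel)) \<longlonglongrightarrow> 0"
        using tendsto_add[OF tendsto_mult_right_zero[OF compact_translation_symdiff_tendsto_0(1)[OF S vm]]
            tendsto_mult_right_zero[OF compact_translation_symdiff_tendsto_0(2)[OF S vm]], of c c] by simp
    qed (intro always_eventually allI, use D in \<open>simp, smt (verit)\<close>)
    moreover have "(\<lambda>k. (\<integral>x. indicator S x * diffquot f (w1 + w2) k x \<partial>lborel)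
        - (\<integral>x. indicator S x * diffquot f w1 k x \<partial>lborel)
        - (\<integral>x. indicator S x * diffquot f w2 k x \<partial>lborel)) \<longlonglongrightarrow>
        (\<integral>x. indicator S x * dirderiv f (w1 + w2) x \<partial>lborel)
        - (\<integral>x. indicator S x * dirderiv f w1 x \<partial>lborel)
        - (\<integral>x. indicator S x * dirderiv f w2 x \<partial>lborel)"
      by (intro tendsto_intros I)
    ultimately have "(\<integral>x. indicator S x * dirderiv f (w1 + w2) x \<partial>lborel)
        - (\<integral>x. indicator S x * dirderiv f w1 x \<partial>lborel)
        - (\<integral>x. indicator S x * dirderiv f w2 x \<partial>lborel) = 0"
      using LIMSEQ_unique by blast
    then show "(\<integral>x. indicator S x * (dirderiv f (w1 + w2) x - dirderiv f w1 x - dirderiv f w2 x) \<partial>lborel) = 0"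
      using I(2) by (simp add: right_diff_distrib)
  qed measurable
  then show ?thesis by eventually_elim simp
qed

lemma dirderiv_zero [simp]: "dirderiv f 0 x = 0"
  by (simp add: dirderiv_def diffquot_def)

lemma AE_dirderiv_sum:
  fixes f :: "'a::euclidean_space \<Rightarrow> real"
  assumes lip: "L-lipschitz_on UNIV f" and "finite F"
  shows "AE x in lborel. dirderiv f (\<Sum>i\<in>F. g i) x = (\<Sum>i\<in>F. dirderiv f (g i) x)"
  using \<open>finite F\<close>
proof (induction F rule: finite_induct)
  case (insert i F)
  from insert.IH AE_dirderiv_add[OF lip, of "g i" "\<Sum>i\<in>F. g i"] show ?case
    by eventually_elim (use insert.hyps in simp)
qed simp

text \<open>For \<open>c > 0\<close> the one-sided limit over all real \<open>t\<close> is invariant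
  under rescaling of \<open>t\<close>, which a limit along 1/(k+1) alone does not show. For
  \<open>c < 0\<close>, additivity for \<open>c *\<^sub>R w\<close> and its negative reduces to the
  positive case, since the derivative in direction 0 vanishes.\<close>

lemma AE_dirderiv_scaleR:
  fixes f :: "'a::euclidean_space \<Rightarrow> real"
  assumes lip: "L-lipschitz_on UNIV f"
  shows "AE x in lborel. dirderiv f (c *\<^sub>R w) x = c * dirderiv f w x"
proof -
  have pos: "AE x in lborel. dirderiv f (c *\<^sub>R w) x = c * dirderiv f w x" if c: "c > 0" for c w
    using AE_convergent_diffquot[OF lip, of w]
  proof eventually_elim
    case (elim x)
    then have "(\<lambda>k. diffquot f w k x) \<longlonglongrightarrow> dirderiv f w x"
      by (simp add: dirderiv_def convergent_LIMSEQ_iff)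
    then have A: "((\<lambda>t. (f (x + t *\<^sub>R w) - f x) / t) \<longlongrightarrow> dirderiv f w x) (at_right 0)"
      by (rule diffquot_tendsto_imp_at_right[OF lip])
    have "filterlim (\<lambda>t. c * t) (at_right 0) (at_right 0)"
      using c by (intro filterlim_times_pos) (auto simp: filterlim_ident)
    from tendsto_mult_left[OF filterlim_compose[OF A this], of c]
    have "((\<lambda>t. (f (x + t *\<^sub>R (c *\<^sub>R w)) - f x) / t) \<longlongrightarrow> c * dirderiv f w x) (at_right 0)"
      using c by (simp add: mult.commute)
    from at_right_imp_diffquot_tendsto[OF this] show ?case
      unfolding dirderiv_def[of f "c *\<^sub>R w"] by (rule limI)
  qed
  consider "c > 0" | "c = 0" | "c < 0" by linarith
  then show ?thesis
  proof cases
    case 3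
    then have "AE x in lborel. dirderiv f ((-c) *\<^sub>R w) x = (-c) * dirderiv f w x" by (intro pos) simp
    with AE_dirderiv_add[OF lip, of "c *\<^sub>R w" "(-c) *\<^sub>R w"] show ?thesis
      by eventually_elim simp
  qed (use pos in auto)
qed

text \<open>Almost everywhere, the directional derivatives exist and agree with a linear map on a
  countable dense set of directions. Compactness of the unit sphere reduces to finitely many of
  them, hence to one step size; the Lipschitz bound handles the other directions.\<close>

lemma rademacher_real:
  fixes f :: "'a::euclidean_space \<Rightarrow> real"
  assumes lip: "L-lipschitz_on UNIV f"
  shows "AE x in lborel. f differentiable (at x)"
proof -
  have L0: "0 \<le> L" by (rule lipschitz_on_nonneg[OF lip])
  obtain D :: "'a set" where D: "countable D" "\<And>X. open X \<Longrightarrow> X \<noteq> {} \<Longrightarrow> \<exists>d\<in>D. d \<in> X"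
    by (metis countable_dense_setE)
  define T where "T x w = (\<Sum>b\<in>Basis. (w \<bullet> b) * dirderiv f b x)" for x w
  have "AE x in lborel. dirderiv f w x = T x w" for w
  proof -
    have "AE x in lborel. \<forall>b\<in>Basis. dirderiv f ((w \<bullet> b) *\<^sub>R b) x = (w \<bullet> b) * dirderiv f b x"
      by (intro AE_finite_allI AE_dirderiv_scaleR[OF lip] finite_Basis)
    with AE_dirderiv_sum[OF lip finite_Basis, of "\<lambda>b. (w \<bullet> b) *\<^sub>R b"] show ?thesis
      by eventually_elim (simp add: euclidean_representation T_def)
  qed
  note dT = this
  have "AE x in lborel. (\<lambda>k. diffquot f w k x) \<longlonglongrightarrow> T x w" for w
    using AE_convergent_diffquot[OF lip, of w] dT[of w]
    by eventually_elim (simp add: dirderiv_def convergent_LIMSEQ_iff)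
  then have "AE x in lborel. \<forall>w\<in>D. (\<lambda>k. diffquot f w k x) \<longlonglongrightarrow> T x w"
    using D(1) by (subst AE_ball_countable) auto
  then show ?thesis
  proof eventually_elim
    case (elim x)
    have T: "bounded_linear (T x)" unfolding T_def
      by (intro bounded_linear_sum bounded_linear_mult_left bounded_linear_compose[OF bounded_linear_mult_left] bounded_linear_inner_left)
    obtain K where K: "K > 0" "\<And>v. norm (T x v) \<le> norm v * K"
      using bounded_linear.pos_bounded[OF T] by auto
    have "(f has_derivative T x) (at x)"
      unfolding has_derivative_at_alt
    proof (intro conjI T allI impI)
      fix e :: real assume e: "0 < e"
      \<comment> \<open>Replacing a unit direction by a net point costs \<open>L * \<eta>\<close> in
        \<open>f\<close> and \<open>K * \<eta>\<close> in the linear map, together half of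
        \<open>e\<close>.\<close>
      define \<eta> where "\<eta> = e / (2 * (L + K))"
      have \<eta>: "\<eta> > 0" "(L + K) * \<eta> = e / 2" 
      proof -
        have "L + K > 0" using L0 K by simp
        then show "\<eta> > 0" "(L + K) * \<eta> = e / 2" using e by (auto simp: \<eta>_def divide_simps)
      qed
      have "sphere (0::'a) 1 \<subseteq> (\<Union>w\<in>D. ball w \<eta>)"
      proof
        fix v :: 'a
        obtain d where "d \<in> D" "d \<in> ball v \<eta>" using D(2)[of "ball v \<eta>"] \<eta> by auto
        then show "v \<in> (\<Union>w\<in>D. ball w \<eta>)" by (auto simp: dist_commute)
      qed
      then obtain W where W: "W \<subseteq> D" "finite W" "sphere (0::'a) 1 \<subseteq> (\<Union>w\<in>W. ball w \<eta>)"
        by (rule compactE_image[OF compact_sphere _ , rotated]) auto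
      have "\<forall>\<^sub>F t in at_right 0. \<forall>w\<in>W. dist ((f (x + t *\<^sub>R w) - f x) / t) (T x w) < e / 2"
        using W elim e by (intro eventually_ball_finite ballI tendstoD diffquot_tendsto_imp_at_right[OF lip]) auto
      then obtain d where d: "d > 0"
        "\<And>t w. 0 < t \<Longrightarrow> t < d \<Longrightarrow> w \<in> W \<Longrightarrow> dist ((f (x + t *\<^sub>R w) - f x) / t) (T x w) < e / 2"
        unfolding eventually_at_right_field by auto
      show "\<exists>d>0. \<forall>y. norm (y - x) < d \<longrightarrow> norm (f y - f x - T x (y - x)) \<le> e * norm (y - x)"
      proof (intro exI[of _ d] conjI d allI impI)
        fix y assume y: "norm (y - x) < d"
        show "norm (f y - f x - T x (y - x)) \<le> e * norm (y - x)"
        proof (cases "y = x")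
          case True
          then show ?thesis using linear_0[OF bounded_linear.linear[OF T]] by simp
        next
          case False
          define t where "t = norm (y - x)"
          define \<omega> where "\<omega> = (1 / t) *\<^sub>R (y - x)"
          have t: "0 < t" "t < d" using False y by (auto simp: t_def)
          have yx: "y = x + t *\<^sub>R \<omega>" using t by (simp add: \<omega>_def)
          have "norm \<omega> = 1" using t by (simp add: \<omega>_def t_def)
          then obtain w where w: "w \<in> W" "dist w \<omega> < \<eta>" using W(3) by auto
          have 1: "\<bar>f (x + t *\<^sub>R \<omega>) - f (x + t *\<^sub>R w)\<bar> \<le> L * (t * \<eta>)"
          proof -
            have "\<bar>f (x + t *\<^sub>R \<omega>) - f (x + t *\<^sub>R w)\<bar> \<le> L * dist (x + t *\<^sub>R \<omega>) (x + t *\<^sub>R w)"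
              using lipschitz_onD[OF lip, of "x + t *\<^sub>R \<omega>" "x + t *\<^sub>R w"] by (simp add: dist_real_def)
            also have "dist (x + t *\<^sub>R \<omega>) (x + t *\<^sub>R w) = t * dist w \<omega>"
              using t by (simp add: dist_norm norm_minus_commute flip: scaleR_diff_right)
            finally show ?thesis using L0 w t by (smt (verit) mult_left_mono)
          qed
          have 2: "\<bar>f (x + t *\<^sub>R w) - f x - t * T x w\<bar> \<le> t * (e / 2)"
          proof -
            have "f (x + t *\<^sub>R w) - f x - t * T x w = t * ((f (x + t *\<^sub>R w) - f x) / t - T x w)"
              using t unfolding right_diff_distrib[of t "_ / _"] by simp
            then show ?thesis using d(2)[OF t w(1)] t by (simp add: abs_mult dist_real_def)
          qed
          have 3: "\<bar>t * T x w - t * T x \<omega>\<bar> \<le> t * (\<eta> * K)"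
          proof -
            have "t * T x w - t * T x \<omega> = t * T x (w - \<omega>)"
              by (simp add: linear_diff[OF bounded_linear.linear[OF T]] right_diff_distrib)
            moreover have "\<bar>T x (w - \<omega>)\<bar> \<le> \<eta> * K"
              using K(2)[of "w - \<omega>"] w(2) K(1) by (smt (verit) dist_norm mult_right_mono real_norm_def)
            ultimately show ?thesis using t by (simp add: abs_mult)
          qed
          have "T x (y - x) = t * T x \<omega>"
            using linear_scale[OF bounded_linear.linear[OF T], of t \<omega>] by (simp add: yx)
          then have "norm (f y - f x - T x (y - x)) \<le> L * (t * \<eta>) + t * (e / 2) + t * (\<eta> * K)"
            unfolding yx real_norm_def using 1 2 3 by (simp only: add_diff_cancel_left')
          also have "\<dots> = t * ((L + K) * \<eta> + e / 2)" by (simp add: algebra_simps)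
          also have "\<dots> = e * norm (y - x)" using \<eta>(2) by (simp add: t_def)
          finally show ?thesis .
        qed
      qed
    qed
    then show ?case by (rule differentiableI)
  qed
qed

lemma rademacher:
  fixes f :: "'a::euclidean_space \<Rightarrow> 'b::euclidean_space"
  assumes lip: "L-lipschitz_on UNIV f"
  shows "AE x in lborel. f differentiable (at x)"
proof -
  have "L-lipschitz_on UNIV (\<lambda>x. f x \<bullet> b)" if "b \<in> Basis" for b
  proof (rule lipschitz_onI)
    fix x y
    have "dist (f x \<bullet> b) (f y \<bullet> b) \<le> dist (f x) (f y)"
      using Basis_le_norm[OF that, of "f x - f y"] by (simp add: dist_norm inner_diff_left)
    also have "\<dots> \<le> L * dist x y" by (rule lipschitz_onD[OF lip]) auto
    finally show "dist (f x \<bullet> b) (f y \<bullet> b) \<le> L * dist x y" .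
  qed (rule lipschitz_on_nonneg[OF lip])
  then have "AE x in lborel. \<forall>b\<in>Basis. (\<lambda>x. f x \<bullet> b) differentiable (at x)"
    by (intro AE_finite_allI rademacher_real) auto
  then show ?thesis
    by eventually_elim (subst differentiable_componentwise_within, auto)
qed

section \<open>Localisation of Rademacher's theorem\<close>

definition locally_lipschitz :: "('a::metric_space \<Rightarrow> 'b::metric_space) \<Rightarrow> bool" where
  "locally_lipschitz f \<longleftrightarrow> (\<forall>z. \<exists>e>0. \<exists>L. L-lipschitz_on (cball z e) f)"

text \<open>Composing with the metric projection onto a closed ball, which is 1-Lipschitz, yields a
  globally Lipschitz function that agrees with \<open>f\<close> on the ball. By Lindelof's theorem
  countably many balls suffice.\<close>

lemma rademacher_local:
  fixes f :: "'a::euclidean_space \<Rightarrow> 'b::euclidean_space"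
  assumes "locally_lipschitz f"
  shows "AE x in lborel. f differentiable (at x)"
proof -
  from assms obtain e L where e: "\<And>z. e z > 0" "\<And>z. (L z)-lipschitz_on (cball z (e z)) f"
    unfolding locally_lipschitz_def by metis
  have loc: "AE x in lborel. x \<in> ball z (e z) \<longrightarrow> f differentiable (at x)" for z
  proof -
    define p where "p = closest_point (cball z (e z))"
    have "1-lipschitz_on UNIV p" unfolding p_def
      by (intro lipschitz_onI) (use closest_point_lipschitz[of "cball z (e z)"] e(1)[of z] in \<open>auto simp: less_imp_le\<close>)
    moreover have "(L z)-lipschitz_on (p ` UNIV) f"
      by (rule lipschitz_on_subset[OF e(2)])
        (use closest_point_in_set[of "cball z (e z)"] e(1)[of z] in \<open>auto simp: p_def less_imp_le\<close>)
    ultimately have "(L z * 1)-lipschitz_on UNIV (f \<circ> p)"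
      by (rule lipschitz_on_compose)
    from rademacher[OF this] show ?thesis
    proof eventually_elim
      case (elim x)
      show ?case
      proof
        assume x: "x \<in> ball z (e z)"
        from elim obtain D where "((f \<circ> p) has_derivative D) (at x)" by (auto simp: differentiable_def)
        then have "(f has_derivative D) (at x)"
          by (rule has_derivative_transform_within_open[OF _ open_ball x]) (simp add: p_def closest_point_self)
        then show "f differentiable (at x)" by (rule differentiableI)
      qed
    qed
  qed
  obtain C where C: "C \<subseteq> range (\<lambda>z. ball z (e z))" "countable C" "\<Union>C = \<Union>(range (\<lambda>z. ball z (e z)))"
    by (rule Lindelof[of "range (\<lambda>z. ball z (e z))"]) auto
  have "AE x in lborel. \<forall>B\<in>C. x \<in> B \<longrightarrow> f differentiable (at x)"
    using C(1,2) loc by (subst AE_ball_countable) auto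
  then show ?thesis
  proof eventually_elim
    case (elim x)
    have "x \<in> \<Union>C" unfolding C(3) using e(1)[of x] centre_in_ball by blast
    with elim show ?case by auto
  qed
qed

section \<open>Ball means and their Jacobians\<close>

lemma locally_lipschitz_compact:
  fixes f :: "'a::euclidean_space \<Rightarrow> 'b::euclidean_space"
  assumes "locally_lipschitz f" "compact S"
  obtains L where "L-lipschitz_on S f"
proof -
  \<comment> \<open>The time parameter of \<open>local_lipschitz\<close> is a dummy with the single
    value 0.\<close>
  have "local_lipschitz {0::real} S (\<lambda>_. f)"
  proof (rule local_lipschitzI)
    fix t x assume "t \<in> {0::real}" "x \<in> S"
    from assms(1) obtain e L where e: "e > 0" "L-lipschitz_on (cball x e) f"
      unfolding locally_lipschitz_def by blast
    have "L-lipschitz_on (cball x e \<inter> S) f" by (rule lipschitz_on_subset[OF e(2)]) auto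
    then show "\<exists>u>0. \<exists>L. \<forall>t\<in>cball t u \<inter> {0}. L-lipschitz_on (cball x u \<inter> S) f"
      using e(1) by blast
  qed
  then obtain L where "\<And>t. t \<in> {0::real} \<Longrightarrow> L-lipschitz_on S f"
    by (rule local_lipschitz_compact_implies_lipschitz[OF _ assms(2) compact_insert[OF compact_empty, of 0]]) auto
  then show thesis using that by blast
qed

lemma locally_lipschitz_continuous_on:
  fixes f :: "'a::euclidean_space \<Rightarrow> 'b::euclidean_space"
  assumes "locally_lipschitz f"
  shows "continuous_on UNIV f"
proof (rule continuous_at_imp_continuous_on, intro ballI)
  fix x
  from assms obtain e L where e: "e > 0" "L-lipschitz_on (cball x e) f"
    unfolding locally_lipschitz_def by blast
  then have "continuous_on (ball x e) f"
    by (intro continuous_on_subset[OF lipschitz_on_continuous_on[OF e(2)]]) auto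
  then show "isCont f x" using e(1) by (simp add: continuous_on_eq_continuous_at)
qed

lemma locally_lipschitz_borel_measurable:
  fixes f :: "'a::euclidean_space \<Rightarrow> 'b::euclidean_space"
  shows "locally_lipschitz f \<Longrightarrow> f \<in> borel_measurable borel"
  by (intro borel_measurable_continuous_onI locally_lipschitz_continuous_on)

section \<open>Jacobians as measurable, locally bounded functions\<close>

lemma has_derivative_imp_quotient_tendsto:
  assumes "(f has_derivative D) (at x)"
  shows "((\<lambda>t. (f (x + t *\<^sub>R w) - f x) /\<^sub>R t) \<longlongrightarrow> D w) (at 0)"
proof -
  have "((\<lambda>t. x + t *\<^sub>R w) has_derivative (\<lambda>t. t *\<^sub>R w)) (at 0)"
    by (auto intro!: derivative_eq_intros)
  moreover have "(f has_derivative D) (at (x + 0 *\<^sub>R w))" using assms by simp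
  ultimately have "((\<lambda>t. f (x + t *\<^sub>R w)) has_derivative (\<lambda>t. D (t *\<^sub>R w))) (at 0)"
    by (rule has_derivative_compose)
  then have "((\<lambda>t. f (x + t *\<^sub>R w)) has_vector_derivative D w) (at 0)"
    unfolding has_vector_derivative_def
    using linear_scale[OF has_derivative_linear[OF assms]] by simp
  then have "((\<lambda>t. norm (f (x + t *\<^sub>R w) - f x - t *\<^sub>R D w) / norm t) \<longlongrightarrow> 0) (at 0)"
    by (simp add: has_vector_derivative_def has_derivative_at)
  then have "((\<lambda>t. norm ((f (x + t *\<^sub>R w) - f x) /\<^sub>R t - D w)) \<longlongrightarrow> 0) (at 0)"
  proof (rule Lim_transform_eventually)
    have "norm (v - t *\<^sub>R D w) / norm t = norm (v /\<^sub>R t - D w)" if "t \<noteq> 0" for v t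
    proof -
      have "v /\<^sub>R t - D w = (v - t *\<^sub>R D w) /\<^sub>R t" using that by (simp add: scaleR_diff_right)
      then show ?thesis by (simp only: norm_scaleR) (simp add: divide_inverse mult.commute)
    qed
    then show "\<forall>\<^sub>F t in at 0. norm (f (x + t *\<^sub>R w) - f x - t *\<^sub>R D w) / norm t
        = norm ((f (x + t *\<^sub>R w) - f x) /\<^sub>R t - D w)"
      by (intro eventually_mono[OF eventually_neq_at_within[of 0]]) auto
  qed
  from tendsto_norm_zero_cancel[OF this] show ?thesis by (rule LIM_zero_cancel)
qed

lemma bounded_linear_matrix_vector_mul_left:
  "bounded_linear (\<lambda>A::real^'d^'n. A *v w)"
  unfolding linear_conv_bounded_linear[symmetric]
  by (intro linearI) (simp_all add: matrix_vector_mult_add_rdistrib scaleR_matrix_vector_assoc)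

text \<open>Built from \<open>dirderiv\<close> so that it is Borel on the whole space; it agrees
  with \<open>jacobian\<close> wherever \<open>f\<close> is differentiable.\<close>

definition jac :: "(real^'d \<Rightarrow> real^'n) \<Rightarrow> real^'d \<Rightarrow> real^'d^'n" where
  "jac f z = (\<chi> i j. dirderiv f (axis j 1) z $ i)"

lemma borel_measurable_jac [measurable]:
  fixes f :: "real^'d \<Rightarrow> real^'n"
  assumes [measurable]: "f \<in> borel_measurable borel"
  shows "jac f \<in> borel_measurable borel"
proof (rule borel_measurable_euclidean_space[THEN iffD2, rule_format])
  fix B :: "real^'d^'n" assume "B \<in> Basis"
  then obtain i j where B: "B = axis i (axis j 1)" by (auto simp: Basis_vec_def)
  have "jac f z \<bullet> B = dirderiv f (axis j 1) z \<bullet> axis i 1" for z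
    by (simp add: B jac_def inner_axis)
  then show "(\<lambda>z. jac f z \<bullet> B) \<in> borel_measurable borel" by simp
qed

lemma jac_eq_jacobian:
  fixes f :: "real^'d \<Rightarrow> real^'n"
  assumes "f differentiable (at z)"
  shows "jac f z = jacobian f (at z)"
proof -
  have D: "(f has_derivative (\<lambda>h. jacobian f (at z) *v h)) (at z)"
    using assms jacobian_works by blast
  have "dirderiv f w z = jacobian f (at z) *v w" for w
  proof -
    have "(\<lambda>k. diffquot f w k z) \<longlonglongrightarrow> jacobian f (at z) *v w"
    proof -
      have "filterlim (\<lambda>k. 1 / real (Suc k)) (at 0) sequentially"
        unfolding filterlim_at using LIMSEQ_inverse_real_of_nat by (auto simp: inverse_eq_divide)
      from filterlim_compose[OF has_derivative_imp_quotient_tendsto[OF D, of w] this]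
      show ?thesis by (simp add: diffquot_def)
    qed
    then show ?thesis unfolding dirderiv_def by (rule limI)
  qed
  then show ?thesis by (simp add: jac_def vec_eq_iff matrix_vector_mult_basis column_def)
qed

lemma jac_has_derivative:
  "f differentiable (at z) \<Longrightarrow> (f has_derivative (\<lambda>h. jac f z *v h)) (at z)"
  using jac_eq_jacobian jacobian_works by metis

lemma norm_divideR_le:
  fixes x :: "'a::real_normed_vector"
  assumes "norm x \<le> L * norm (t *\<^sub>R w)" "t \<noteq> 0"
  shows "norm (x /\<^sub>R t) \<le> L * norm w"
proof -
  have "norm (x /\<^sub>R t) = norm x / \<bar>t\<bar>" by (simp add: divide_inverse mult.commute)
  then show ?thesis using assms by (simp add: pos_divide_le_eq mult_ac)
qed

text \<open>Every column has norm at most \<open>L\<close>, as a limit of difference quotients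
  inside the ball. The dimension factors come from the crude estimate of the matrix norm by the sum
  of the absolute values of its entries.\<close>

lemma norm_jac_le:
  fixes f :: "real^'d \<Rightarrow> real^'n"
  assumes lip: "L-lipschitz_on (ball z0 r) f" and z: "z \<in> ball z0 r" and d: "f differentiable (at z)"
  shows "norm (jac f z) \<le> real CARD('n) * (real CARD('d) * L)"
proof -
  have bd: "norm (jac f z *v w) \<le> L * norm w" for w
  proof (rule tendsto_upperbound[OF tendsto_norm])
    show "((\<lambda>t. (f (z + t *\<^sub>R w) - f z) /\<^sub>R t) \<longlongrightarrow> jac f z *v w) (at 0)"
      by (rule has_derivative_imp_quotient_tendsto[OF jac_has_derivative[OF d]])
    have "((\<lambda>t. z + t *\<^sub>R w) \<longlongrightarrow> z + 0 *\<^sub>R w) (at 0)" by (intro tendsto_intros)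
    then have "\<forall>\<^sub>F t in at 0. z + t *\<^sub>R w \<in> ball z0 r"
      using z by (intro topological_tendstoD) auto
    then show "\<forall>\<^sub>F t in at 0. norm ((f (z + t *\<^sub>R w) - f z) /\<^sub>R t) \<le> L * norm w"
    proof (rule eventually_mono[OF eventually_conj[OF _ eventually_neq_at_within[of 0]]])
      fix t :: real assume t: "z + t *\<^sub>R w \<in> ball z0 r \<and> t \<noteq> 0"
      then have "norm (f (z + t *\<^sub>R w) - f z) \<le> L * norm (t *\<^sub>R w)"
        using lipschitz_onD[OF lip, of "z + t *\<^sub>R w" z] z by (simp add: dist_norm)
      then show "norm ((f (z + t *\<^sub>R w) - f z) /\<^sub>R t) \<le> L * norm w"
        using t by (intro norm_divideR_le) auto
    qed
  qed simp
  have entry: "\<bar>jac f z $ i $ j\<bar> \<le> L" for i j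
  proof -
    have "\<bar>(jac f z *v axis j 1) $ i\<bar> \<le> norm (jac f z *v axis j 1)" by (rule component_le_norm_cart)
    also have "\<dots> \<le> L" using bd[of "axis j 1"] by simp
    finally show ?thesis by (simp add: matrix_vector_mult_basis column_def)
  qed
  have row: "norm (jac f z $ i) \<le> real CARD('d) * L" for i
  proof -
    have "norm (jac f z $ i) \<le> (\<Sum>j\<in>UNIV. \<bar>jac f z $ i $ j\<bar>)" by (rule norm_le_l1_cart)
    also have "\<dots> \<le> (\<Sum>j\<in>(UNIV::'d set). L)" by (intro sum_mono entry)
    finally show ?thesis by simp
  qed
  have "norm (jac f z) \<le> (\<Sum>i\<in>UNIV. norm (jac f z $ i))"
    unfolding norm_vec_def by (rule L2_set_le_sum) simp
  also have "\<dots> \<le> (\<Sum>i\<in>(UNIV::'n set). real CARD('d) * L)" by (intro sum_mono row)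
  finally show ?thesis by simp
qed

lemma jac_locally_bounded:
  fixes f :: "real^'d \<Rightarrow> real^'n"
  assumes "locally_lipschitz f"
  obtains K where "K \<ge> 0" "\<And>z. z \<in> ball z0 r \<Longrightarrow> f differentiable (at z) \<Longrightarrow> norm (jac f z) \<le> K"
proof -
  obtain L where L: "L-lipschitz_on (cball z0 r) f"
    using locally_lipschitz_compact[OF assms compact_cball] by blast
  have L': "L-lipschitz_on (ball z0 r) f" by (rule lipschitz_on_subset[OF L]) auto
  show thesis
    using that[of "real CARD('n) * (real CARD('d) * L)"] norm_jac_le[OF L'] lipschitz_on_nonneg[OF L]
    by auto
qed

section \<open>Averages over balls\<close>

definition ball_weight :: "real \<Rightarrow> 'a::euclidean_space \<Rightarrow> real" where
  "ball_weight h y = indicator (ball 0 h) y / measure lborel (ball (0::'a) h)"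

lemma borel_measurable_ball_weight [measurable]: "ball_weight h \<in> borel_measurable borel"
  unfolding ball_weight_def[abs_def]
  by (intro borel_measurable_divide borel_measurable_indicator borel_measurable_const) auto

lemma ball_weight_nonneg [simp]: "0 \<le> ball_weight h y"
  by (simp add: ball_weight_def)

lemma ball_weight_eq_0: "norm y \<ge> h \<Longrightarrow> ball_weight h y = 0"
  by (simp add: ball_weight_def)

lemma norm_ball_weight_scaleR_le:
  "norm X \<le> B \<Longrightarrow> norm (ball_weight h y *\<^sub>R X) \<le> B * ball_weight h y"
  using mult_right_mono[of "norm X" B "ball_weight h y"] by (simp add: mult.commute)

lemma emeasure_lborel_ball_less_top: "emeasure lborel (ball (z::'a::euclidean_space) h) < \<infinity>"
  by (rule emeasure_bounded_finite) auto

lemma integrable_ball_weight [simp]: "integrable lborel (ball_weight h :: 'a::euclidean_space \<Rightarrow> real)"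
  unfolding ball_weight_def[abs_def]
  using emeasure_lborel_ball_less_top[of "0::'a" h]
  by (intro integrable_divide integrable_real_indicator) auto

lemma integral_ball_weight:
  assumes "h > 0"
  shows "(\<integral>y. ball_weight h (y :: 'a::euclidean_space) \<partial>lborel) = 1"
proof -
  have "measure lborel (ball (0::'a) h) > 0" using assms by (simp add: content_ball_pos)
  then show ?thesis by (simp add: ball_weight_def)
qed

definition ball_mean :: "real \<Rightarrow> ('a::euclidean_space \<Rightarrow> 'b::euclidean_space) \<Rightarrow> 'a \<Rightarrow> 'b" where
  "ball_mean h F z = (\<integral>y. ball_weight h y *\<^sub>R F (z + y) \<partial>lborel)"

lemma ball_mean_shift:
  assumes [measurable]: "F \<in> borel_measurable borel"
  shows "ball_mean h F z = (\<integral>y. ball_weight h (y - z) *\<^sub>R F y \<partial>lborel)"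
proof -
  have "(\<integral>y. ball_weight h (y - z) *\<^sub>R F y \<partial>lborel) = (\<integral>y. ball_weight h (y - z) *\<^sub>R F y \<partial>distr lborel borel ((+) z))"
    by (simp add: lborel_distr_plus)
  also have "\<dots> = ball_mean h F z" unfolding ball_mean_def
    by (subst integral_distr) auto
  finally show ?thesis by simp
qed

lemma AE_lborel_translate:
  assumes "AE y in lborel. P (y::'a::euclidean_space)"
  shows "AE y in lborel. P (z + y)"
proof -
  have "AE y in distr lborel borel ((+) z). P y"
    unfolding lborel_distr_plus by (rule assms)
  then show ?thesis by (rule AE_distrD[rotated]) simp
qed

lemma integrable_ball_weight_bounded:
  fixes F :: "'a::euclidean_space \<Rightarrow> 'b::euclidean_space"
  assumes [measurable]: "F \<in> borel_measurable borel"
    and bd: "AE y in lborel. y \<in> ball z h \<longrightarrow> norm (F y) \<le> K"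
  shows "integrable lborel (\<lambda>y. ball_weight h y *\<^sub>R F (z + y))"
proof (rule Bochner_Integration.integrable_bound)
  show "integrable lborel (\<lambda>y::'a. K * ball_weight h y)" by simp
  show "AE y in lborel. norm (ball_weight h y *\<^sub>R F (z + y)) \<le> norm (K * ball_weight h y)"
    using AE_lborel_translate[OF bd, of z]
  proof eventually_elim
    case (elim y)
    show ?case
    proof (cases "norm y < h")
      case True
      then have "norm (F (z + y)) \<le> K" using elim by (simp add: dist_norm)
      then have "norm (F (z + y)) \<le> \<bar>K\<bar>" by linarith
      from norm_ball_weight_scaleR_le[OF this, of h y] show ?thesis by (simp add: abs_mult)
    next
      case False
      then show ?thesis by (simp add: ball_weight_eq_0)
    qed
  qed
qed measurable

text \<open>A hyperplane strictly separating the mean from \<open>K\<close> is refuted by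
  integrating against the weight, whose total mass is 1. The bound \<open>B\<close> secures
  integrability.\<close>

lemma ball_mean_in_closed_convex:
  fixes F :: "'a::euclidean_space \<Rightarrow> 'b::euclidean_space"
  assumes h: "h > 0" and [measurable]: "F \<in> borel_measurable borel" and K: "closed K" "convex K"
    and bd: "AE y in lborel. y \<in> ball z h \<longrightarrow> norm (F y) \<le> B"
    and mem: "AE y in lborel. y \<in> ball z h \<longrightarrow> F y \<in> K"
  shows "ball_mean h F z \<in> K"
proof (rule ccontr)
  assume "ball_mean h F z \<notin> K"
  then obtain P c where P: "P \<bullet> ball_mean h F z < c" "\<And>x. x \<in> K \<Longrightarrow> c < P \<bullet> x"
    using separating_hyperplane_closed_point[OF K(2,1)] by metis
  have int: "integrable lborel (\<lambda>y. ball_weight h y *\<^sub>R F (z + y))"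
    by (rule integrable_ball_weight_bounded[OF _ bd]) measurable
  have "c = (\<integral>y. c * ball_weight h (y::'a) \<partial>lborel)" using integral_ball_weight[OF h, where 'a='a] by simp
  also have "\<dots> \<le> (\<integral>y. P \<bullet> (ball_weight h y *\<^sub>R F (z + y)) \<partial>lborel)"
  proof (rule integral_mono_AE)
    show "integrable lborel (\<lambda>y. P \<bullet> (ball_weight h y *\<^sub>R F (z + y)))"
      by (rule integrable_inner_right) (use int in auto)
    show "AE y in lborel. c * ball_weight h y \<le> P \<bullet> (ball_weight h y *\<^sub>R F (z + y))"
      using AE_lborel_translate[OF mem, of z]
    proof eventually_elim
      case (elim y)
      show ?case
      proof (cases "norm y < h")
        case True
        then have "F (z + y) \<in> K" using elim by (simp add: dist_norm)
        then show ?thesis 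
          using mult_right_mono[of c "P \<bullet> F (z + y)" "ball_weight h y"] P(2)[of "F (z + y)"]
          by (simp add: mult.commute)
      next
        case False
        then show ?thesis by (simp add: ball_weight_eq_0)
      qed
    qed
  qed simp
  also have "\<dots> = P \<bullet> ball_mean h F z"
    unfolding ball_mean_def using int by (intro integral_inner_right) auto
  finally show False using P(1) by simp
qed

text \<open>Differentiation under the integral sign: the integrands converge almost everywhere by
  Rademacher's theorem and are dominated through the Lipschitz constant on a ball containing all
  points involved. Null sequences \<open>t\<close> are the form in which dominated convergence
  applies.\<close>

lemma ball_mean_quotient_tendsto:
  fixes f :: "real^'d \<Rightarrow> real^'n"
  assumes ll: "locally_lipschitz f" and t: "t \<longlonglongrightarrow> 0" "\<And>k. t k \<noteq> 0"
  shows "(\<lambda>k. (ball_mean h f (z + t k *\<^sub>R w) - ball_mean h f z) /\<^sub>R t k) \<longlonglongrightarrow> ball_mean h (jac f) z *v w"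
proof -
  have [measurable]: "f \<in> borel_measurable borel" using ll by (rule locally_lipschitz_borel_measurable)
  obtain T where T: "\<And>k. norm (t k) \<le> T" using convergent_imp_Bseq[of t] t(1)
    by (auto simp: convergent_def Bseq_def)
  define R where "R = h + T * norm w"
  obtain L where L: "L-lipschitz_on (cball z R) f"
    using locally_lipschitz_compact[OF ll compact_cball] by blast
  have Tw: "norm (t k *\<^sub>R w) \<le> T * norm w" for k using T[of k] by (simp add: mult_right_mono)
  have in_ball: "z + y + t k *\<^sub>R w \<in> cball z R" "z + y \<in> cball z R" if "norm y < h" for y k
  proof -
    have "norm (y + t k *\<^sub>R w) \<le> R"
      using norm_triangle_ineq[of y "t k *\<^sub>R w"] Tw[of k] that by (simp add: R_def)
    then show "z + y + t k *\<^sub>R w \<in> cball z R" 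
      unfolding mem_cball dist_norm by (metis add.assoc add_diff_cancel_left' norm_minus_commute)
    have "0 \<le> T * norm w" using Tw[of k] norm_ge_zero order_trans by blast
    then show "z + y \<in> cball z R" using that by (simp add: dist_norm R_def)
  qed
  have fbd: "\<exists>B. \<forall>y\<in>ball z' h. norm (f y) \<le> B" for z'
  proof -
    have "compact (f ` cball z' h)"
      by (intro compact_continuous_image continuous_on_subset[OF locally_lipschitz_continuous_on[OF ll]]) auto
    then obtain B where "\<forall>y\<in>f ` cball z' h. norm y \<le> B" by (meson bounded_iff compact_imp_bounded)
    then show ?thesis by force
  qed
  have int: "integrable lborel (\<lambda>y. ball_weight h y *\<^sub>R f (z' + y))" for z'
  proof -
    obtain B where "\<forall>y\<in>ball z' h. norm (f y) \<le> B" using fbd by blast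
    then show ?thesis by (intro integrable_ball_weight_bounded[where K=B]) auto
  qed
  obtain K where K: "\<And>y. y \<in> ball z h \<Longrightarrow> f differentiable (at y) \<Longrightarrow> norm (jac f y) \<le> K"
    using jac_locally_bounded[OF ll] by metis
  have "AE y in lborel. y \<in> ball z h \<longrightarrow> norm (jac f y) \<le> K"
    using rademacher_local[OF ll] by eventually_elim (use K in blast)
  then have intJ: "integrable lborel (\<lambda>y. ball_weight h y *\<^sub>R jac f (z + y))"
    by (rule integrable_ball_weight_bounded[rotated]) measurable
  have "(\<lambda>k. \<integral>y. ball_weight h y *\<^sub>R ((f (z + y + t k *\<^sub>R w) - f (z + y)) /\<^sub>R t k) \<partial>lborel)
     \<longlonglongrightarrow> (\<integral>y. ball_weight h y *\<^sub>R (jac f (z + y) *v w) \<partial>lborel)"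
  proof (rule integral_dominated_convergence[where w = "\<lambda>y. L * norm w * ball_weight h y"])
    show "AE y in lborel. (\<lambda>k. ball_weight h y *\<^sub>R ((f (z + y + t k *\<^sub>R w) - f (z + y)) /\<^sub>R t k))
      \<longlonglongrightarrow> ball_weight h y *\<^sub>R (jac f (z + y) *v w)"
      using AE_lborel_translate[OF rademacher_local[OF ll], of z]
    proof eventually_elim
      case (elim y)
      have "filterlim t (at 0) sequentially" unfolding filterlim_at using t by simp
      from filterlim_compose[OF has_derivative_imp_quotient_tendsto[OF jac_has_derivative[OF elim], of w] this]
      show ?case by (intro tendsto_intros)
    qed
    show "AE y in lborel. norm (ball_weight h y *\<^sub>R ((f (z + y + t k *\<^sub>R w) - f (z + y)) /\<^sub>R t k))
      \<le> L * norm w * ball_weight h y" for k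
    proof (intro AE_I2)
      fix y :: "real^'d"
      show "norm (ball_weight h y *\<^sub>R ((f (z + y + t k *\<^sub>R w) - f (z + y)) /\<^sub>R t k)) \<le> L * norm w * ball_weight h y"
      proof (cases "norm y < h")
        case True
        have "norm (f (z + y + t k *\<^sub>R w) - f (z + y)) \<le> L * norm (t k *\<^sub>R w)"
          using lipschitz_onD[OF L in_ball[OF True]] by (simp add: dist_norm)
        then have "norm ((f (z + y + t k *\<^sub>R w) - f (z + y)) /\<^sub>R t k) \<le> L * norm w"
          using t(2)[of k] by (rule norm_divideR_le)
        then show ?thesis by (rule norm_ball_weight_scaleR_le)
      next
        case False
        then show ?thesis by (simp add: ball_weight_eq_0)
      qed
    qed
    have [measurable]: "(\<lambda>y. jac f (z + y) *v w) \<in> borel_measurable borel"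
      by (rule borel_measurable_continuous_on[where f = "\<lambda>A. A *v w"])
        (auto intro!: continuous_intros linear_continuous_on bounded_linear_matrix_vector_mul_left)
    show "(\<lambda>y. ball_weight h y *\<^sub>R (jac f (z + y) *v w)) \<in> borel_measurable lborel" by measurable
  qed (auto intro!: integrable_mult_right)
  moreover have "(\<integral>y. ball_weight h y *\<^sub>R ((f (z + y + t k *\<^sub>R w) - f (z + y)) /\<^sub>R t k) \<partial>lborel)
      = (ball_mean h f (z + t k *\<^sub>R w) - ball_mean h f z) /\<^sub>R t k" for k
  proof -
    have "(ball_mean h f (z + t k *\<^sub>R w) - ball_mean h f z) /\<^sub>R t k
       = (\<integral>y. (ball_weight h y *\<^sub>R f (z + t k *\<^sub>R w + y) - ball_weight h y *\<^sub>R f (z + y)) /\<^sub>R t k \<partial>lborel)"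
      unfolding ball_mean_def by (simp add: Bochner_Integration.integral_diff[OF int int])
    also have "\<dots> = (\<integral>y. ball_weight h y *\<^sub>R ((f (z + y + t k *\<^sub>R w) - f (z + y)) /\<^sub>R t k) \<partial>lborel)"
      by (intro Bochner_Integration.integral_cong) (auto simp: algebra_simps)
    finally show ?thesis by simp
  qed
  moreover have "(\<integral>y. ball_weight h y *\<^sub>R (jac f (z + y) *v w) \<partial>lborel) = ball_mean h (jac f) z *v w"
  proof -
    have "bounded_linear (\<lambda>A::real^'d^'n. A *v w)" by (rule bounded_linear_matrix_vector_mul_left)
    from integral_bounded_linear[OF this intJ] show ?thesis
      by (simp add: ball_mean_def scaleR_matrix_vector_assoc)
  qed
  ultimately show ?thesis by simp
qed

text \<open>\<open>jac f\<close> itself need not be continuous. After a translation,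
  \<open>z\<close> enters only through the weight, which converges at every point off the sphere of
  radius \<open>h\<close> about \<open>z\<close>, a null set.\<close>

lemma isCont_ball_mean_jac:
  fixes f :: "real^'d \<Rightarrow> real^'n"
  assumes ll: "locally_lipschitz f"
  shows "isCont (ball_mean h (jac f)) z"
  unfolding continuous_at_sequentially comp_def
proof (intro allI impI)
  fix u assume u: "u \<longlonglongrightarrow> z"
  have [measurable]: "f \<in> borel_measurable borel" using ll by (rule locally_lipschitz_borel_measurable)
  obtain U where U: "\<And>k. norm (u k) \<le> U" using convergent_imp_Bseq[of u] u
    by (auto simp: convergent_def Bseq_def)
  obtain K where K: "K \<ge> 0" "\<And>y. y \<in> ball 0 (U + h) \<Longrightarrow> f differentiable (at y) \<Longrightarrow> norm (jac f y) \<le> K"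
    using jac_locally_bounded[OF ll] by metis
  define V where "V = measure lborel (ball (0::real^'d) h)"
  have "(\<lambda>k. \<integral>y. ball_weight h (y - u k) *\<^sub>R jac f y \<partial>lborel) \<longlonglongrightarrow> (\<integral>y. ball_weight h (y - z) *\<^sub>R jac f y \<partial>lborel)"
  proof (rule integral_dominated_convergence[where w = "\<lambda>y. K / V * indicator (ball 0 (U + h)) y"])
    show "integrable lborel (\<lambda>y::real^'d. K / V * indicator (ball 0 (U + h)) y)"
      using emeasure_lborel_ball_less_top[of "0::real^'d" "U + h"]
      by (intro integrable_mult_right integrable_real_indicator) auto
    have "AE y in lborel. y \<notin> sphere z h"
      using negligible_sphere[of z h]
      by (intro AE_not_in) (simp add: negligible_iff_null_sets null_sets_completion_iff)
    then show "AE y in lborel. (\<lambda>k. ball_weight h (y - u k) *\<^sub>R jac f y) \<longlonglongrightarrow> ball_weight h (y - z) *\<^sub>R jac f y"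
    proof eventually_elim
      case (elim y)
      have lim: "(\<lambda>k. norm (y - u k)) \<longlonglongrightarrow> norm (y - z)" by (intro tendsto_intros u)
      have "\<forall>\<^sub>F k in sequentially. ball_weight h (y - u k) = ball_weight h (y - z)"
      proof (cases "norm (y - z) < h")
        case True
        from order_tendstoD(2)[OF lim True] show ?thesis
          by eventually_elim (use True in \<open>simp add: ball_weight_def\<close>)
      next
        case False
        then have "h < norm (y - z)" using elim by (auto simp: dist_norm norm_minus_commute)
        from order_tendstoD(1)[OF lim this] show ?thesis
          by eventually_elim (use False in \<open>simp add: ball_weight_def\<close>)
      qed
      then have "\<forall>\<^sub>F k in sequentially. ball_weight h (y - u k) *\<^sub>R jac f y = ball_weight h (y - z) *\<^sub>R jac f y"
        by eventually_elim simp
      then show ?case by (rule tendsto_eventually)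
    qed
    show "AE y in lborel. norm (ball_weight h (y - u k) *\<^sub>R jac f y) \<le> K / V * indicator (ball 0 (U + h)) y" for k
      using rademacher_local[OF ll]
    proof eventually_elim
      case (elim y)
      have "norm y < U + h" if "norm (y - u k) < h"
        using that U[of k] norm_triangle_ineq[of "y - u k" "u k"] by simp
      moreover have "norm (jac f y) \<le> K" if "norm y < U + h" using K(2)[of y] elim that by simp
      ultimately show ?case
        using K(1) by (auto simp: ball_weight_def indicator_def V_def divide_right_mono)
    qed
  qed measurable
  then show "(\<lambda>k. ball_mean h (jac f) (u k)) \<longlonglongrightarrow> ball_mean h (jac f) z"
    by (simp add: ball_mean_shift)
qed

section \<open>Convex hulls of mean Jacobians\<close>

lemma norm_matrix_vector_mul_le:
  fixes A :: "real^'d^'n"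
  shows "norm (A *v w) \<le> norm A * norm w"
proof -
  have "norm (A *v w) = L2_set (\<lambda>i. norm ((A *v w) $ i)) UNIV" by (simp add: norm_vec_def)
  also have "\<dots> \<le> L2_set (\<lambda>i. norm (A $ i) * norm w) UNIV"
    by (intro L2_set_mono) (auto simp: matrix_vector_mul_component Cauchy_Schwarz_ineq2)
  also have "\<dots> = norm A * norm w"
    by (simp add: L2_set_left_distrib[symmetric] norm_vec_def)
  finally show ?thesis .
qed

definition jac_near :: "(real^'d \<Rightarrow> real^'n) \<Rightarrow> real^'d \<Rightarrow> real \<Rightarrow> (real^'d^'n) set" where
  "jac_near f z0 r = {jac f z |z. z \<in> ball z0 r \<and> f differentiable (at z)}"

text \<open>\<open>Q\<close> will be a countable dense set of shifts, so that the hull is spanned by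
  countably many points depending measurably on a parameter. The side condition keeps the averaged
  ball inside \<open>ball z0 r\<close>.\<close>

definition mean_jac_hull :: "(real^'d) set \<Rightarrow> (real^'d \<Rightarrow> real^'n) \<Rightarrow> real^'d \<Rightarrow> real \<Rightarrow> (real^'d^'n) set" where
  "mean_jac_hull Q f z0 r = closure (convex hull
     ((\<lambda>(\<zeta>, k). ball_mean (1 / real (Suc k)) (jac f) (z0 + \<zeta>)) `
        {(\<zeta>, k). \<zeta> \<in> Q \<and> norm \<zeta> + 1 / real (Suc k) < r}))"

lemma closed_mean_jac_hull [simp]: "closed (mean_jac_hull Q f z0 r)"
  by (simp add: mean_jac_hull_def)

lemma convex_mean_jac_hull [simp]: "convex (mean_jac_hull Q f z0 r)"
  by (simp add: mean_jac_hull_def convex_closure convex_convex_hull)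

lemma mean_jac_hull_mono: "r \<le> s \<Longrightarrow> mean_jac_hull Q f z0 r \<subseteq> mean_jac_hull Q f z0 s"
  unfolding mean_jac_hull_def by (intro closure_mono hull_mono image_mono) auto

lemma ball_mean_jac_in_hull_jac_near:
  fixes f :: "real^'d \<Rightarrow> real^'n"
  assumes ll: "locally_lipschitz f" and h: "h > 0" "dist z0 z + h < r"
  shows "ball_mean h (jac f) z \<in> closure (convex hull (jac_near f z0 r))"
proof -
  have [measurable]: "f \<in> borel_measurable borel" using ll by (rule locally_lipschitz_borel_measurable)
  obtain K where K: "\<And>y. y \<in> ball z0 r \<Longrightarrow> f differentiable (at y) \<Longrightarrow> norm (jac f y) \<le> K"
    using jac_locally_bounded[OF ll] by metis
  have sub: "y \<in> ball z0 r" if "y \<in> ball z h" for y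
    using that h dist_triangle[of z0 y z] by auto
  show ?thesis
  proof (rule ball_mean_in_closed_convex[OF h(1), where B = K])
    show "AE y in lborel. y \<in> ball z h \<longrightarrow> norm (jac f y) \<le> K"
      using rademacher_local[OF ll] by eventually_elim (use K sub in blast)
    show "AE y in lborel. y \<in> ball z h \<longrightarrow> jac f y \<in> closure (convex hull (jac_near f z0 r))"
      using rademacher_local[OF ll]
    proof eventually_elim
      case (elim y)
      have "jac f y \<in> jac_near f z0 r" if "y \<in> ball z h" using elim sub[OF that] by (auto simp: jac_near_def)
      then show ?case by (intro impI subsetD[OF closure_subset] hull_inc)
    qed
  qed (auto simp: convex_closure convex_convex_hull)
qed

lemma mean_jac_hull_subset:
  fixes f :: "real^'d \<Rightarrow> real^'n"
  assumes ll: "locally_lipschitz f"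
  shows "mean_jac_hull Q f z0 r \<subseteq> closure (convex hull (jac_near f z0 r))"
  unfolding mean_jac_hull_def
proof (intro closure_minimal hull_minimal)
  show "(\<lambda>(\<zeta>, k). ball_mean (1 / real (Suc k)) (jac f) (z0 + \<zeta>)) ` {(\<zeta>, k). \<zeta> \<in> Q \<and> norm \<zeta> + 1 / real (Suc k) < r}
    \<subseteq> closure (convex hull (jac_near f z0 r))"
    by (auto intro!: ball_mean_jac_in_hull_jac_near[OF ll] simp: dist_norm)
qed (auto simp: convex_closure convex_convex_hull)

lemma norm_mean_jac_hull_le:
  fixes f :: "real^'d \<Rightarrow> real^'n"
  assumes ll: "locally_lipschitz f"
    and bd: "\<And>z. z \<in> ball z0 r \<Longrightarrow> f differentiable (at z) \<Longrightarrow> norm (jac f z) \<le> K"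
    and A: "A \<in> mean_jac_hull Q f z0 r"
  shows "norm A \<le> K"
proof -
  have "closure (convex hull (jac_near f z0 r)) \<subseteq> cball 0 K"
    by (intro closure_minimal hull_minimal) (use bd in \<open>auto simp: jac_near_def\<close>)
  then show ?thesis using A mean_jac_hull_subset[OF ll] by fastforce
qed

lemma compact_mean_jac_hull:
  fixes f :: "real^'d \<Rightarrow> real^'n"
  assumes ll: "locally_lipschitz f"
  shows "compact (mean_jac_hull Q f z0 r)"
proof -
  obtain K where K: "\<And>y. y \<in> ball z0 r \<Longrightarrow> f differentiable (at y) \<Longrightarrow> norm (jac f y) \<le> K"
    using jac_locally_bounded[OF ll] by metis
  have "bounded (mean_jac_hull Q f z0 r)"
    by (rule boundedI[where B=K]) (use norm_mean_jac_hull_le[OF ll K] in auto)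
  then show ?thesis by (simp add: compact_eq_bounded_closed)
qed

text \<open>Continuity in the centre removes the restriction to shifts in \<open>Q\<close>; the
  strict inequality survives small perturbations of the centre.\<close>

lemma ball_mean_jac_in_mean_jac_hull:
  fixes f :: "real^'d \<Rightarrow> real^'n"
  assumes ll: "locally_lipschitz f" and Q: "closure Q = UNIV"
    and k: "dist z0 z + 1 / real (Suc k) < r"
  shows "ball_mean (1 / real (Suc k)) (jac f) z \<in> mean_jac_hull Q f z0 r"
proof -
  have "z - z0 \<in> closure Q" using Q by simp
  then obtain \<zeta> where \<zeta>: "\<And>n. \<zeta> n \<in> Q" "\<zeta> \<longlonglongrightarrow> z - z0" unfolding closure_sequential by blast
  have "(\<lambda>n. z0 + \<zeta> n) \<longlonglongrightarrow> z" using tendsto_add[OF tendsto_const[of z0] \<zeta>(2)] by simp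
  then have lim: "(\<lambda>n. ball_mean (1 / real (Suc k)) (jac f) (z0 + \<zeta> n)) \<longlonglongrightarrow> ball_mean (1 / real (Suc k)) (jac f) z"
    by (rule isCont_tendsto_compose[OF isCont_ball_mean_jac[OF ll]])
  have "(\<lambda>n. norm (\<zeta> n)) \<longlonglongrightarrow> norm (z - z0)" by (intro tendsto_norm \<zeta>)
  then have "\<forall>\<^sub>F n in sequentially. norm (\<zeta> n) < r - 1 / real (Suc k)"
    by (rule order_tendstoD) (use k in \<open>simp add: dist_norm norm_minus_commute\<close>)
  then have "\<forall>\<^sub>F n in sequentially. ball_mean (1 / real (Suc k)) (jac f) (z0 + \<zeta> n) \<in> mean_jac_hull Q f z0 r"
  proof eventually_elim
    case (elim n)
    then have "ball_mean (1 / real (Suc k)) (jac f) (z0 + \<zeta> n) \<in>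
      (\<lambda>(\<zeta>, k). ball_mean (1 / real (Suc k)) (jac f) (z0 + \<zeta>)) ` {(\<zeta>, k). \<zeta> \<in> Q \<and> norm \<zeta> + 1 / real (Suc k) < r}"
      using \<zeta>(1)[of n] by (intro image_eqI[of _ _ "(\<zeta> n, k)"]) auto
    then show ?case unfolding mean_jac_hull_def by (intro subsetD[OF closure_subset] hull_inc)
  qed
  then show ?thesis by (intro Lim_in_closed_set[OF closed_mean_jac_hull _ _ lim]) auto
qed

lemma ball_mean_tendsto:
  fixes f :: "'a::euclidean_space \<Rightarrow> 'b::euclidean_space"
  assumes ll: "locally_lipschitz f"
  shows "(\<lambda>k. ball_mean (1 / real (Suc k)) f z) \<longlonglongrightarrow> f z"
proof -
  have [measurable]: "f \<in> borel_measurable borel" using ll by (rule locally_lipschitz_borel_measurable)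
  obtain L where L: "L-lipschitz_on (cball z 1) f"
    using locally_lipschitz_compact[OF ll compact_cball] by blast
  have L0: "0 \<le> L" by (rule lipschitz_on_nonneg[OF L])
  have "ball_mean (1 / real (Suc k)) f z \<in> cball (f z) (L * (1 / real (Suc k)))" for k
  proof -
    define h where "h = 1 / real (Suc k)"
    have h: "h > 0" "h \<le> 1" by (auto simp: h_def)
    have near: "dist (f z) (f y) \<le> L * h" if "y \<in> ball z h" for y
    proof -
      have "dist (f z) (f y) \<le> L * dist z y"
        using that h by (intro lipschitz_onD[OF L]) auto
      also have "\<dots> \<le> L * h" using that L0 by (intro mult_left_mono) auto
      finally show ?thesis .
    qed
    have "ball_mean h f z \<in> cball (f z) (L * h)"
    proof (rule ball_mean_in_closed_convex[OF h(1), where B = "norm (f z) + L * h"])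
      show "AE y in lborel. y \<in> ball z h \<longrightarrow> norm (f y) \<le> norm (f z) + L * h"
      proof (intro AE_I2 impI)
        fix y assume "y \<in> ball z h"
        from near[OF this] norm_triangle_ineq2[of "f y" "f z"]
        show "norm (f y) \<le> norm (f z) + L * h" by (simp add: dist_norm norm_minus_commute)
      qed
    qed (use near in auto)
    then show ?thesis by (simp add: h_def)
  qed
  then have *: "dist (ball_mean (1 / real (Suc k)) f z) (f z) \<le> L * inverse (real (Suc k))" for k
    by (simp add: dist_commute inverse_eq_divide)
  have "(\<lambda>k. L * inverse (real (Suc k))) \<longlonglongrightarrow> 0"
    using tendsto_mult_right_zero[OF LIMSEQ_inverse_real_of_nat] by simp
  then show ?thesis
  proof (rule metric_tendsto_imp_tendsto)
    have "dist (L * inverse (real (Suc k))) 0 = L * inverse (real (Suc k))" for k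
      using L0 by (simp only: dist_real_def) simp
    then show "\<forall>\<^sub>F k in sequentially. dist (ball_mean (1 / real (Suc k)) f z) (f z) \<le> dist (L * inverse (real (Suc k))) 0"
      using * by simp
  qed
qed

text \<open>Mean value theorem: apply the scalar one to \<open>\<xi> \<bullet> f\<close> after averaging, for a hyperplane
  \<open>\<xi>\<close> separating \<open>f u - f v\<close> from \<open>{B (u - v)}\<close>.\<close>

lemma mean_value_hull:
  fixes f :: "real^'d \<Rightarrow> real^'n"
  assumes ll: "locally_lipschitz f" and Q: "closure Q = UNIV"
    and uv: "u \<in> ball z0 r" "v \<in> ball z0 r"
  obtains B where "B \<in> mean_jac_hull Q f z0 r" "f u - f v = B *v (u - v)"
proof -
  define w where "w = u - v"
  define S where "S = (\<lambda>B. B *v w) ` mean_jac_hull Q f z0 r"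
  have bl: "bounded_linear (\<lambda>B::real^'d^'n. B *v w)" by (rule bounded_linear_matrix_vector_mul_left)
  have "compact S" unfolding S_def
    by (intro compact_continuous_image linear_continuous_on bl compact_mean_jac_hull ll)
  have "convex S" unfolding S_def
    by (intro convex_linear_image bounded_linear.linear[OF bl] convex_mean_jac_hull)
  have "f u - f v \<in> S"
  proof (rule ccontr)
    assume "f u - f v \<notin> S"
    then obtain \<xi> c where \<xi>: "\<xi> \<bullet> (f u - f v) < c" "\<And>s. s \<in> S \<Longrightarrow> c < \<xi> \<bullet> s"
      using separating_hyperplane_closed_point[OF \<open>convex S\<close> compact_imp_closed[OF \<open>compact S\<close>]] by metis
    \<comment> \<open>The segment from \<open>v\<close> to \<open>u\<close> stays in
      \<open>cball z0 m\<close>; since \<open>m < r\<close>, there is room for a small averaging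
      ball about each of its points.\<close>
    define m where "m = max (dist z0 u) (dist z0 v)"
    have "m < r" using uv by (auto simp: m_def)
    have "(\<lambda>k. m + inverse (real (Suc k))) \<longlonglongrightarrow> m + 0"
      by (intro tendsto_intros LIMSEQ_inverse_real_of_nat)
    then have "\<forall>\<^sub>F k in sequentially. m + inverse (real (Suc k)) < r"
      by (rule order_tendstoD) (use \<open>m < r\<close> in simp)
    then have "\<forall>\<^sub>F k in sequentially. c \<le> \<xi> \<bullet> (ball_mean (1 / real (Suc k)) f u - ball_mean (1 / real (Suc k)) f v)"
    proof eventually_elim
      case (elim k)
      define h where "h = 1 / real (Suc k)"
      define G where "G s = \<xi> \<bullet> ball_mean h f (v + s *\<^sub>R w)" for s
      have G: "(G has_real_derivative \<xi> \<bullet> (ball_mean h (jac f) (v + s *\<^sub>R w) *v w)) (at s)" for s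
        unfolding DERIV_def
      proof (subst tendsto_at_iff_sequentially, intro allI impI)
        fix t :: "nat \<Rightarrow> real" assume t: "\<forall>i. t i \<in> UNIV - {0}" "t \<longlonglongrightarrow> 0"
        have "(\<lambda>k. \<xi> \<bullet> ((ball_mean h f ((v + s *\<^sub>R w) + t k *\<^sub>R w) - ball_mean h f (v + s *\<^sub>R w)) /\<^sub>R t k))
          \<longlonglongrightarrow> \<xi> \<bullet> (ball_mean h (jac f) (v + s *\<^sub>R w) *v w)"
          by (intro tendsto_inner tendsto_const ball_mean_quotient_tendsto[OF ll]) (use t in auto)
        moreover have "\<xi> \<bullet> ((ball_mean h f ((v + s *\<^sub>R w) + t k *\<^sub>R w) - ball_mean h f (v + s *\<^sub>R w)) /\<^sub>R t k)
          = (G (s + t k) - G s) / t k" for k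
          by (simp add: G_def inner_diff_right divide_inverse mult.commute scaleR_add_left add.assoc)
        ultimately show "((\<lambda>h. (G (s + h) - G s) / h) \<circ> t) \<longlonglongrightarrow> \<xi> \<bullet> (ball_mean h (jac f) (v + s *\<^sub>R w) *v w)"
          by (simp add: comp_def)
      qed
      obtain s where s: "0 < s" "s < 1" "G 1 - G 0 = (1 - 0) * (\<xi> \<bullet> (ball_mean h (jac f) (v + s *\<^sub>R w) *v w))"
        using MVT2[of 0 1 G "\<lambda>s. \<xi> \<bullet> (ball_mean h (jac f) (v + s *\<^sub>R w) *v w)"] G by auto
      define z where "z = v + s *\<^sub>R w"
      have "z \<in> cball z0 m"
      proof -
        have "z = (1 - s) *\<^sub>R v + s *\<^sub>R u" by (simp add: z_def w_def algebra_simps)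
        then show ?thesis using s convexD[OF convex_cball[of z0 m], of v u "1 - s" s]
          by (simp add: m_def)
      qed
      then have "dist z0 z + 1 / real (Suc k) < r" using elim by (simp add: inverse_eq_divide)
      then have "ball_mean h (jac f) z *v w \<in> S"
        unfolding S_def h_def by (intro imageI ball_mean_jac_in_mean_jac_hull[OF ll Q])
      then show ?case using \<xi>(2) s(3) by (auto simp: G_def w_def z_def h_def inner_diff_right less_imp_le)
    qed
    then have "c \<le> \<xi> \<bullet> (f u - f v)"
      by (intro tendsto_lowerbound[OF tendsto_inner[OF tendsto_const tendsto_diff[OF ball_mean_tendsto[OF ll] ball_mean_tendsto[OF ll]]]]) auto
    then show False using \<xi>(1) by simp
  qed
  then show thesis using that by (auto simp: S_def w_def)
qed

text \<open>Each hull lies in the closed convex hull of the Jacobians at nearby points of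
  differentiability. If a hyperplane separated \<open>A\<close> from the Clarke Jacobian, then
  arbitrarily close to \<open>z0\<close> some Jacobian would lie on the side of \<open>A\<close>; by
  boundedness a subsequence converges, to a generator of the Clarke Jacobian on the wrong
  side.\<close>

lemma Inter_mean_jac_hull_subset_clarke:
  fixes f :: "real^'d \<Rightarrow> real^'n"
  assumes ll: "locally_lipschitz f"
  shows "(\<Inter>n. mean_jac_hull Q f z0 (1 / real (Suc n))) \<subseteq> clarke_jac f z0"
proof
  fix A assume A: "A \<in> (\<Inter>n. mean_jac_hull Q f z0 (1 / real (Suc n)))"
  define Lm where "Lm = {A. \<exists>zs. (\<forall>k. f differentiable (at (zs k))) \<and> zs \<longlonglongrightarrow> z0 \<and>
             (\<lambda>k. jacobian f (at (zs k))) \<longlonglongrightarrow> A}"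
  \<comment> \<open>This form reduces closedness of \<open>Lm\<close> to the triangle inequality,
    without a diagonal sequence. Compactness of \<open>Lm\<close> then makes its convex hull closed,
    so that separation applies.\<close>
  have Lm_iff: "B \<in> Lm \<longleftrightarrow> (\<forall>e>0. \<exists>z. f differentiable (at z) \<and> dist z z0 < e \<and> dist (jac f z) B < e)" for B
  proof
    assume "B \<in> Lm"
    then obtain zs where zs: "\<And>k. f differentiable (at (zs k))" "zs \<longlonglongrightarrow> z0" "(\<lambda>k. jacobian f (at (zs k))) \<longlonglongrightarrow> B"
      by (auto simp: Lm_def)
    show "\<forall>e>0. \<exists>z. f differentiable (at z) \<and> dist z z0 < e \<and> dist (jac f z) B < e"
    proof (intro allI impI)
      fix e :: real assume "e > 0"
      have "\<forall>\<^sub>F k in sequentially. dist (zs k) z0 < e \<and> dist (jacobian f (at (zs k))) B < e"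
        using tendstoD[OF zs(2) \<open>e > 0\<close>] tendstoD[OF zs(3) \<open>e > 0\<close>] by (rule eventually_conj)
      then obtain k where "dist (zs k) z0 < e" "dist (jacobian f (at (zs k))) B < e"
        by (metis (mono_tags, lifting) eventually_happens' sequentially_bot)
      then show "\<exists>z. f differentiable (at z) \<and> dist z z0 < e \<and> dist (jac f z) B < e"
        using zs(1)[of k] jac_eq_jacobian[of f "zs k"] by metis
    qed
  next
    assume R: "\<forall>e>0. \<exists>z. f differentiable (at z) \<and> dist z z0 < e \<and> dist (jac f z) B < e"
    have "\<exists>z. f differentiable (at z) \<and> dist z z0 < inverse (real (Suc k)) \<and> dist (jac f z) B < inverse (real (Suc k))" for k
      using R by simp
    then obtain zs where zs: "\<And>k. f differentiable (at (zs k))" "\<And>k. dist (zs k) z0 < inverse (real (Suc k))"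
      "\<And>k. dist (jac f (zs k)) B < inverse (real (Suc k))" by metis
    have "zs \<longlonglongrightarrow> z0"
      by (rule metric_tendsto_imp_tendsto[OF LIMSEQ_inverse_real_of_nat]) (use zs(2) in \<open>auto intro!: always_eventually less_imp_le\<close>)
    moreover have "(\<lambda>k. jac f (zs k)) \<longlonglongrightarrow> B"
      by (rule metric_tendsto_imp_tendsto[OF LIMSEQ_inverse_real_of_nat]) (use zs(3) in \<open>auto intro!: always_eventually less_imp_le\<close>)
    ultimately show "B \<in> Lm" using zs(1) by (auto simp: Lm_def jac_eq_jacobian)
  qed
  obtain K where K: "\<And>y. y \<in> ball z0 1 \<Longrightarrow> f differentiable (at y) \<Longrightarrow> norm (jac f y) \<le> K"
    using jac_locally_bounded[OF ll] by metis
  have "closure Lm \<subseteq> Lm"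
  proof
    fix B assume "B \<in> closure Lm"
    then have B: "\<forall>e>0. \<exists>y\<in>Lm. dist y B < e" by (simp add: closure_approachable)
    show "B \<in> Lm" unfolding Lm_iff
    proof (intro allI impI)
      fix e :: real assume "e > 0"
      then obtain B' where B': "B' \<in> Lm" "dist B' B < e / 2" using B half_gt_zero by blast
      then obtain z where "f differentiable (at z)" "dist z z0 < e / 2" "dist (jac f z) B' < e / 2"
        using \<open>e > 0\<close> half_gt_zero unfolding Lm_iff by blast
      then show "\<exists>z. f differentiable (at z) \<and> dist z z0 < e \<and> dist (jac f z) B < e"
        using B' \<open>e > 0\<close> dist_triangle_half_r[of B' "jac f z" e B] by (intro exI[of _ z]) (auto simp: dist_commute)
    qed
  qed
  then have "closed Lm" by (simp add: closure_subset_eq)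
  moreover have "bounded Lm"
  proof (rule boundedI)
    fix B assume "B \<in> Lm"
    then obtain z where z: "f differentiable (at z)" "dist z z0 < 1" "dist (jac f z) B < 1"
      unfolding Lm_iff using zero_less_one by blast
    then have "norm (jac f z) \<le> K" using K[of z] by (simp add: dist_commute)
    then show "norm B \<le> K + 1" using z(3) norm_triangle_ineq2[of B "jac f z"] by (simp add: dist_norm norm_minus_commute)
  qed
  ultimately have "compact Lm" by (simp add: compact_eq_bounded_closed)
  have "A \<in> convex hull Lm"
  proof (rule ccontr)
    assume "A \<notin> convex hull Lm"
    then obtain P c where P: "P \<bullet> A < c" "\<And>B. B \<in> convex hull Lm \<Longrightarrow> c < P \<bullet> B"
      using separating_hyperplane_closed_point[OF convex_convex_hull compact_imp_closed[OF compact_convex_hull[OF \<open>compact Lm\<close>]]]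
      by metis
    have "\<exists>z. z \<in> ball z0 (1 / real (Suc n)) \<and> f differentiable (at z) \<and> P \<bullet> jac f z < c" for n
    proof (rule ccontr)
      assume no: "\<nexists>z. z \<in> ball z0 (1 / real (Suc n)) \<and> f differentiable (at z) \<and> P \<bullet> jac f z < c"
      have "closure (convex hull (jac_near f z0 (1 / real (Suc n)))) \<subseteq> {B. P \<bullet> B \<ge> c}"
        by (intro closure_minimal hull_minimal closed_halfspace_ge convex_halfspace_ge)
          (use no in \<open>auto simp: jac_near_def not_less\<close>)
      moreover have "A \<in> closure (convex hull (jac_near f z0 (1 / real (Suc n))))"
        using A mean_jac_hull_subset[OF ll] by blast
      ultimately show False using P(1) by auto
    qed
    then obtain z where z: "\<And>n. z n \<in> ball z0 (1 / real (Suc n))" "\<And>n. f differentiable (at (z n))" "\<And>n. P \<bullet> jac f (z n) < c"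
      by metis
    have "jac f (z n) \<in> cball 0 K" for n
    proof -
      have "z n \<in> ball z0 1" using z(1)[of n] by (auto intro: less_le_trans)
      then show ?thesis using K z(2) by simp
    qed
    then obtain B r where B: "strict_mono r" "((\<lambda>n. jac f (z n)) \<circ> r) \<longlonglongrightarrow> B"
      using compact_cball[of 0 K] unfolding compact_def by metis
    have zl: "z \<longlonglongrightarrow> z0"
      by (rule metric_tendsto_imp_tendsto[OF LIMSEQ_inverse_real_of_nat])
        (use z(1) in \<open>auto intro!: always_eventually less_imp_le simp: dist_commute inverse_eq_divide\<close>)
    have "B \<in> Lm"
      unfolding Lm_def using z(2) LIMSEQ_subseq_LIMSEQ[OF zl B(1)] B(2)
      by (auto intro!: exI[of _ "z \<circ> r"] simp: comp_def jac_eq_jacobian)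
    then have "c < P \<bullet> B" by (intro P hull_inc)
    moreover have "P \<bullet> B \<le> c"
      by (rule tendsto_upperbound[OF tendsto_inner[OF tendsto_const B(2)]]) (use z(3) in \<open>auto intro!: always_eventually less_imp_le\<close>)
    ultimately show False by simp
  qed
  then show "A \<in> clarke_jac f z0" by (simp add: clarke_jac_def Lm_def)
qed

section \<open>Measurable selection\<close>

text \<open>Means of nonempty lists with repetition are the convex combinations with rational
  weights. The index lists form a countable set independent of the points, so measurability in a
  parameter is immediate.\<close>

definition list_mean :: "(nat \<Rightarrow> 'v::real_vector) \<Rightarrow> nat list \<Rightarrow> 'v" where
  "list_mean b l = (\<Sum>i\<leftarrow>l. b i) /\<^sub>R real (length l)"

definition list_means :: "(nat \<Rightarrow> 'v::real_vector) \<Rightarrow> 'v set" where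
  "list_means b = list_mean b ` {l. l \<noteq> []}"

lemma list_means_subset_convex_hull: "list_means b \<subseteq> convex hull (range b)"
proof -
  have "list_mean b l \<in> convex hull (range b)" if "l \<noteq> []" for l
  proof -
    have "list_mean b l = (\<Sum>j\<in>{0..<length l}. (1 / real (length l)) *\<^sub>R b (l ! j))"
      by (simp add: list_mean_def sum_list_sum_nth scaleR_sum_right inverse_eq_divide)
    also have "\<dots> \<in> convex hull (range b)"
      using that by (intro convex_sum convex_convex_hull hull_inc) auto
    finally show ?thesis .
  qed
  then show ?thesis by (auto simp: list_means_def)
qed

lemma list_means_rational_convex:
  assumes p: "p \<in> list_means b" and q: "q \<in> list_means b" and m: "m \<le> N" "0 < N"
  shows "(real m / real N) *\<^sub>R p + (1 - real m / real N) *\<^sub>R q \<in> list_means b"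
proof -
  obtain k l where k: "k \<noteq> []" "p = list_mean b k" and l: "l \<noteq> []" "q = list_mean b l"
    using p q by (auto simp: list_means_def)
  \<comment> \<open>The factors \<open>length l\<close> and \<open>length k\<close> compensate for
    the different lengths, so that the two means enter in the ratio \<open>m\<close> to
    \<open>N - m\<close>.\<close>
  define xs where "xs = concat (replicate (m * length l) k) @ concat (replicate ((N - m) * length k) l)"
  have rep: "sum_list (map b (concat (replicate j k))) = real j *\<^sub>R sum_list (map b k)"
    "length (concat (replicate j k)) = j * length k" for j and k :: "nat list"
    by (induction j) (simp_all add: scaleR_add_left)
  have len: "length xs = N * length k * length l"
    using m by (simp add: xs_def rep) (metis add_mult_distrib le_add_diff_inverse mult.assoc mult.commute)
  have pq: "sum_list (map b k) = real (length k) *\<^sub>R p" "sum_list (map b l) = real (length l) *\<^sub>R q"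
    using k l by (simp_all add: list_mean_def)
  have "sum_list (map b xs) = (real m * real (length k) * real (length l)) *\<^sub>R p
      + ((real N - real m) * real (length k) * real (length l)) *\<^sub>R q"
    using m by (simp add: xs_def rep pq of_nat_diff mult_ac)
  then have "list_mean b xs = ((real m * real (length k) * real (length l)) / (real N * real (length k) * real (length l))) *\<^sub>R p
      + (((real N - real m) * real (length k) * real (length l)) / (real N * real (length k) * real (length l))) *\<^sub>R q"
    by (simp add: list_mean_def len scaleR_add_right divide_inverse mult_ac)
  also have "\<dots> = (real m / real N) *\<^sub>R p + (1 - real m / real N) *\<^sub>R q"
    using k l m by (simp add: diff_divide_distrib)
  finally have eq: "list_mean b xs = (real m / real N) *\<^sub>R p + (1 - real m / real N) *\<^sub>R q" .
  have "length xs > 0" using len k l m by simp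
  then have "list_mean b xs \<in> list_means b" by (auto simp: list_means_def)
  with eq show ?thesis by simp
qed

lemma convex_closure_list_means:
  fixes b :: "nat \<Rightarrow> 'v::real_normed_vector"
  shows "convex (closure (list_means b))"
proof (rule convexI)
  fix x y and s t :: real
  assume x: "x \<in> closure (list_means b)" and y: "y \<in> closure (list_means b)"
    and st: "0 \<le> s" "0 \<le> t" "s + t = 1"
  obtain p where p: "\<And>n. p n \<in> list_means b" "p \<longlonglongrightarrow> x" using x unfolding closure_sequential by blast
  obtain q where q: "\<And>n. q n \<in> list_means b" "q \<longlonglongrightarrow> y" using y unfolding closure_sequential by blast
  \<comment> \<open>Approximates \<open>s\<close> from below by rationals
    \<open>m n / Suc n\<close>, with error at most 1/(n+1).\<close>
  define m where "m n = nat \<lfloor>s * real (Suc n)\<rfloor>" for n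
  have m: "real (m n) \<le> s * real (Suc n)" "s * real (Suc n) < real (m n) + 1" for n
    using st by (auto simp: m_def simp del: of_nat_Suc)
  have "m n \<le> Suc n" for n
  proof -
    have "s * real (Suc n) \<le> 1 * real (Suc n)" using st by (intro mult_right_mono) auto
    from order_trans[OF m(1)[of n] this] have "real (m n) \<le> real (Suc n)" by simp
    then show ?thesis by (simp only: of_nat_le_iff)
  qed
  then have in_means: "(real (m n) / real (Suc n)) *\<^sub>R p n + (1 - real (m n) / real (Suc n)) *\<^sub>R q n \<in> list_means b" for n
    using p(1) q(1) by (intro list_means_rational_convex) auto
  have "dist (real (m n) / real (Suc n)) s \<le> dist (inverse (real (Suc n))) 0" for n
  proof -
    have "real (m n) / real (Suc n) \<le> s" "s \<le> real (m n) / real (Suc n) + 1 / real (Suc n)"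
      using m[of n] by (simp_all add: pos_divide_le_eq pos_le_divide_eq add_divide_distrib[symmetric] del: of_nat_Suc)
    then show ?thesis by (simp add: dist_real_def inverse_eq_divide del: of_nat_Suc)
  qed
  then have "(\<lambda>n. real (m n) / real (Suc n)) \<longlonglongrightarrow> s"
    by (intro metric_tendsto_imp_tendsto[OF LIMSEQ_inverse_real_of_nat]) auto
  then have "(\<lambda>n. (real (m n) / real (Suc n)) *\<^sub>R p n + (1 - real (m n) / real (Suc n)) *\<^sub>R q n)
     \<longlonglongrightarrow> s *\<^sub>R x + (1 - s) *\<^sub>R y"
    by (intro tendsto_intros p q)
  then have "s *\<^sub>R x + (1 - s) *\<^sub>R y \<in> closure (list_means b)"
    by (rule Lim_in_closed_set[OF closed_closure _ sequentially_bot, rotated])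
      (intro always_eventually allI subsetD[OF closure_subset] in_means)
  moreover have "1 - s = t" using st by simp
  ultimately show "s *\<^sub>R x + t *\<^sub>R y \<in> closure (list_means b)" by simp
qed

lemma closure_list_means:
  fixes b :: "nat \<Rightarrow> 'v::real_normed_vector"
  shows "closure (list_means b) = closure (convex hull (range b))"
proof
  show "closure (list_means b) \<subseteq> closure (convex hull (range b))"
    by (intro closure_mono list_means_subset_convex_hull)
  have "b i \<in> list_means b" for i
    unfolding list_means_def by (intro image_eqI[of _ _ "[i]"]) (auto simp: list_mean_def)
  then have "range b \<subseteq> closure (list_means b)" using closure_subset by blast
  then show "closure (convex hull (range b)) \<subseteq> closure (list_means b)"
    by (intro closure_minimal hull_minimal convex_closure_list_means) auto
qed

text \<open>The index map \<open>r\<close> admits sequences that have already been thinned out, as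
  in the next proof.\<close>

lemma decseq_compact_subseq_limit:
  fixes K :: "nat \<Rightarrow> 'v::metric_space set"
  assumes comp: "\<And>n. compact (K n)" and dec: "\<And>n. K (Suc n) \<subseteq> K n"
    and c: "\<And>n. c n \<in> K (r n)" and r: "strict_mono (r :: nat \<Rightarrow> nat)"
  obtains l s where "l \<in> (\<Inter>n. K n)" "strict_mono (s :: nat \<Rightarrow> nat)" "(c \<circ> s) \<longlonglongrightarrow> l"
proof -
  have mono: "K m \<subseteq> K n" if "n \<le> m" for m n using that dec by (rule lift_Suc_antimono_le[of K, rotated])
  have "\<And>n. c n \<in> K 0" using c mono by blast
  then obtain l s where s: "strict_mono (s :: nat \<Rightarrow> nat)" "(c \<circ> s) \<longlonglongrightarrow> l"
    using comp[of 0] unfolding compact_def by metis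
  have "l \<in> K n" for n
  proof (rule Lim_in_closed_set[OF compact_imp_closed[OF comp] _ _ s(2)])
    have "(c \<circ> s) k \<in> K n" if "k \<ge> n" for k
    proof -
      have "n \<le> r (s k)" using that seq_suble[OF s(1), of k] seq_suble[OF r, of "s k"] by linarith
      then show ?thesis using c[of "s k"] mono by auto
    qed
    then show "\<forall>\<^sub>F k in sequentially. (c \<circ> s) k \<in> K n" unfolding eventually_sequentially by blast
  qed simp
  then show thesis using that s by blast
qed

text \<open>A subsequence staying away from the projection has, by compactness, a limit point
  \<open>l\<close> in the intersection. Points of the intersection compete in every
  \<open>K n\<close>, so almost minimality passes to the limit and \<open>l\<close> is a closest
  point; convexity makes it unique.\<close>

lemma approx_closest_point_tendsto:
  fixes K :: "nat \<Rightarrow> 'v::euclidean_space set"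
  assumes comp: "\<And>n. compact (K n)" and conv: "\<And>n. convex (K n)" and dec: "\<And>n. K (Suc n) \<subseteq> K n"
    and c: "\<And>n. c n \<in> K n" "\<And>n y. y \<in> K n \<Longrightarrow> dist B (c n) \<le> dist B y + inverse (real (Suc n))"
  shows "c \<longlonglongrightarrow> closest_point (\<Inter>n. K n) B"
proof (rule tendstoI, rule ccontr)
  fix e :: real assume e: "e > 0"
  define G where "G = (\<Inter>n. K n)"
  assume "\<not> (\<forall>\<^sub>F n in sequentially. dist (c n) (closest_point (\<Inter>n. K n) B) < e)"
  then have "infinite {n. \<not> dist (c n) (closest_point G B) < e}"
    by (simp add: cofinite_eq_sequentially[symmetric] eventually_cofinite G_def)
  then obtain r :: "nat \<Rightarrow> nat" where r: "strict_mono r" "\<And>n. \<not> dist (c (r n)) (closest_point G B) < e"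
    using infinite_enumerate[of "{n. \<not> dist (c n) (closest_point G B) < e}"] by blast
  obtain l s where l: "l \<in> G" "strict_mono (s :: nat \<Rightarrow> nat)" "((c \<circ> r) \<circ> s) \<longlonglongrightarrow> l"
    using decseq_compact_subseq_limit[where K = K and c = "c \<circ> r" and r = r, OF comp dec] c(1) r(1) by (auto simp: G_def)
  have rs: "strict_mono (r \<circ> s)" using r(1) l(2) by (rule strict_mono_o)
  have "closed G" unfolding G_def by (intro closed_INT ballI compact_imp_closed comp)
  moreover have "convex G" unfolding G_def by (intro convex_INT conv)
  moreover have "dist B l \<le> dist B y" if "y \<in> G" for y
  proof (rule tendsto_le[OF sequentially_bot])
    show "(\<lambda>k. dist B (((c \<circ> r) \<circ> s) k)) \<longlonglongrightarrow> dist B l" by (intro tendsto_intros l)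
    have "(\<lambda>k. dist B y + ((\<lambda>n. inverse (real (Suc n))) \<circ> (r \<circ> s)) k) \<longlonglongrightarrow> dist B y + 0"
      by (intro tendsto_intros LIMSEQ_subseq_LIMSEQ[OF LIMSEQ_inverse_real_of_nat rs])
    then show "(\<lambda>k. dist B y + inverse (real (Suc (r (s k))))) \<longlonglongrightarrow> dist B y" by (simp add: comp_def)
    show "\<forall>\<^sub>F k in sequentially. dist B (((c \<circ> r) \<circ> s) k) \<le> dist B y + inverse (real (Suc (r (s k))))"
      using that c(2)[of y] by (intro always_eventually) (auto simp: G_def)
  qed
  ultimately have "l = closest_point G B" using l(1) by (intro closest_point_unique) auto
  with l(3) have "(\<lambda>k. c (r (s k))) \<longlonglongrightarrow> closest_point G B" by (simp add: comp_def)
  from tendstoD[OF this e] have "\<forall>\<^sub>F k in sequentially. False"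
    by eventually_elim (use r(2) in simp)
  then show False by simp
qed

text \<open>Points of \<open>K n\<close> staying \<open>e\<close> away from the intersection would
  accumulate at one of its points. This later replaces a mean value matrix by an element of the
  intersection.\<close>

lemma eventually_near_Inter:
  fixes K :: "nat \<Rightarrow> 'v::metric_space set"
  assumes comp: "\<And>n. compact (K n)" and dec: "\<And>n. K (Suc n) \<subseteq> K n" and e: "e > 0"
  shows "\<exists>n. \<forall>B\<in>K n. \<exists>B'\<in>(\<Inter>n. K n). dist B B' < e"
proof (rule ccontr)
  assume "\<not> ?thesis"
  then obtain c where c: "\<And>n. c n \<in> K n" "\<And>n B'. B' \<in> (\<Inter>n. K n) \<Longrightarrow> \<not> dist (c n) B' < e" by metis
  obtain l s where l: "l \<in> (\<Inter>n. K n)" "strict_mono (s :: nat \<Rightarrow> nat)" "(c \<circ> s) \<longlonglongrightarrow> l"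
    using decseq_compact_subseq_limit[where K = K and c = c and r = id, OF comp dec] c(1) by (auto simp: strict_mono_id)
  from tendstoD[OF l(3) e] have "\<forall>\<^sub>F k in sequentially. False"
    by eventually_elim (use c(2)[OF l(1)] in simp)
  then show False by simp
qed

lemma ex_almost_minimal:
  fixes F :: "nat \<Rightarrow> real"
  assumes "\<And>i. 0 \<le> F i" "e > 0"
  shows "\<exists>i. \<forall>j. F i \<le> F j + e"
proof -
  have bdd: "bdd_below (range F)" using assms(1) by (intro bdd_belowI[of _ 0]) auto
  have "Inf (range F) < Inf (range F) + e" using assms(2) by simp
  from iffD1[OF cInf_less_iff[OF _ bdd] this] obtain i where "F i < Inf (range F) + e" by blast
  moreover have "Inf (range F) \<le> F j" for j using cInf_lower[OF _ bdd] by auto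
  ultimately show ?thesis by (meson add_right_mono less_eq_real_def order_trans)
qed

text \<open>Measurable selection by approximation: the first almost closest list mean converges, by
  convexity, to the metric projection onto the intersection.\<close>

lemma measurable_closest_point_Inter:
  fixes b :: "nat \<Rightarrow> nat \<Rightarrow> 'a \<Rightarrow> 'v::euclidean_space"
  assumes meas: "\<And>n i. b n i \<in> borel_measurable M"
    and K: "\<And>n x. x \<in> space M \<Longrightarrow> K n x = closure (convex hull (range (\<lambda>i. b n i x)))"
    and comp: "\<And>n x. x \<in> space M \<Longrightarrow> compact (K n x)"
    and dec: "\<And>n x. x \<in> space M \<Longrightarrow> K (Suc n) x \<subseteq> K n x"
  shows "(\<lambda>x. closest_point (\<Inter>n. K n x) B) \<in> borel_measurable M"
proof -
  \<comment> \<open>Every index decodes to a head and a tail, so \<open>L\<close> enumerates exactly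
    the nonempty lists.\<close>
  define L where "L j = (let p = from_nat j :: nat \<times> nat list in fst p # snd p)" for j
  have rangeL: "range L = {l. l \<noteq> []}"
  proof -
    have "l \<in> range L" if "l \<noteq> []" for l
      using that by (intro image_eqI[of _ _ "to_nat (hd l, tl l)"]) (auto simp: L_def)
    then show ?thesis by (auto simp: L_def Let_def)
  qed
  define g where "g n j x = list_mean (\<lambda>i. b n i x) (L j)" for n j x
  have [measurable]: "g n j \<in> borel_measurable M" for n j
  proof -
    have "(\<lambda>x. \<Sum>i\<leftarrow>l. b n i x) \<in> borel_measurable M" for l
      by (induction l) (use meas in simp_all)
    then show ?thesis unfolding g_def[abs_def] list_mean_def by measurable
  qed
  have range_g: "closure (range (\<lambda>j. g n j x)) = K n x" if "x \<in> space M" for n x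
  proof -
    have "range (\<lambda>j. g n j x) = list_means (\<lambda>i. b n i x)"
      unfolding g_def list_means_def rangeL[symmetric] by auto
    then show ?thesis using K[OF that] by (simp add: closure_list_means)
  qed
  \<comment> \<open>The first almost minimal index is measurable because countably many measurable
    comparisons determine it. The margin 1/(n+1) guarantees that one exists although the infimum
    need not be attained.\<close>
  define N where "N n x = (LEAST j. \<forall>i. dist B (g n j x) \<le> dist B (g n i x) + inverse (real (Suc n)))" for n x
  have [measurable]: "N n \<in> measurable M (count_space UNIV)" for n
    unfolding N_def[abs_def] by measurable
  define c where "c n x = g n (N n x) x" for n x
  have cm: "c n \<in> borel_measurable M" for n
    unfolding c_def[abs_def] by (rule measurable_compose_countable) measurable
  have "(\<lambda>n. c n x) \<longlonglongrightarrow> closest_point (\<Inter>n. K n x) B" if x: "x \<in> space M" for x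
  proof (rule approx_closest_point_tendsto)
    show "convex (K n x)" for n using K[OF x] by (simp add: convex_closure convex_convex_hull)
    show "c n x \<in> K n x" for n
      unfolding range_g[OF x, symmetric] c_def by (rule subsetD[OF closure_subset]) (rule rangeI)
    have min: "dist B (c n x) \<le> dist B (g n i x) + inverse (real (Suc n))" for n i
    proof -
      have "\<exists>j. \<forall>i. dist B (g n j x) \<le> dist B (g n i x) + inverse (real (Suc n))"
        by (rule ex_almost_minimal) auto
      from LeastI_ex[OF this] show ?thesis by (simp add: c_def N_def)
    qed
    show "dist B (c n x) \<le> dist B y + inverse (real (Suc n))" if "y \<in> K n x" for n y
    proof -
      have "closure (range (\<lambda>j. g n j x)) \<subseteq> {y. dist B (c n x) \<le> dist B y + inverse (real (Suc n))}"
        by (intro closure_minimal closed_Collect_le continuous_intros) (use min in auto)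
      then show ?thesis using that range_g[OF x] by auto
    qed
  qed (use comp dec x in auto)
  then show ?thesis using cm by (rule borel_measurable_LIMSEQ_metric[rotated])
qed

text \<open>The projections \<open>c i\<close> of a countable dense set form a Castaing
  representation: measurable selections whose values are dense in the intersection, since projection
  is 1-Lipschitz and fixes the points of the intersection. By continuity of \<open>F x\<close> it
  suffices to compete with these selections.\<close>

lemma measurable_almost_minimizer:
  fixes b :: "nat \<Rightarrow> nat \<Rightarrow> 'a \<Rightarrow> 'v::euclidean_space" and F :: "'a \<Rightarrow> 'v \<Rightarrow> real"
  assumes meas: "\<And>n i. b n i \<in> borel_measurable M"
    and K: "\<And>n x. x \<in> space M \<Longrightarrow> K n x = closure (convex hull (range (\<lambda>i. b n i x)))"
    and comp: "\<And>n x. x \<in> space M \<Longrightarrow> compact (K n x)"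
    and dec: "\<And>n x. x \<in> space M \<Longrightarrow> K (Suc n) x \<subseteq> K n x"
    and F_meas: "\<And>c. c \<in> borel_measurable M \<Longrightarrow> (\<lambda>x. F x (c x)) \<in> borel_measurable M"
    and F_cont: "\<And>x. x \<in> space M \<Longrightarrow> continuous_on UNIV (F x)" and F_nonneg: "\<And>x A. 0 \<le> F x A"
    and e: "e > 0"
  obtains A where "A \<in> borel_measurable M" "\<And>x. x \<in> space M \<Longrightarrow> A x \<in> (\<Inter>n. K n x)"
    "\<And>x B. x \<in> space M \<Longrightarrow> B \<in> (\<Inter>n. K n x) \<Longrightarrow> F x (A x) \<le> F x B + e"
proof -
  define G where "G x = (\<Inter>n. K n x)" for x
  obtain D :: "'v set" where D: "countable D" "\<And>X. open X \<Longrightarrow> X \<noteq> {} \<Longrightarrow> \<exists>d\<in>D. d \<in> X"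
    by (metis countable_dense_setE)
  have "D \<noteq> {}" using D(2)[of UNIV] by auto
  define c where "c i x = closest_point (G x) (from_nat_into D i)" for i x
  have [measurable]: "c i \<in> borel_measurable M" for i
    unfolding c_def[abs_def] G_def by (rule measurable_closest_point_Inter[where b = b and K = K, OF meas K comp dec])
  have [measurable]: "(\<lambda>x. F x (c i x)) \<in> borel_measurable M" for i by (rule F_meas) measurable
  define N where "N x = (LEAST i. \<forall>j. F x (c i x) \<le> F x (c j x) + e)" for x
  have [measurable]: "N \<in> measurable M (count_space UNIV)" unfolding N_def[abs_def] by measurable
  define A where "A x = c (N x) x" for x
  have Gp: "closed (G x)" "convex (G x)" "G x \<noteq> {}" if x: "x \<in> space M" for x
  proof -
    show "closed (G x)" unfolding G_def using comp[OF x] by (intro closed_INT) (auto intro: compact_imp_closed)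
    show "convex (G x)" unfolding G_def using K[OF x] by (intro convex_INT) (simp add: convex_closure convex_convex_hull)
    have "K n x \<noteq> {}" for n using K[OF x, of n] by simp
    then have k: "(SOME a. a \<in> K n x) \<in> K n x" for n by (simp add: some_in_eq)
    obtain l s where "l \<in> G x"
      using decseq_compact_subseq_limit[where K = "\<lambda>n. K n x" and c = "\<lambda>n. SOME a. a \<in> K n x" and r = id, OF comp[OF x] dec[OF x]] k
      unfolding G_def by (metis id_apply strict_mono_id)
    then show "G x \<noteq> {}" by blast
  qed
  show thesis
  proof
    show "A \<in> borel_measurable M"
      unfolding A_def[abs_def] by (rule measurable_compose_countable) measurable
    show "A x \<in> (\<Inter>n. K n x)" if "x \<in> space M" for x
      unfolding A_def c_def G_def[symmetric] using Gp[OF that] by (intro closest_point_in_set)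
    fix x B assume x: "x \<in> space M" and B: "B \<in> (\<Inter>n. K n x)"
    have "\<exists>i. \<forall>j. F x (c i x) \<le> F x (c j x) + e"
      using F_nonneg e by (intro ex_almost_minimal) auto
    from LeastI_ex[OF this] have min: "F x (A x) \<le> F x (c j x) + e" for j
      by (simp add: A_def N_def)
    show "F x (A x) \<le> F x B + e"
    proof (rule field_le_epsilon)
      fix \<eta> :: real assume "\<eta> > 0"
      have "isCont (F x) B" using F_cont[OF x] by (simp add: continuous_on_eq_continuous_at)
      then obtain d where d: "d > 0" "\<And>B'. dist B' B < d \<Longrightarrow> dist (F x B') (F x B) < \<eta>"
        using \<open>\<eta> > 0\<close> unfolding continuous_at_eps_delta by metis
      obtain q where q: "q \<in> D" "q \<in> ball B d" using D(2)[of "ball B d"] d(1) by auto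
      then obtain j where j: "q = from_nat_into D j" using D(1) from_nat_into_surj by metis
      have "closest_point (G x) B = B" using B by (intro closest_point_self) (simp add: G_def)
      then have "dist (c j x) B \<le> dist q B"
        using closest_point_lipschitz[OF Gp(2,1,3)[OF x], of q B] by (simp add: c_def j)
      then have "dist (F x (c j x)) (F x B) < \<eta>" using q by (intro d) (auto simp: dist_commute)
      then show "F x (A x) \<le> F x B + e + \<eta>" using min[of j] by (simp add: dist_real_def abs_if split: if_splits)
    qed
  qed
qed

section \<open>The Nemytskii operator\<close>

lemma borel_measurable_ball_mean_param:
  fixes H :: "'a \<Rightarrow> real^'d \<Rightarrow> real^'n"
  assumes H: "(\<lambda>(x, z). H x z) \<in> borel_measurable (M \<Otimes>\<^sub>M borel)" and g[measurable]: "g \<in> borel_measurable M"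
  shows "(\<lambda>x. ball_mean h (H x) (g x)) \<in> borel_measurable M"
proof -
  have "(\<lambda>(x, y). (x, g x + y)) \<in> measurable (M \<Otimes>\<^sub>M lborel) (M \<Otimes>\<^sub>M borel)" by measurable
  from measurable_compose[OF this H]
  have [measurable]: "(\<lambda>(x, y). H x (g x + y)) \<in> borel_measurable (M \<Otimes>\<^sub>M lborel)"
    by (simp add: case_prod_unfold)
  show ?thesis unfolding ball_mean_def
    by (rule lborel.borel_measurable_lebesgue_integral) measurable
qed

text \<open>Joint measurability of the Jacobian in (x, z) is bypassed: averages of
  \<open>H x\<close> are measurable in \<open>x\<close>, and each column of the mean Jacobian is a
  limit of their difference quotients.\<close>

lemma borel_measurable_ball_mean_jac_param:
  fixes H :: "'a \<Rightarrow> real^'d \<Rightarrow> real^'n"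
  assumes H: "(\<lambda>(x, z). H x z) \<in> borel_measurable (M \<Otimes>\<^sub>M borel)" and g[measurable]: "g \<in> borel_measurable M"
    and ll: "\<And>x. x \<in> space M \<Longrightarrow> locally_lipschitz (H x)"
  shows "(\<lambda>x. ball_mean h (jac (H x)) (g x)) \<in> borel_measurable M"
proof (rule borel_measurable_euclidean_space[THEN iffD2, rule_format])
  fix B :: "real^'d^'n" assume "B \<in> Basis"
  then obtain i j where B: "B = axis i (axis j 1)" by (auto simp: Basis_vec_def)
  have "(\<lambda>x. ball_mean h (jac (H x)) (g x) *v axis j 1) \<in> borel_measurable M"
  proof (rule borel_measurable_LIMSEQ_metric)
    show "(\<lambda>x. diffquot (ball_mean h (H x)) (axis j 1) k (g x)) \<in> borel_measurable M" for k
      unfolding diffquot_def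
      by (intro borel_measurable_scaleR borel_measurable_const borel_measurable_diff
          borel_measurable_ball_mean_param[OF H]) measurable
    show "(\<lambda>k. diffquot (ball_mean h (H x)) (axis j 1) k (g x)) \<longlonglongrightarrow> ball_mean h (jac (H x)) (g x) *v axis j 1"
      if "x \<in> space M" for x
    proof -
      have "(\<lambda>k. 1 / real (Suc k)) \<longlonglongrightarrow> 0"
        using LIMSEQ_inverse_real_of_nat by (simp add: inverse_eq_divide)
      from ball_mean_quotient_tendsto[OF ll[OF that] this] show ?thesis
        by (simp add: diffquot_def)
    qed
  qed
  moreover have "X \<bullet> B = (X *v axis j 1) \<bullet> axis i 1" for X :: "real^'d^'n"
    by (simp add: B inner_axis matrix_vector_mult_basis column_def)
  ultimately show "(\<lambda>x. ball_mean h (jac (H x)) (g x) \<bullet> B) \<in> borel_measurable M" by simp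
qed

lemma borel_measurable_matrix_vector_mul:
  fixes A :: "'a \<Rightarrow> real^'d^'n"
  assumes [measurable]: "A \<in> borel_measurable M" "w \<in> borel_measurable M"
  shows "(\<lambda>x. A x *v w x) \<in> borel_measurable M"
proof (rule borel_measurable_euclidean_space[THEN iffD2, rule_format])
  fix i :: "real^'n" assume "i \<in> Basis"
  then obtain k where i: "i = axis k 1" by (auto simp: Basis_vec_def)
  have "(A x *v w x) \<bullet> i = A x $ k \<bullet> w x" for x
    by (simp add: i inner_axis matrix_vector_mul_component)
  moreover have "(\<lambda>x. A x $ k) \<in> borel_measurable M"
    by (rule borel_measurable_continuous_on[where f = "\<lambda>A. A $ k"]) (auto intro!: continuous_intros)
  ultimately show "(\<lambda>x. (A x *v w x) \<bullet> i) \<in> borel_measurable M" by simp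
qed

lemma measurable_clarke_selection:
  fixes H :: "'a \<Rightarrow> real^'d \<Rightarrow> real^'n"
  assumes H: "(\<lambda>(x, z). H x z) \<in> borel_measurable (M \<Otimes>\<^sub>M borel)"
    and ll: "\<And>x. x \<in> space M \<Longrightarrow> locally_lipschitz (H x)"
    and m[measurable]: "ub \<in> borel_measurable M" "w \<in> borel_measurable M" "y \<in> borel_measurable M"
    and Q: "countable Q" "closure Q = UNIV" and e: "e > 0"
  obtains A where "A \<in> borel_measurable M"
    "\<And>x. x \<in> space M \<Longrightarrow> A x \<in> (\<Inter>n. mean_jac_hull Q (H x) (ub x) (1 / real (Suc n)))"
    "\<And>x B. x \<in> space M \<Longrightarrow> B \<in> (\<Inter>n. mean_jac_hull Q (H x) (ub x) (1 / real (Suc n))) \<Longrightarrow>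
       norm (y x - A x *v w x) / norm (w x) \<le> norm (y x - B *v w x) / norm (w x) + e"
proof -
  define I where "I n = {(\<zeta>, k). \<zeta> \<in> Q \<and> norm \<zeta> + 1 / real (Suc k) < 1 / real (Suc n)}" for n
  have "countable (Q \<times> (UNIV :: nat set))" using Q(1) by auto
  then have Ic: "countable (I n)" for n
    by (rule countable_subset[rotated]) (auto simp: I_def)
  \<comment> \<open>\<open>from_nat_into\<close> enumerates \<open>I n\<close> only if it is
    nonempty. A shift in \<open>Q\<close> and an averaging radius, each below half of 1/(n+1),
    provide an element.\<close>
  have Ine: "I n \<noteq> {}" for n
  proof -
    define r where "r = 1 / real (Suc n)"
    have "r > 0" by (simp add: r_def)
    have "(0::real^'d) \<in> closure Q" using Q(2) by simp
    then obtain \<zeta> where \<zeta>: "\<zeta> \<in> Q" "dist \<zeta> 0 < r / 2"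
      unfolding closure_approachable using \<open>r > 0\<close> half_gt_zero by blast
    obtain k where "inverse (real (Suc k)) < r / 2" using reals_Archimedean \<open>r > 0\<close> half_gt_zero by blast
    then have "norm \<zeta> + 1 / real (Suc k) < r"
      unfolding inverse_eq_divide using \<zeta>(2) by (simp only: dist_0_norm dist_commute)
    then have "(\<zeta>, k) \<in> I n" using \<zeta>(1) by (simp add: I_def r_def)
    then show ?thesis by blast
  qed
  define b where "b n i x = (case from_nat_into (I n) i of (\<zeta>, k) \<Rightarrow> ball_mean (1 / real (Suc k)) (jac (H x)) (ub x + \<zeta>))" for n i x
  have K: "mean_jac_hull Q (H x) (ub x) (1 / real (Suc n)) = closure (convex hull (range (\<lambda>i. b n i x)))" for n x
  proof -
    have "range (\<lambda>i. b n i x) = (\<lambda>(\<zeta>, k). ball_mean (1 / real (Suc k)) (jac (H x)) (ub x + \<zeta>)) ` range (from_nat_into (I n))"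
      by (simp add: b_def image_image)
    from this[unfolded range_from_nat_into[OF Ine Ic]] show ?thesis
      by (simp add: mean_jac_hull_def I_def)
  qed
  show thesis
  proof (rule measurable_almost_minimizer[where b = b and K = "\<lambda>n x. mean_jac_hull Q (H x) (ub x) (1 / real (Suc n))"
        and F = "\<lambda>x A. norm (y x - A *v w x) / norm (w x)" and M = M and e = e])
    show "b n i \<in> borel_measurable M" for n i
      unfolding b_def[abs_def] case_prod_unfold
      by (rule borel_measurable_ball_mean_jac_param[OF H _ ll]) measurable
    show "compact (mean_jac_hull Q (H x) (ub x) (1 / real (Suc n)))" if "x \<in> space M" for n x
      using ll[OF that] by (rule compact_mean_jac_hull)
    show "mean_jac_hull Q (H x) (ub x) (1 / real (Suc (Suc n))) \<subseteq> mean_jac_hull Q (H x) (ub x) (1 / real (Suc n))" for n x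
      by (intro mean_jac_hull_mono) (simp add: frac_le)
    show "(\<lambda>x. norm (y x - A x *v w x) / norm (w x)) \<in> borel_measurable M" if [measurable]: "A \<in> borel_measurable M" for A
      using borel_measurable_matrix_vector_mul[OF that m(2)] by measurable
    \<comment> \<open>For fixed \<open>x\<close> the denominator is constant in \<open>A\<close>;
      where \<open>w x = 0\<close> the quotient is 0 by the convention for division.\<close>
    show "continuous_on UNIV (\<lambda>A. norm (y x - A *v w x) / norm (w x))" for x
    proof -
      have "continuous_on UNIV (\<lambda>A. A *v w x)"
        by (intro linear_continuous_on bounded_linear_matrix_vector_mul_left)
      then show ?thesis unfolding divide_inverse by (intro continuous_intros)
    qed
  qed (use K e that in auto)
qed

text \<open>The source of the domination: \<open>f u - f v\<close> is \<open>B *v (u - v)\<close>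
  with \<open>B\<close> in the hull of radius \<open>r\<close>, and \<open>r \<ge> 1\<close> puts
  \<open>A\<close>, which lies in the hull of radius 1, into the same hull. All its matrices have
  norm at most \<open>K\<close>.\<close>

lemma clarke_residual_bound:
  fixes f :: "real^'d \<Rightarrow> real^'n"
  assumes ll: "locally_lipschitz f" and Q: "closure Q = UNIV"
    and bd: "\<And>z. z \<in> ball z0 r \<Longrightarrow> f differentiable (at z) \<Longrightarrow> norm (jac f z) \<le> K"
    and uv: "u \<in> ball z0 r" "v \<in> ball z0 r" and r: "r \<ge> 1"
    and A: "A \<in> (\<Inter>n. mean_jac_hull Q f z0 (1 / real (Suc n)))"
  shows "norm (f u - f v - A *v (u - v)) / norm (u - v) \<le> 2 * K"
proof (cases "u = v")
  case True
  have "K \<ge> 0"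
    using mean_value_hull[OF ll Q uv] norm_mean_jac_hull_le[OF ll bd] norm_ge_zero order_trans by metis
  then show ?thesis using True by simp
next
  case False
  obtain B where B: "B \<in> mean_jac_hull Q f z0 r" "f u - f v = B *v (u - v)"
    using mean_value_hull[OF ll Q uv] by blast
  have "A \<in> mean_jac_hull Q f z0 (1 / real (Suc 0))" using A by blast
  then have "A \<in> mean_jac_hull Q f z0 r" using mean_jac_hull_mono[of 1 r] r by auto
  then have "norm (B - A) \<le> 2 * K"
    using norm_mean_jac_hull_le[where A = B and Q = Q, OF ll bd]
      norm_mean_jac_hull_le[where A = A and Q = Q, OF ll bd] B(1) norm_triangle_ineq4[of B A] by fastforce
  then have "norm (B - A) * norm (u - v) \<le> 2 * K * norm (u - v)" by (intro mult_right_mono) auto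
  from order_trans[OF norm_matrix_vector_mul_le this]
  have "norm ((B - A) *v (u - v)) / norm (u - v) \<le> 2 * K" using False by (simp add: pos_divide_le_eq)
  moreover have "f u - f v - A *v (u - v) = (B - A) *v (u - v)"
    by (simp add: B(2) matrix_vector_mult_diff_rdistrib)
  ultimately show ?thesis by simp
qed

text \<open>For large \<open>k\<close> the mean value matrix \<open>B\<close> lies in a hull so
  small that some \<open>B'\<close> in the intersection is within \<open>e / 2\<close> of it. The
  residual quotient of \<open>B'\<close> is at most \<open>norm (B - B')\<close>, and that of
  \<open>A k\<close> exceeds it by at most 1/(k+1).\<close>

lemma clarke_residual_tendsto_0:
  fixes f :: "real^'d \<Rightarrow> real^'n" and u v :: "nat \<Rightarrow> real^'d"
  assumes ll: "locally_lipschitz f" and Q: "closure Q = UNIV"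
    and uv: "u \<longlonglongrightarrow> z0" "v \<longlonglongrightarrow> z0"
    and A: "\<And>k B. B \<in> (\<Inter>n. mean_jac_hull Q f z0 (1 / real (Suc n))) \<Longrightarrow>
       norm (f (u k) - f (v k) - A k *v (u k - v k)) / norm (u k - v k)
         \<le> norm (f (u k) - f (v k) - B *v (u k - v k)) / norm (u k - v k) + inverse (real (Suc k))"
  shows "(\<lambda>k. norm (f (u k) - f (v k) - A k *v (u k - v k)) / norm (u k - v k)) \<longlonglongrightarrow> 0"
proof (rule tendstoI)
  fix e :: real assume e: "e > 0"
  have "\<exists>n. \<forall>B\<in>mean_jac_hull Q f z0 (1 / real (Suc n)).
    \<exists>B'\<in>(\<Inter>n. mean_jac_hull Q f z0 (1 / real (Suc n))). dist B B' < e / 2"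
  proof (rule eventually_near_Inter)
    show "mean_jac_hull Q f z0 (1 / real (Suc (Suc n))) \<subseteq> mean_jac_hull Q f z0 (1 / real (Suc n))" for n
      by (intro mean_jac_hull_mono) (simp add: frac_le)
  qed (use e compact_mean_jac_hull[OF ll] in auto)
  then obtain n where n: "\<And>B. B \<in> mean_jac_hull Q f z0 (1 / real (Suc n)) \<Longrightarrow>
    \<exists>B'\<in>(\<Inter>n. mean_jac_hull Q f z0 (1 / real (Suc n))). dist B B' < e / 2" by blast
  have r: "1 / real (Suc n) > 0" by simp
  have "\<forall>\<^sub>F k in sequentially. inverse (real (Suc k)) < e / 2"
    using LIMSEQ_inverse_real_of_nat by (rule order_tendstoD) (use e in simp)
  with tendstoD[OF uv(1) r] tendstoD[OF uv(2) r]
  show "\<forall>\<^sub>F k in sequentially. dist (norm (f (u k) - f (v k) - A k *v (u k - v k)) / norm (u k - v k)) 0 < e"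
  proof eventually_elim
    case (elim k)
    show ?case
    proof (cases "u k = v k")
      case False
      have "u k \<in> ball z0 (1 / real (Suc n))" "v k \<in> ball z0 (1 / real (Suc n))"
        using elim by (simp_all add: dist_commute)
      then obtain B where B: "B \<in> mean_jac_hull Q f z0 (1 / real (Suc n))" "f (u k) - f (v k) = B *v (u k - v k)"
        using mean_value_hull[OF ll Q] by blast
      from n[OF B(1)] obtain B' where B': "B' \<in> (\<Inter>n. mean_jac_hull Q f z0 (1 / real (Suc n)))" "dist B B' < e / 2"
        by blast
      have "f (u k) - f (v k) - B' *v (u k - v k) = (B - B') *v (u k - v k)"
        by (simp add: B(2) matrix_vector_mult_diff_rdistrib)
      then have "norm (f (u k) - f (v k) - B' *v (u k - v k)) / norm (u k - v k) \<le> norm (B - B')"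
        using False norm_matrix_vector_mul_le[of "B - B'" "u k - v k"] by (simp add: pos_divide_le_eq)
      with A[OF B'(1), of k] B'(2) elim(1)
      have "norm (f (u k) - f (v k) - A k *v (u k - v k)) / norm (u k - v k) < e"
        unfolding dist_norm[of B B'] using elim by linarith
      then show ?thesis by simp
    qed (use e in simp)
  qed
qed

section \<open>Estimates in L^p\<close>

lemma powr_add_le:
  fixes a b p :: real
  assumes "0 \<le> a" "0 \<le> b" "0 \<le> p"
  shows "(a + b) powr p \<le> 2 powr p * (a powr p + b powr p)"
proof -
  have "(a + b) powr p \<le> (2 * max a b) powr p" using assms by (intro powr_mono2) auto
  also have "\<dots> = 2 powr p * max a b powr p" using assms by (simp add: powr_mult)
  also have "max a b powr p \<le> a powr p + b powr p" by (auto simp: max_def)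
  finally show ?thesis by simp
qed

lemma integrable_powr_diff:
  fixes u v :: "'a \<Rightarrow> 'b::euclidean_space"
  assumes u: "Lp_mem M p u" and v: "Lp_mem M p v" and p: "0 \<le> p"
  shows "integrable M (\<lambda>x. norm (u x - v x) powr p)"
proof (rule Bochner_Integration.integrable_bound)
  show "integrable M (\<lambda>x. 2 powr p * (norm (u x) powr p + norm (v x) powr p))"
    using u v by (auto simp: Lp_mem_def)
  have [measurable]: "u \<in> borel_measurable M" "v \<in> borel_measurable M" using u v by (auto simp: Lp_mem_def)
  show "(\<lambda>x. norm (u x - v x) powr p) \<in> borel_measurable M" by measurable
  show "AE x in M. norm (norm (u x - v x) powr p) \<le> norm (2 powr p * (norm (u x) powr p + norm (v x) powr p))"
  proof (intro AE_I2)
    fix x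
    have "norm (u x - v x) powr p \<le> (norm (u x) + norm (v x)) powr p"
      using p by (intro powr_mono2 norm_triangle_ineq4) auto
    also have "\<dots> \<le> 2 powr p * (norm (u x) powr p + norm (v x) powr p)"
      using p by (intro powr_add_le) auto
    finally show "norm (norm (u x - v x) powr p) \<le> norm (2 powr p * (norm (u x) powr p + norm (v x) powr p))"
      by simp
  qed
qed

lemma AE_summable_if_summable_integrals:
  fixes f :: "nat \<Rightarrow> 'a \<Rightarrow> real"
  assumes int: "\<And>k. integrable M (f k)" and nonneg: "\<And>k x. 0 \<le> f k x"
    and sum: "summable (\<lambda>k. \<integral>x. f k x \<partial>M)"
  shows "AE x in M. summable (\<lambda>k. f k x)" "integrable M (\<lambda>x. \<Sum>k. f k x)"
proof -
  have [measurable]: "f k \<in> borel_measurable M" for k using int[of k] by auto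
  have "(\<integral>\<^sup>+x. (\<Sum>k. ennreal (f k x)) \<partial>M) = (\<Sum>k. \<integral>\<^sup>+x. ennreal (f k x) \<partial>M)"
    by (rule nn_integral_suminf) measurable
  also have "\<dots> = (\<Sum>k. ennreal (\<integral>x. f k x \<partial>M))"
    using int nonneg by (simp add: nn_integral_eq_integral)
  also have "\<dots> \<noteq> \<infinity>"
    using sum nonneg by (simp add: suminf_ennreal2 integral_nonneg_AE)
  finally have "AE x in M. (\<Sum>k. ennreal (f k x)) \<noteq> \<infinity>"
    by (intro nn_integral_PInf_AE) auto
  then show *: "AE x in M. summable (\<lambda>k. f k x)"
    by eventually_elim (use nonneg in \<open>auto intro: summable_suminf_not_top\<close>)
  show "integrable M (\<lambda>x. \<Sum>k. f k x)"
    by (rule integrable_suminf[OF int]) (use * sum nonneg in auto)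
qed

text \<open>Replaces Hoelder's inequality: one of the two terms on the right already dominates.\<close>

lemma powr_mult_le_powr_add_powr:
  fixes r w p q \<tau> :: real
  assumes "0 \<le> r" "0 \<le> w" "0 < q" "q < p" "0 < \<tau>"
  shows "(r * w) powr q \<le> \<tau> * w powr p + \<tau> powr (- q / (p - q)) * r powr (p * q / (p - q))"
proof (cases "r powr q \<le> \<tau> * w powr (p - q)")
  case True
  have "(r * w) powr q = r powr q * w powr q" using assms by (simp add: powr_mult)
  also have "\<dots> \<le> \<tau> * w powr (p - q) * w powr q" using True by (intro mult_right_mono) auto
  also have "\<dots> = \<tau> * w powr p" by (simp add: powr_add[symmetric])
  finally show ?thesis by (simp add: add_increasing2)
next
  case False
  then have "w powr (p - q) \<le> r powr q / \<tau>" using assms by (simp add: pos_le_divide_eq mult.commute)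
  then have "(w powr (p - q)) powr (q / (p - q)) \<le> (r powr q / \<tau>) powr (q / (p - q))"
    using assms by (intro powr_mono2) auto
  also have "(w powr (p - q)) powr (q / (p - q)) = w powr q" using assms by (simp add: powr_powr)
  also have "(r powr q / \<tau>) powr (q / (p - q)) = r powr (q * q / (p - q)) * \<tau> powr (- q / (p - q))"
    using assms by (simp add: powr_divide powr_powr powr_minus_divide)
  finally have "r powr q * w powr q \<le> r powr q * (r powr (q * q / (p - q)) * \<tau> powr (- q / (p - q)))"
    by (intro mult_left_mono) auto
  also have "\<dots> = \<tau> powr (- q / (p - q)) * r powr (q + q * q / (p - q))"
    by (simp add: powr_add)
  also have "q + q * q / (p - q) = p * q / (p - q)" using assms by (simp add: field_simps)
  finally show ?thesis using assms by (simp add: powr_mult add_increasing)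
qed

section \<open>The contradiction argument in L^p\<close>

theorem mainTheorem9:
  fixes M :: "'a measure" and H :: "'a \<Rightarrow> real^'d \<Rightarrow> real^'n"
    and C_H p q :: real
  assumes fin: "finite_measure M"
    and compl: "complete_measure M"
    and N1_meas: "(\<lambda>(x, z). H x z) \<in> borel_measurable (M \<Otimes>\<^sub>M borel)"
    and N1_lip: "\<forall>x\<in>space M. \<forall>z. \<exists>e>0. \<exists>L. L-lipschitz_on (cball z e) (H x)"
    and pq: "1 < q" "q < p"
    and CH: "C_H > 0"
    and N2_H: "\<forall>x\<in>space M. \<forall>z. norm (H x z) \<le> C_H * (1 + norm z powr (p / q))"
    and N2_J: "\<forall>x\<in>space M. \<forall>z. \<forall>A\<in>clarke_jac (H x) z.
                  norm A \<le> C_H * (1 + norm z powr (p / q - 1))"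
  shows "\<forall>\<epsilon>>0. \<forall>ub. Lp_mem M p ub \<longrightarrow>
           (\<exists>\<delta>>0. \<forall>u v. Lp_mem M p u \<and> Lp_mem M p v
              \<and> Lp_norm M p (\<lambda>x. u x - ub x) \<le> \<delta> \<and> Lp_norm M p (\<lambda>x. v x - ub x) \<le> \<delta>
              \<and> Lp_norm M p (\<lambda>x. u x - v x) \<noteq> 0 \<longrightarrow>
              (\<exists>A \<in> clarke_nemytskii M H ub.
                 Lp_norm M q (\<lambda>x. H x (u x) - H x (v x) - A x *v (u x - v x))
                   < \<epsilon> * Lp_norm M p (\<lambda>x. u x - v x)))"
proof (intro allI impI)
  fix \<epsilon> :: real and ub :: "'a \<Rightarrow> real^'d"
  assume eps: "0 < \<epsilon>" and ub: "Lp_mem M p ub"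
  interpret finite_measure M by (rule fin)
  have p1: "p > 1" using pq by simp
  have ll: "locally_lipschitz (H x)" if "x \<in> space M" for x
    unfolding locally_lipschitz_def using N1_lip that by blast
  obtain Q :: "(real^'d) set" where Q: "countable Q" "closure Q = UNIV"
  proof -
    obtain D :: "(real^'d) set" where D: "countable D" "\<And>X. open X \<Longrightarrow> X \<noteq> {} \<Longrightarrow> \<exists>d\<in>D. d \<in> X"
      by (metis countable_dense_setE)
    have "x \<in> closure D" for x
      unfolding closure_approachable
    proof (intro allI impI)
      fix e :: real assume "0 < e"
      then obtain d where "d \<in> D" "d \<in> ball x e" using D(2)[of "ball x e"] by auto
      then show "\<exists>d\<in>D. dist d x < e" by (auto simp: dist_commute)
    qed
    then show thesis using that D(1) by blast
  qed
  define \<alpha> where "\<alpha> = p / q - 1"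
  have \<alpha>: "\<alpha> > 0" using pq by (simp add: \<alpha>_def)
  \<comment> \<open>The identity \<open>\<alpha> * s = p\<close> will turn the growth of order
    \<alpha> of the Jacobians into integrability of order \<open>p\<close>.\<close>
  define s where "s = p * q / (p - q)"
  have s: "s > 0" "\<alpha> * s = p" using pq by (simp_all add: s_def \<alpha>_def field_simps)
  \<comment> \<open>Chosen so that \<open>\<delta> k powr p\<close> is 2^(-k), hence summable: the
    whole sequences then converge almost everywhere, without passing to subsequences, and the sum of
    the p-th powers serves in the dominating function.\<close>
  define \<delta> where "\<delta> k = ((1 / 2) ^ k) powr (1 / p)" for k :: nat
  have \<delta>: "\<delta> k > 0" for k by (simp add: \<delta>_def)
  have [measurable]: "ub \<in> borel_measurable M" using ub by (simp add: Lp_mem_def)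
  show "\<exists>\<delta>>0. \<forall>u v. Lp_mem M p u \<and> Lp_mem M p v
              \<and> Lp_norm M p (\<lambda>x. u x - ub x) \<le> \<delta> \<and> Lp_norm M p (\<lambda>x. v x - ub x) \<le> \<delta>
              \<and> Lp_norm M p (\<lambda>x. u x - v x) \<noteq> 0 \<longrightarrow>
              (\<exists>A \<in> clarke_nemytskii M H ub.
                 Lp_norm M q (\<lambda>x. H x (u x) - H x (v x) - A x *v (u x - v x))
                   < \<epsilon> * Lp_norm M p (\<lambda>x. u x - v x))"
    (is "\<exists>\<delta>>0. \<forall>u v. ?hyp \<delta> u v \<longrightarrow> ?concl u v")
  proof (rule ccontr)
    assume neg: "\<not> (\<exists>\<delta>>0. \<forall>u v. ?hyp \<delta> u v \<longrightarrow> ?concl u v)"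
    define bad where "bad k u v \<longleftrightarrow> ?hyp (\<delta> k) u v \<and> \<not> ?concl u v" for k u v
    have "\<exists>u v. bad k u v" for k unfolding bad_def using neg \<delta>[of k] by blast
    then obtain u v where bad: "\<And>k. bad k (u k) (v k)" by metis
    have uv: "?hyp (\<delta> k) (u k) (v k)" for k using bad[of k] unfolding bad_def by (rule conjunct1)
    have no: "\<not> ?concl (u k) (v k)" for k using bad[of k] unfolding bad_def by (rule conjunct2)
    have [measurable]: "u k \<in> borel_measurable M" "v k \<in> borel_measurable M" for k
      using uv[of k] by (auto simp: Lp_mem_def)
    have Hm[measurable]: "(\<lambda>x. H x (g x)) \<in> borel_measurable M" if [measurable]: "g \<in> borel_measurable M" for g
    proof -
      have "(\<lambda>x. (x, g x)) \<in> measurable M (M \<Otimes>\<^sub>M borel)" by measurable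
      from measurable_compose[OF this N1_meas] show ?thesis by simp
    qed

    define y where "y k x = H x (u k x) - H x (v k x)" for k x
    define w where "w k x = u k x - v k x" for k x
    have ym[measurable]: "y k \<in> borel_measurable M" and wm[measurable]: "w k \<in> borel_measurable M" for k
      unfolding y_def[abs_def] w_def[abs_def] by measurable
    define \<Gamma> where "\<Gamma> x = (\<Inter>n. mean_jac_hull Q (H x) (ub x) (1 / real (Suc n)))" for x
    have "\<exists>A. A \<in> borel_measurable M \<and> (\<forall>x\<in>space M. A x \<in> \<Gamma> x) \<and> (\<forall>x\<in>space M. \<forall>B\<in>\<Gamma> x.
       norm (y k x - A x *v w k x) / norm (w k x) \<le> norm (y k x - B *v w k x) / norm (w k x) + inverse (real (Suc k)))" for k
    proof -
      obtain A where "A \<in> borel_measurable M" "\<And>x. x \<in> space M \<Longrightarrow> A x \<in> \<Gamma> x"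
       "\<And>x B. x \<in> space M \<Longrightarrow> B \<in> \<Gamma> x \<Longrightarrow>
       norm (y k x - A x *v w k x) / norm (w k x) \<le> norm (y k x - B *v w k x) / norm (w k x) + inverse (real (Suc k))"
        unfolding \<Gamma>_def
        by (rule measurable_clarke_selection[OF N1_meas ll, of ub "w k" "y k" Q "inverse (real (Suc k))"])
          (use Q in auto)
      then show ?thesis by blast
    qed
    then obtain A where A: "\<And>k. A k \<in> borel_measurable M" "\<And>k x. x \<in> space M \<Longrightarrow> A k x \<in> \<Gamma> x"
      "\<And>k x B. x \<in> space M \<Longrightarrow> B \<in> \<Gamma> x \<Longrightarrow> norm (y k x - A k x *v w k x) / norm (w k x)
         \<le> norm (y k x - B *v w k x) / norm (w k x) + inverse (real (Suc k))"
      by metis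
    have Acl: "A k \<in> clarke_nemytskii M H ub" for k
    proof -
      have "A k x \<in> clarke_jac (H x) (ub x)" if "x \<in> space M" for x
        using A(2)[OF that, of k] Inter_mean_jac_hull_subset_clarke[OF ll[OF that]] unfolding \<Gamma>_def by blast
      then show ?thesis using A(1)[of k] by (auto simp: clarke_nemytskii_def)
    qed
    define R where "R k x = norm (y k x - A k x *v w k x) / norm (w k x)" for k x
    have R0: "0 \<le> R k x" for k x by (simp add: R_def)
    have resm[measurable]: "(\<lambda>x. y k x - A k x *v w k x) \<in> borel_measurable M" for k
      by (intro borel_measurable_diff borel_measurable_matrix_vector_mul ym wm A(1))
    have [measurable]: "R k \<in> borel_measurable M" for k unfolding R_def[abs_def] by measurable
    \<comment> \<open>Where \<open>w k x = 0\<close> both sides vanish, because then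
      \<open>y k x = 0\<close> as well.\<close>
    have res: "norm (y k x - A k x *v w k x) = R k x * norm (w k x)" for k x
      by (cases "w k x = 0") (auto simp: R_def y_def w_def)

    define d where "d k x = norm (u k x - ub x) powr p + norm (v k x - ub x) powr p" for k x
    have dint: "integrable M (d k)" for k
      unfolding d_def[abs_def] using uv[of k] ub p1
      by (intro Bochner_Integration.integrable_add integrable_powr_diff) auto
    have small: "(\<integral>x. norm (f x) powr p \<partial>M) \<le> (1 / 2) ^ k" if "Lp_norm M p f \<le> \<delta> k" for f :: "'a \<Rightarrow> real^'d" and k
    proof -
      define I where "I = (\<integral>x. norm (f x) powr p \<partial>M)"
      have "0 \<le> I" unfolding I_def by (rule integral_nonneg_AE) auto
      have "I powr (1 / p) \<le> ((1 / 2) ^ k) powr (1 / p)"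
        using that unfolding Lp_norm_def \<delta>_def I_def .
      then have "(I powr (1 / p)) powr p \<le> (((1 / 2) ^ k) powr (1 / p)) powr p"
        by (rule powr_mono2[rotated 2]) (use p1 in auto)
      then have "I \<le> (1 / 2) ^ k" using p1 \<open>0 \<le> I\<close> by (simp add: powr_powr)
      then show ?thesis by (simp add: I_def)
    qed
    have "summable (\<lambda>k. \<integral>x. d k x \<partial>M)"
    proof (rule summable_comparison_test'[where g = "\<lambda>k. 2 * (1 / 2) ^ k" and N = 0])
      show "summable (\<lambda>k. 2 * (1 / 2) ^ k :: real)" by (intro summable_mult summable_geometric) auto
      fix k :: nat
      have "(\<integral>x. d k x \<partial>M) = (\<integral>x. norm (u k x - ub x) powr p \<partial>M) + (\<integral>x. norm (v k x - ub x) powr p \<partial>M)"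
        unfolding d_def using uv[of k] ub p1 by (intro Bochner_Integration.integral_add integrable_powr_diff) auto
      also have "\<dots> \<le> (1 / 2) ^ k + (1 / 2) ^ k" using uv[of k] by (intro add_mono small) auto
      finally have "(\<integral>x. d k x \<partial>M) \<le> 2 * (1 / 2) ^ k" by simp
      moreover have "0 \<le> (\<integral>x. d k x \<partial>M)" by (rule integral_nonneg_AE) (simp add: d_def)
      ultimately show "norm (\<integral>x. d k x \<partial>M) \<le> 2 * (1 / 2) ^ k" by simp
    qed
    from AE_summable_if_summable_integrals[where f = d, OF dint _ this]
    have dsum: "AE x in M. summable (\<lambda>k. d k x)" and gint: "integrable M (\<lambda>x. \<Sum>k. d k x)"
      by (auto simp: d_def)
    define g where "g x = (\<Sum>k. d k x)" for x
    \<comment> \<open>The constants come from the estimate of \<open>Y powr p\<close> below, which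
      applies \<open>powr_add_le\<close> to \<open>(norm (ub x) + 1) + (a + b)\<close> and then to
      each of the two inner sums.\<close>
    define Dom where "Dom x = (4 * C_H) powr s * (2 powr p * (2 powr p * (norm (ub x) powr p + 1) + 2 powr p * g x))" for x
    have Dint: "integrable M Dom"
      unfolding Dom_def[abs_def] using ub gint
      by (intro integrable_mult_right Bochner_Integration.integrable_add) (auto simp: Lp_mem_def g_def)
    have bound: "R k x powr s \<le> Dom x" if x: "x \<in> space M" and sx: "summable (\<lambda>k. d k x)" for k x
    proof -
      have "d k x \<le> g x"
        unfolding g_def using sum_le_suminf[OF sx, of "{k}"] by (simp add: d_def)
      define a where "a = norm (u k x - ub x)"
      define b where "b = norm (v k x - ub x)"
      \<comment> \<open>Large enough for \<open>u k x\<close> and \<open>v k x\<close> to lie in the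
        open ball about \<open>ub x\<close>, and at least 1 as \<open>clarke_residual_bound\<close>
        demands.\<close>
      define r where "r = a + b + 1"
      have ab: "0 \<le> a" "0 \<le> b" "1 \<le> r" by (auto simp: a_def b_def r_def)
      define Y where "Y = norm (ub x) + r"
      have Y: "1 \<le> Y" using ab(3) norm_ge_zero[of "ub x"] unfolding Y_def by linarith
      \<comment> \<open>Since \<open>Y \<ge> 1\<close>, the constant 1 in the growth bound is
        absorbed by \<open>Y powr \<alpha>\<close>; hence the factor 2.\<close>
      define K where "K = 2 * C_H * Y powr \<alpha>"
      have "norm (jac (H x) z) \<le> K" if z: "z \<in> ball (ub x) r" and dz: "H x differentiable (at z)" for z
      proof -
        \<comment> \<open>The constant sequence at a point of differentiability shows that the
          Jacobian there is a Clarke element, so that \<open>N2_J\<close> bounds it.\<close>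
        have "jac (H x) z \<in> clarke_jac (H x) z"
          unfolding clarke_jac_def jac_eq_jacobian[OF dz]
          by (intro hull_inc CollectI exI[of _ "\<lambda>_. z"]) (use dz in auto)
        then have "norm (jac (H x) z) \<le> C_H * (1 + norm z powr \<alpha>)"
          using N2_J x by (auto simp: \<alpha>_def)
        also have "norm z \<le> Y" using z norm_triangle_sub[of z "ub x"] by (simp add: Y_def dist_norm norm_minus_commute)
        then have "norm z powr \<alpha> \<le> Y powr \<alpha>" using \<alpha> by (intro powr_mono2) auto
        then have "C_H * (1 + norm z powr \<alpha>) \<le> C_H * (Y powr \<alpha> + Y powr \<alpha>)"
          using CH Y \<alpha> by (intro mult_left_mono add_mono ge_one_powr_ge_zero) auto
        finally show ?thesis by (simp add: K_def)
      qed
      then have "R k x \<le> 2 * K"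
        unfolding R_def y_def w_def
        by (rule clarke_residual_bound[OF ll[OF x] Q(2), where r = r])
          (use ab A(2)[OF x, of k] in \<open>auto simp: a_def b_def r_def \<Gamma>_def dist_norm norm_minus_commute add_nonneg_pos\<close>)
      then have "R k x \<le> 4 * C_H * Y powr \<alpha>" by (simp add: K_def)
      then have "R k x powr s \<le> (4 * C_H * Y powr \<alpha>) powr s" using s R0 by (intro powr_mono2) auto
      also have "\<dots> = (4 * C_H) powr s * Y powr p"
        using CH s by (simp add: powr_mult powr_powr)
      also have "Y powr p \<le> 2 powr p * (2 powr p * (norm (ub x) powr p + 1) + 2 powr p * g x)"
      proof -
        have "Y powr p = ((norm (ub x) + 1) + (a + b)) powr p" by (simp add: Y_def r_def algebra_simps)
        also have "\<dots> \<le> 2 powr p * ((norm (ub x) + 1) powr p + (a + b) powr p)"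
          using ab p1 by (intro powr_add_le) auto
        also have "\<dots> \<le> 2 powr p * (2 powr p * (norm (ub x) powr p + 1 powr p) + 2 powr p * (a powr p + b powr p))"
          using ab p1 by (intro mult_left_mono add_mono powr_add_le) auto
        also have "\<dots> \<le> 2 powr p * (2 powr p * (norm (ub x) powr p + 1) + 2 powr p * g x)"
          using \<open>d k x \<le> g x\<close> by (intro mult_left_mono add_mono) (auto simp: d_def a_def b_def)
        finally show ?thesis .
      qed
      finally show ?thesis by (simp add: Dom_def mult_left_mono)
    qed
    have "AE x in M. (\<lambda>k. R k x powr s) \<longlonglongrightarrow> 0"
      using dsum AE_space
    proof eventually_elim
      case (elim x)
      have d0: "(\<lambda>k. d k x) \<longlonglongrightarrow> 0" using elim(1) by (rule summable_LIMSEQ_zero)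
      have conv: "(\<lambda>k. f k x) \<longlonglongrightarrow> ub x" if "\<And>k. norm (f k x - ub x) powr p \<le> d k x" for f :: "nat \<Rightarrow> 'a \<Rightarrow> real^'d"
      proof -
        have "(\<lambda>k. norm (f k x - ub x) powr p) \<longlonglongrightarrow> 0"
          by (rule tendsto_sandwich[OF _ _ tendsto_const d0]) (use that in auto)
        then have "(\<lambda>k. (norm (f k x - ub x) powr p) powr (1 / p)) \<longlonglongrightarrow> 0"
          by (rule tendsto_zero_powrI[OF _ tendsto_const]) (use p1 in auto)
        then have "(\<lambda>k. norm (f k x - ub x)) \<longlonglongrightarrow> 0" using p1 by (simp add: powr_powr)
        then show ?thesis by (simp add: tendsto_norm_zero_iff LIM_zero_iff)
      qed
      have "(\<lambda>k. R k x) \<longlonglongrightarrow> 0"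
        unfolding R_def y_def w_def
      proof (rule clarke_residual_tendsto_0[OF ll[OF elim(2)] Q(2)])
        show "(\<lambda>k. u k x) \<longlonglongrightarrow> ub x" "(\<lambda>k. v k x) \<longlonglongrightarrow> ub x" by (intro conv; simp add: d_def)+
      qed (use A(3)[OF elim(2)] in \<open>auto simp: \<Gamma>_def y_def w_def\<close>)
      then show ?case
        by (rule tendsto_zero_powrI[OF _ tendsto_const]) (use s R0 in auto)
    qed
    then have Rlim: "(\<lambda>k. \<integral>x. R k x powr s \<partial>M) \<longlonglongrightarrow> (\<integral>x. 0 \<partial>M)" and Rint: "\<And>k. integrable M (\<lambda>x. R k x powr s)"
    proof -
      assume lim: "AE x in M. (\<lambda>k. R k x powr s) \<longlonglongrightarrow> 0"
      have bd: "AE x in M. norm (R k x powr s) \<le> Dom x" for k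
        using dsum AE_space by eventually_elim (use bound in auto)
      show "(\<lambda>k. \<integral>x. R k x powr s \<partial>M) \<longlonglongrightarrow> (\<integral>x. 0 \<partial>M)"
        by (rule integral_dominated_convergence[OF _ _ Dint lim bd]) measurable
      show "integrable M (\<lambda>x. R k x powr s)" for k
        by (rule integrable_dominated_convergence2[OF _ _ Dint lim bd]) measurable
    qed

    \<comment> \<open>Half of \<open>\<epsilon> powr q\<close> is reserved for each of the two terms
      of \<open>powr_mult_le_powr_add_powr\<close>.\<close>
    define \<tau> where "\<tau> = \<epsilon> powr q / 2"
    have \<tau>: "\<tau> > 0" using eps by (simp add: \<tau>_def)
    define c where "c = \<tau> powr (- q / (p - q))"
    have "(\<lambda>k. c * (\<integral>x. R k x powr s \<partial>M)) \<longlonglongrightarrow> 0"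
      using tendsto_mult_right_zero[OF Rlim[simplified], of c] by simp
    then have "\<forall>\<^sub>F k in sequentially. c * (\<integral>x. R k x powr s \<partial>M) < \<tau>"
      using \<tau> by (rule order_tendstoD(2))
    then obtain k where k: "c * (\<integral>x. R k x powr s \<partial>M) < \<tau>"
      by (auto simp: eventually_sequentially)
    define N where "N = Lp_norm M p (w k)"
    define W where "W = (\<integral>x. norm (w k x) powr p \<partial>M)"
    have "N \<noteq> 0" using uv[of k] by (simp add: N_def w_def[abs_def])
    moreover have N_eq: "N = W powr (1 / p)" by (simp add: N_def W_def Lp_norm_def)
    ultimately have N: "N > 0" by (metis powr_ge_zero order_less_le)
    have "W \<ge> 0" unfolding W_def by (rule integral_nonneg_AE) auto
    then have NW: "N powr p = W" using p1 by (simp add: N_eq powr_powr)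
    have wint: "integrable M (\<lambda>x. norm (w k x) powr p)"
      unfolding w_def using uv[of k] p1 by (intro integrable_powr_diff) auto
    \<comment> \<open>Dividing \<open>w k x\<close> by \<open>N\<close> normalises it in L^p, so the
      first term integrates to exactly \<tau>, and the smallness condition that fixed
      \<open>k\<close> does not involve \<open>N\<close>.\<close>
    have pw: "norm (y k x - A k x *v w k x) powr q
        \<le> N powr q * (\<tau> * (norm (w k x) powr p / W) + c * R k x powr s)" for x
    proof -
      have "norm (y k x - A k x *v w k x) powr q = (N * (R k x * (norm (w k x) / N))) powr q"
        using N by (simp add: res)
      also have "\<dots> = N powr q * (R k x * (norm (w k x) / N)) powr q"
        using N R0 by (subst powr_mult) auto
      also have "\<dots> \<le> N powr q * (\<tau> * (norm (w k x) / N) powr p + c * R k x powr s)"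
        unfolding c_def s_def using N R0 pq \<tau> by (intro mult_left_mono powr_mult_le_powr_add_powr) auto
      also have "(norm (w k x) / N) powr p = norm (w k x) powr p / W"
        using N by (simp add: powr_divide NW)
      finally show ?thesis .
    qed
    have dom: "integrable M (\<lambda>x. N powr q * (\<tau> * (norm (w k x) powr p / W) + c * R k x powr s))"
      using wint Rint[of k] by (intro integrable_mult_right Bochner_Integration.integrable_add integrable_divide) auto
    have "(\<integral>x. norm (y k x - A k x *v w k x) powr q \<partial>M)
        \<le> (\<integral>x. N powr q * (\<tau> * (norm (w k x) powr p / W) + c * R k x powr s) \<partial>M)"
    proof (rule integral_mono[OF _ dom pw])
      show "integrable M (\<lambda>x. norm (y k x - A k x *v w k x) powr q)"
        by (rule Bochner_Integration.integrable_bound[OF dom])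
          (use pw in \<open>auto intro!: AE_I2 order_trans[OF _ abs_ge_self]\<close>)
    qed
    also have "\<dots> = N powr q * (\<tau> * (W / W) + c * (\<integral>x. R k x powr s \<partial>M))"
      using wint Rint[of k] by (simp add: W_def)
    also have "\<dots> < N powr q * (\<tau> + \<tau>)"
      using k N NW by (intro mult_strict_left_mono) auto
    also have "\<dots> = (N * \<epsilon>) powr q" using N eps by (simp add: \<tau>_def powr_mult)
    finally have less: "(\<integral>x. norm (y k x - A k x *v w k x) powr q \<partial>M) < (N * \<epsilon>) powr q" .
    have "Lp_norm M q (\<lambda>x. y k x - A k x *v w k x) < ((N * \<epsilon>) powr q) powr (1 / q)"
      unfolding Lp_norm_def using less pq by (intro powr_less_mono2 integral_nonneg_AE) auto
    also have "\<dots> = \<epsilon> * N" using pq N eps by (simp add: powr_powr mult.commute)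
    finally have "?concl (u k) (v k)"
      using Acl[of k] by (auto simp: y_def[abs_def] w_def[abs_def] N_def)
    with no show False by blast
  qed
qed

end
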